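(* Let $\alpha>0$, $\sigma>0$, and let $V:\mathbb{R}\to\mathbb{R}$ and an $L$-periodic $p:\mathbb{R}\to\mathbb{R}$ satisfy the standing assumptions in the context. For $\epsilon>0$ let $x^\epsilon(t)\in\mathbb{R}$ solve $$dx^\epsilon(t) = -\alpha V'(x^\epsilon(t))\,dt - \frac{1}{\epsilon}p'\Big(\frac{x^\epsilon(t)}{\epsilon}\Big)\,dt + \sqrt{2\sigma}\,d\beta(t),$$ with $\beta$ a standard one-dimensional Brownian motion and $x^\epsilon(0)$ distributed according to the invariant measure of the process. For $\delta>0$, $N\in\mathbb{N}$ and $x_n=x(n\delta)$ define $$\widehat{A}_{N,\delta}(x) = -\frac{\sum_{n=0}^{N-1}V'(x_n)(x_{n+1}-x_n)}{\sum_{n=0}^{N-1}|V'(x_n)|^2\,\delta}.$$ Let $\delta=\epsilon^{\kappa}$ with $\kappa\in(0,1)$ and $N=[\epsilon^{-\gamma}]$ with $\gamma>\kappa$, where $[\cdot]$ denotes the integer part. Then $$\lim_{\epsilon\to0}\widehat{A}_{N,\delta}(x^\epsilon)=A\quad\text{in law},$$ where $A=\dfrac{\alpha L^2}{Z\widehat{Z}}$, $Z=\int_0^L e^{-p(y)/\sigma}\,dy$, $\widehat{Z}=\int_0^L e^{p(y)/\sigma}\,dy$.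
   Context: Standing assumptions: $p\in C^\infty(\mathbb{R})$ is $L$-periodic; $V\in C^\infty(\mathbb{R})$; $V'$ is globally Lipschitz; there exist $a,b>0$ with $-V'(x)x\le a-bx^2$ for all $x$; $e^{-\frac{\alpha}{\sigma}V}\in L^1(\mathbb{R})$. *)

theory Defs
  imports "HOL-Probability.Probability"
begin

definition smooth_real :: "(real \<Rightarrow> real) \<Rightarrow> bool" where
  "smooth_real f \<longleftrightarrow> (\<exists>D :: nat \<Rightarrow> real \<Rightarrow> real. D 0 = f \<and>
      (\<forall>n x. (D n has_real_derivative D (Suc n) x) (at x)))"

definition brownian_motion_indep ::
  "'a measure \<Rightarrow> ('a \<Rightarrow> real) \<Rightarrow> ('a \<Rightarrow> real \<Rightarrow> real) \<Rightarrow> bool" where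
  "brownian_motion_indep M xi B \<longleftrightarrow>
     xi \<in> borel_measurable M \<and>
     (\<forall>t. (\<lambda>\<omega>. B \<omega> t) \<in> borel_measurable M) \<and>
     (AE \<omega> in M. B \<omega> 0 = 0 \<and> continuous_on {0..} (B \<omega>)) \<and>
     (\<forall>s t. 0 \<le> s \<longrightarrow> s < t \<longrightarrow>
        distributed M lborel (\<lambda>\<omega>. B \<omega> t - B \<omega> s)
          (\<lambda>x. ennreal (normal_density 0 (sqrt (t - s)) x))) \<and>
     (\<forall>(ts :: nat \<Rightarrow> real) n. 0 \<le> ts 0 \<longrightarrow> (\<forall>i<n. ts i < ts (Suc i)) \<longrightarrow>
        prob_space.indep_vars M (\<lambda>_. borel)
          (\<lambda>i \<omega>. if i = 0 then xi \<omega> else B \<omega> (ts i) - B \<omega> (ts (i - 1))) {0..n})"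

definition drift_estimator ::
  "(real \<Rightarrow> real) \<Rightarrow> real \<Rightarrow> nat \<Rightarrow> (real \<Rightarrow> real) \<Rightarrow> real" where
  "drift_estimator V' \<delta> N x =
     - (\<Sum>n<N. V' (x (real n * \<delta>)) * (x (real (Suc n) * \<delta>) - x (real n * \<delta>)))
       / (\<Sum>n<N. (V' (x (real n * \<delta>)))\<^sup>2 * \<delta>)"

definition converges_in_law :: "('b \<Rightarrow> real measure) \<Rightarrow> real measure \<Rightarrow> 'b filter \<Rightarrow> bool" where
  "converges_in_law \<mu> \<nu> F \<longleftrightarrow>
     (\<forall>f :: real \<Rightarrow> real. continuous_on UNIV f \<and> bounded (range f) \<longrightarrow>
        ((\<lambda>i. integral\<^sup>L (\<mu> i) f) \<longlongrightarrow> integral\<^sup>L \<nu> f) F)"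

end

(* The map S(x) = x + eps H(x / eps) with S'(x) proportional to exp(p(x / eps) / sigma) removes the
   singular drift: its generator is -alpha V' S', so S(x_{n+1}) - S(x_n) is a drift integral plus a
   martingale increment, while S(x) - x is of order eps. After division by N delta = T, the martingale
   part of the numerator is of order T^{-1/2}, the corrector boundary terms are of order eps / delta,
   and a second cell problem replaces S' by its mean L^2 / (Z Zhat). A third test function, whose
   generator is at least c - C |V'|, keeps the denominator away from 0. Its ergodic limit is never
   needed, since it cancels in the quotient.

   No stochastic integral is used. As the noise is additive, each of these statements is Ito's
   formula for one test function and follows from a Taylor expansion over a fine time grid, where
   independence of the Brownian increments makes the first-order terms orthogonal in L^2. The solution
   is adapted because it is the limit of Euler schemes, and moments of the unknown stationary law come
   from its invariance, applied to truncated powers of S. *)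
theory Submission
  imports Defs
begin

text \<open>The obstacle is uniformity in \<epsilon>: the drift has a Lipschitz constant of order
  \<open>1 / \<epsilon>^2\<close>, and second derivatives of the test functions grow like
  \<open>1 / \<epsilon>\<close>. Two kinds of constants are therefore kept apart. Those of Taylor
  expansions may depend on \<epsilon> in any way, because they multiply powers of a fine mesh that
  tends to 0 while \<epsilon> is fixed. What survives the refinement involves only the sup norm of
  the first derivative, integrals of the generator and moments of the stationary law. This is why
  every test function has a derivative of the form \<open>q (x / \<epsilon>) * g x\<close>:
  \<open>q\<close> is an integrating factor that removes the \<open>1 / \<epsilon>\<close> term from
  the generator. Moments are likewise obtained twice, as mere finiteness for each \<epsilon>, which
  licenses the expansions, and then quantitatively, from the mean of the generator being zero. The
  two exponents enter at separate places. The corrector is paid for once per sample, since its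
  weights prevent telescoping; this calls for \<kappa> < 1. The condition \<gamma> > \<kappa> sends
  the observation time \<open>N * \<delta>\<close> to infinity.\<close>

section \<open>Outer L1 bounds and Riemann sums\<close>

text \<open>The measurable majorant \<open>W\<close> allows \<open>U\<close> to be a time integral along paths, whose measurability is never checked.\<close>

definition L1_bound :: "'a measure \<Rightarrow> ('a \<Rightarrow> real) \<Rightarrow> real \<Rightarrow> bool" where
  "L1_bound M U c \<longleftrightarrow> 0 \<le> c \<and> (\<exists>W\<in>borel_measurable M.
     (AE \<omega> in M. ennreal \<bar>U \<omega>\<bar> \<le> W \<omega>) \<and> (\<integral>\<^sup>+\<omega>. W \<omega> \<partial>M) \<le> ennreal c)"

lemma L1_boundE:
  assumes "L1_bound M U c"
  obtains W where "W \<in> borel_measurable M" "AE \<omega> in M. ennreal \<bar>U \<omega>\<bar> \<le> W \<omega>"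
    "(\<integral>\<^sup>+\<omega>. W \<omega> \<partial>M) \<le> ennreal c" "0 \<le> c"
  using assms unfolding L1_bound_def by blast

lemma L1_boundI:
  assumes "W \<in> borel_measurable M" "AE \<omega> in M. ennreal \<bar>U \<omega>\<bar> \<le> W \<omega>"
    "(\<integral>\<^sup>+\<omega>. W \<omega> \<partial>M) \<le> ennreal c" "0 \<le> c"
  shows "L1_bound M U c"
  using assms unfolding L1_bound_def by blast

lemma L1_bound_nonneg: "L1_bound M U c \<Longrightarrow> 0 \<le> c"
  by (simp add: L1_bound_def)

lemma L1_bound_mono:
  assumes "L1_bound M V c" "AE \<omega> in M. \<bar>U \<omega>\<bar> \<le> \<bar>V \<omega>\<bar>" "c \<le> d"
  shows "L1_bound M U d"
proof -
  obtain W where W: "W \<in> borel_measurable M" "AE \<omega> in M. ennreal \<bar>V \<omega>\<bar> \<le> W \<omega>"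
    "(\<integral>\<^sup>+\<omega>. W \<omega> \<partial>M) \<le> ennreal c" "0 \<le> c" using assms(1) by (rule L1_boundE)
  show ?thesis
  proof (rule L1_boundI[OF W(1)])
    show "AE \<omega> in M. ennreal \<bar>U \<omega>\<bar> \<le> W \<omega>"
      using W(2) assms(2) by eventually_elim (meson ennreal_leI order_trans)
    show "(\<integral>\<^sup>+\<omega>. W \<omega> \<partial>M) \<le> ennreal d"
      using W(3) assms(3) by (meson ennreal_leI order_trans)
  qed (use W(4) assms(3) in linarith)
qed

lemma L1_bound_weaken: "L1_bound M U c \<Longrightarrow> c \<le> d \<Longrightarrow> L1_bound M U d"
  by (rule L1_bound_mono) auto

lemma L1_bound_abs_iff: "L1_bound M (\<lambda>\<omega>. \<bar>U \<omega>\<bar>) c \<longleftrightarrow> L1_bound M U c"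
  by (simp add: L1_bound_def)

lemma L1_bound_add:
  assumes "L1_bound M U c" "L1_bound M V d"
  shows "L1_bound M (\<lambda>\<omega>. U \<omega> + V \<omega>) (c + d)"
proof -
  obtain W where W: "W \<in> borel_measurable M" "AE \<omega> in M. ennreal \<bar>U \<omega>\<bar> \<le> W \<omega>"
    "(\<integral>\<^sup>+\<omega>. W \<omega> \<partial>M) \<le> ennreal c" "0 \<le> c" using assms(1) by (rule L1_boundE)
  obtain Y where Y: "Y \<in> borel_measurable M" "AE \<omega> in M. ennreal \<bar>V \<omega>\<bar> \<le> Y \<omega>"
    "(\<integral>\<^sup>+\<omega>. Y \<omega> \<partial>M) \<le> ennreal d" "0 \<le> d" using assms(2) by (rule L1_boundE)
  show ?thesis
  proof (rule L1_boundI[of "\<lambda>\<omega>. W \<omega> + Y \<omega>"])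
    show "(\<lambda>\<omega>. W \<omega> + Y \<omega>) \<in> borel_measurable M" using W(1) Y(1) by measurable
    show "AE \<omega> in M. ennreal \<bar>U \<omega> + V \<omega>\<bar> \<le> W \<omega> + Y \<omega>"
      using W(2) Y(2)
    proof eventually_elim
      case (elim \<omega>)
      have "ennreal \<bar>U \<omega> + V \<omega>\<bar> \<le> ennreal (\<bar>U \<omega>\<bar> + \<bar>V \<omega>\<bar>)" by (intro ennreal_leI abs_triangle_ineq)
      also have "\<dots> = ennreal \<bar>U \<omega>\<bar> + ennreal \<bar>V \<omega>\<bar>" by simp
      finally show ?case using elim by (meson add_mono order_trans)
    qed
    show "(\<integral>\<^sup>+\<omega>. W \<omega> + Y \<omega> \<partial>M) \<le> ennreal (c + d)"
      using W Y by (simp add: nn_integral_add add_mono)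
  qed (use W Y in simp)
qed

lemma L1_bound_cmult:
  assumes "L1_bound M U c"
  shows "L1_bound M (\<lambda>\<omega>. a * U \<omega>) (\<bar>a\<bar> * c)"
proof -
  obtain W where W: "W \<in> borel_measurable M" "AE \<omega> in M. ennreal \<bar>U \<omega>\<bar> \<le> W \<omega>"
    "(\<integral>\<^sup>+\<omega>. W \<omega> \<partial>M) \<le> ennreal c" "0 \<le> c" using assms(1) by (rule L1_boundE)
  show ?thesis
  proof (rule L1_boundI[of "\<lambda>\<omega>. ennreal \<bar>a\<bar> * W \<omega>"])
    show "(\<lambda>\<omega>. ennreal \<bar>a\<bar> * W \<omega>) \<in> borel_measurable M" using W(1) by measurable
    show "AE \<omega> in M. ennreal \<bar>a * U \<omega>\<bar> \<le> ennreal \<bar>a\<bar> * W \<omega>"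
      using W(2)
    proof eventually_elim
      case (elim \<omega>)
      then show ?case by (simp add: abs_mult ennreal_mult mult_left_mono)
    qed
    show "(\<integral>\<^sup>+\<omega>. ennreal \<bar>a\<bar> * W \<omega> \<partial>M) \<le> ennreal (\<bar>a\<bar> * c)"
      using W by (simp add: nn_integral_cmult ennreal_mult mult_left_mono)
  qed (use W in simp)
qed

lemma L1_bound_diff:
  assumes "L1_bound M U c" "L1_bound M V d"
  shows "L1_bound M (\<lambda>\<omega>. U \<omega> - V \<omega>) (c + d)"
  using L1_bound_add[OF assms(1) L1_bound_cmult[OF assms(2), of "-1"]] by simp

lemma L1_bound_zero: "L1_bound M (\<lambda>\<omega>. 0) 0"
  by (rule L1_boundI[of "\<lambda>_. 0"]) auto

lemma L1_bound_sum:
  assumes "\<And>i. i \<in> A \<Longrightarrow> L1_bound M (U i) (c i)"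
  shows "L1_bound M (\<lambda>\<omega>. \<Sum>i\<in>A. U i \<omega>) (\<Sum>i\<in>A. c i)"
proof (cases "finite A")
  case True
  then show ?thesis using assms
    by (induction A) (auto intro: L1_bound_zero L1_bound_add)
qed (simp add: L1_bound_zero)

lemma L1_bound_integrable:
  assumes "integrable M U" "(\<integral>\<omega>. \<bar>U \<omega>\<bar> \<partial>M) \<le> c"
  shows "L1_bound M U c"
proof (rule L1_boundI[of "\<lambda>\<omega>. ennreal \<bar>U \<omega>\<bar>"])
  show "(\<lambda>\<omega>. ennreal \<bar>U \<omega>\<bar>) \<in> borel_measurable M" using assms(1) by measurable
  have "(\<integral>\<^sup>+\<omega>. ennreal \<bar>U \<omega>\<bar> \<partial>M) = ennreal (\<integral>\<omega>. \<bar>U \<omega>\<bar> \<partial>M)"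
    using assms(1) by (intro nn_integral_eq_integral) auto
  then show "(\<integral>\<^sup>+\<omega>. ennreal \<bar>U \<omega>\<bar> \<partial>M) \<le> ennreal c" using assms(2) by (simp add: ennreal_leI)
  have "0 \<le> (\<integral>\<omega>. \<bar>U \<omega>\<bar> \<partial>M)" by simp
  then show "0 \<le> c" using assms(2) by linarith
qed auto

lemma (in prob_space) L1_bound_const: "L1_bound M (\<lambda>\<omega>. a) \<bar>a\<bar>"
  by (rule L1_bound_integrable) (auto simp: prob_space)

lemma (in prob_space) L1_bound_const_le: "\<bar>a\<bar> \<le> c \<Longrightarrow> L1_bound M (\<lambda>\<omega>. a) c"
  using L1_bound_const L1_bound_weaken by blast

lemma L1_bound_imp_integrable:
  assumes "L1_bound M U c" "U \<in> borel_measurable M"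
  shows "integrable M U" "(\<integral>\<omega>. \<bar>U \<omega>\<bar> \<partial>M) \<le> c" "\<bar>\<integral>\<omega>. U \<omega> \<partial>M\<bar> \<le> c"
proof -
  obtain W where W: "W \<in> borel_measurable M" "AE \<omega> in M. ennreal \<bar>U \<omega>\<bar> \<le> W \<omega>"
    "(\<integral>\<^sup>+\<omega>. W \<omega> \<partial>M) \<le> ennreal c" "0 \<le> c" using assms(1) by (rule L1_boundE)
  have le: "(\<integral>\<^sup>+\<omega>. ennreal \<bar>U \<omega>\<bar> \<partial>M) \<le> ennreal c"
    using nn_integral_mono_AE[OF W(2)] W(3) by (rule order_trans)
  show int: "integrable M U"
    using le assms(2) by (intro integrableI_bounded) (auto simp: less_top[symmetric] top_unique)
  have "ennreal (\<integral>\<omega>. \<bar>U \<omega>\<bar> \<partial>M) = (\<integral>\<^sup>+\<omega>. ennreal \<bar>U \<omega>\<bar> \<partial>M)"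
    using int by (intro nn_integral_eq_integral[symmetric]) auto
  with le have "ennreal (\<integral>\<omega>. \<bar>U \<omega>\<bar> \<partial>M) \<le> ennreal c" by (simp only:)
  then show le': "(\<integral>\<omega>. \<bar>U \<omega>\<bar> \<partial>M) \<le> c" using W(4) by (subst (asm) ennreal_le_iff)
  show "\<bar>\<integral>\<omega>. U \<omega> \<partial>M\<bar> \<le> c" using integral_abs_bound[of M U] le' by linarith
qed

lemma L1_bound_AE_cong:
  assumes "L1_bound M V c" "AE \<omega> in M. U \<omega> = V \<omega>"
  shows "L1_bound M U c"
  by (rule L1_bound_mono[OF assms(1)]) (use assms(2) in auto)

text \<open>The lower limit of the measurable majorants is a measurable majorant of the limit, so
  Fatou's lemma is applied to the majorants instead of to \<open>U n\<close>. Vanishing meshes and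
  removed truncations all pass to the limit through this rule.\<close>

lemma L1_bound_Fatou:
  assumes U: "\<And>n. L1_bound M (U n) (a n)" and lim: "AE \<omega> in M. (\<lambda>n. U n \<omega>) \<longlonglongrightarrow> V \<omega>"
    and a: "a \<longlonglongrightarrow> c"
  shows "L1_bound M V c"
proof -
  have "\<exists>W. W \<in> borel_measurable M \<and> (AE \<omega> in M. ennreal \<bar>U n \<omega>\<bar> \<le> W \<omega>) \<and>
    (\<integral>\<^sup>+\<omega>. W \<omega> \<partial>M) \<le> ennreal (a n)" for n
    using U[of n] unfolding L1_bound_def by blast
  then obtain W where W: "\<And>n. W n \<in> borel_measurable M"
    "\<And>n. AE \<omega> in M. ennreal \<bar>U n \<omega>\<bar> \<le> W n \<omega>" "\<And>n. (\<integral>\<^sup>+\<omega>. W n \<omega> \<partial>M) \<le> ennreal (a n)"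
    by metis
  show ?thesis
  proof (rule L1_boundI[of "\<lambda>\<omega>. liminf (\<lambda>n. W n \<omega>)"])
    show "(\<lambda>\<omega>. liminf (\<lambda>n. W n \<omega>)) \<in> borel_measurable M" using W(1) by measurable
    have "AE \<omega> in M. \<forall>n. ennreal \<bar>U n \<omega>\<bar> \<le> W n \<omega>" using W(2) by (simp add: AE_all_countable)
    then show "AE \<omega> in M. ennreal \<bar>V \<omega>\<bar> \<le> liminf (\<lambda>n. W n \<omega>)" using lim
    proof eventually_elim
      case (elim \<omega>)
      have "(\<lambda>n. ennreal \<bar>U n \<omega>\<bar>) \<longlonglongrightarrow> ennreal \<bar>V \<omega>\<bar>"
        using elim(2) by (intro tendsto_ennrealI tendsto_rabs)
      then have "ennreal \<bar>V \<omega>\<bar> = liminf (\<lambda>n. ennreal \<bar>U n \<omega>\<bar>)"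
        by (intro lim_imp_Liminf[symmetric]) auto
      also have "\<dots> \<le> liminf (\<lambda>n. W n \<omega>)" using elim(1) by (intro Liminf_mono) auto
      finally show ?case .
    qed
    have "(\<integral>\<^sup>+\<omega>. liminf (\<lambda>n. W n \<omega>) \<partial>M) \<le> liminf (\<lambda>n. \<integral>\<^sup>+\<omega>. W n \<omega> \<partial>M)"
      using W(1) by (rule nn_integral_liminf)
    also have "\<dots> \<le> liminf (\<lambda>n. ennreal (a n))" using W(3) by (intro Liminf_mono) auto
    also have "\<dots> = ennreal c" using a by (intro lim_imp_Liminf tendsto_ennrealI) auto
    finally show "(\<integral>\<^sup>+\<omega>. liminf (\<lambda>n. W n \<omega>) \<partial>M) \<le> ennreal c" .
    show "0 \<le> c" using a U[THEN L1_bound_nonneg] by (meson LIMSEQ_le_const)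
  qed
qed

lemma abs_mult_le_weighted_squares:
  fixes x y \<theta> :: real assumes "0 < \<theta>"
  shows "\<bar>x * y\<bar> \<le> (\<theta> * x\<^sup>2 + y\<^sup>2 / \<theta>) / 2"
proof -
  have "0 \<le> (\<theta> * \<bar>x\<bar> - \<bar>y\<bar>)\<^sup>2 / \<theta>" using assms by simp
  also have "\<dots> = \<theta> * x\<^sup>2 + y\<^sup>2 / \<theta> - 2 * \<bar>x * y\<bar>"
    using assms by (simp add: power2_diff power_mult_distrib abs_mult field_simps power2_eq_square)
  finally show ?thesis by simp
qed

lemma L1_bound_mult_weighted:
  assumes "L1_bound M (\<lambda>\<omega>. (U \<omega>)\<^sup>2) a" "L1_bound M (\<lambda>\<omega>. (V \<omega>)\<^sup>2) b" "0 < \<theta>"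
  shows "L1_bound M (\<lambda>\<omega>. U \<omega> * V \<omega>) ((\<theta> * a + b / \<theta>) / 2)"
proof (rule L1_bound_mono[OF L1_bound_add[OF L1_bound_cmult[OF assms(1), of "\<theta>/2"] L1_bound_cmult[OF assms(2), of "1/(2*\<theta>)"]]])
  show "AE \<omega> in M. \<bar>U \<omega> * V \<omega>\<bar> \<le> \<bar>\<theta>/2 * (U \<omega>)\<^sup>2 + 1/(2*\<theta>) * (V \<omega>)\<^sup>2\<bar>"
    using abs_mult_le_weighted_squares[OF assms(3)] assms(3)
    by (auto simp: field_simps intro!: AE_I2 order_trans[OF _ abs_ge_self])
qed (use assms(3) in \<open>simp add: field_simps\<close>)

text \<open>Cauchy-Schwarz for outer bounds: \<open>b / a\<close> is the weight that minimises the
  Young bound, and both constants are positive so that it can be formed.\<close>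

lemma L1_bound_mult:
  assumes "L1_bound M (\<lambda>\<omega>. (U \<omega>)\<^sup>2) (a\<^sup>2)" "L1_bound M (\<lambda>\<omega>. (V \<omega>)\<^sup>2) (b\<^sup>2)" "0 < a" "0 < b"
  shows "L1_bound M (\<lambda>\<omega>. U \<omega> * V \<omega>) (a * b)"
proof -
  have "(b / a * a\<^sup>2 + b\<^sup>2 / (b / a)) / 2 = a * b"
    using assms(3,4) by (simp add: field_simps power2_eq_square)
  then show ?thesis using L1_bound_mult_weighted[OF assms(1,2), of "b / a"] assms(3,4) by simp
qed

lemma L1_bound_sum_squares:
  assumes "L1_bound M (\<lambda>\<omega>. (U \<omega>)\<^sup>2) a" "L1_bound M (\<lambda>\<omega>. (V \<omega>)\<^sup>2) b"
  shows "L1_bound M (\<lambda>\<omega>. (U \<omega> + V \<omega>)\<^sup>2) (2 * a + 2 * b)"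
proof (rule L1_bound_mono[OF L1_bound_add[OF L1_bound_cmult[OF assms(1), of 2] L1_bound_cmult[OF assms(2), of 2]]])
  show "AE \<omega> in M. \<bar>(U \<omega> + V \<omega>)\<^sup>2\<bar> \<le> \<bar>2 * (U \<omega>)\<^sup>2 + 2 * (V \<omega>)\<^sup>2\<bar>"
  proof (rule AE_I2)
    fix \<omega>
    have "2 * (U \<omega>)\<^sup>2 + 2 * (V \<omega>)\<^sup>2 - (U \<omega> + V \<omega>)\<^sup>2 = (U \<omega> - V \<omega>)\<^sup>2" by (simp add: power2_eq_square algebra_simps)
    then show "\<bar>(U \<omega> + V \<omega>)\<^sup>2\<bar> \<le> \<bar>2 * (U \<omega>)\<^sup>2 + 2 * (V \<omega>)\<^sup>2\<bar>"
      by (smt (verit) zero_le_power2)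
  qed
qed simp

lemma (in prob_space) L1_bound_of_square:
  assumes "L1_bound M (\<lambda>\<omega>. (U \<omega>)\<^sup>2) (a\<^sup>2)" "0 < a"
  shows "L1_bound M U a"
  using L1_bound_mult[OF assms(1), of "\<lambda>_. 1" 1] assms(2) L1_bound_const[of 1] by simp

text \<open>Measurability is asked of the event: \<open>a * indicator A\<close> is a measurable
  function below \<open>\<bar>U\<bar>\<close>, and its integral is the probability sought.\<close>

lemma (in prob_space) L1_bound_Markov:
  assumes "L1_bound M U c" "A \<in> sets M" "0 < a" "\<And>\<omega>. \<omega> \<in> A \<Longrightarrow> a \<le> \<bar>U \<omega>\<bar>"
  shows "prob A \<le> c / a"
proof -
  have "L1_bound M (\<lambda>\<omega>. a * indicator A \<omega>) c"
    by (rule L1_bound_mono[OF assms(1)]) (use assms(3,4) in \<open>auto simp: indicator_def\<close>)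
  from L1_bound_imp_integrable(3)[OF this] have "\<bar>\<integral>\<omega>. a * indicator A \<omega> \<partial>M\<bar> \<le> c"
    using assms(2) by simp
  then have "a * prob A \<le> c" using assms(2,3) by (simp add: abs_mult)
  then show ?thesis using assms(3) by (simp add: field_simps)
qed

section \<open>Left Riemann sums and time integrals along paths\<close>

definition left_sum :: "(real \<Rightarrow> real) \<Rightarrow> real \<Rightarrow> real \<Rightarrow> nat \<Rightarrow> real" where
  "left_sum u s t m = (\<Sum>k<m. u (s + real k * ((t - s) / real m)) * ((t - s) / real m))"

lemma integral_grid:
  fixes u :: "real \<Rightarrow> real"
  assumes "0 \<le> h" "continuous_on {s..s + real m * h} u"
  shows "integral {s..s + real m * h} u = (\<Sum>k<m. integral {s + real k * h..s + real (Suc k) * h} u)"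
  using assms(2)
proof (induction m)
  case (Suc m)
  have le: "s \<le> s + real m * h" "s + real m * h \<le> s + real (Suc m) * h" using assms(1) by (auto simp: algebra_simps)
  have "continuous_on {s..s + real m * h} u"
    by (rule continuous_on_subset[OF Suc.prems]) (use le in auto)
  moreover have "u integrable_on {s..s + real (Suc m) * h}"
    by (rule integrable_continuous_real[OF Suc.prems])
  ultimately show ?case using Suc.IH Henstock_Kurzweil_Integration.integral_combine[OF le, of u] by simp
qed simp

lemma integral_diff_const_le:
  fixes u :: "real \<Rightarrow> real"
  assumes "s \<le> t" "continuous_on {s..t} u" "\<And>r. r \<in> {s..t} \<Longrightarrow> \<bar>u r - c\<bar> \<le> e"
  shows "\<bar>integral {s..t} u - c * (t - s)\<bar> \<le> e * (t - s)"
proof -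
  have int: "u integrable_on {s..t}" by (rule integrable_continuous_real[OF assms(2)])
  have "integral {s..t} u - c * (t - s) = integral {s..t} (\<lambda>r. u r - c)"
    using assms(1) int by (subst Henstock_Kurzweil_Integration.integral_diff) auto
  moreover have "norm (integral {s..t} (\<lambda>r. u r - c)) \<le> e * (t - s)"
    by (rule integral_bound[OF assms(1)]) (use assms in \<open>auto intro!: continuous_intros\<close>)
  ultimately show ?thesis by simp
qed

lemma left_sum_tendsto:
  fixes u :: "real \<Rightarrow> real"
  assumes "s \<le> t" "continuous_on {s..t} u"
  shows "(\<lambda>m. left_sum u s t (Suc m)) \<longlonglongrightarrow> integral {s..t} u"
proof (rule LIMSEQ_I)
  fix r :: real assume "0 < r"
  \<comment> \<open>The summand 1 covers \<open>s = t\<close>; the factor 2 leaves room for a strict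
    inequality.\<close>
  define e where "e = r / (2 * (t - s + 1))"
  have e: "0 < e" using \<open>0 < r\<close> assms(1) by (simp add: e_def)
  have "e * (t - s) \<le> e * (t - s + 1)" using e by simp
  also have "\<dots> = r / 2" using assms(1) by (simp add: e_def divide_simps)
  finally have e: "0 < e" "e * (t - s) < r" using \<open>0 < r\<close> e by simp_all
  have "uniformly_continuous_on {s..t} u" using assms(2) by (simp add: compact_uniformly_continuous)
  then obtain d where d: "0 < d" "\<And>x y. x \<in> {s..t} \<Longrightarrow> y \<in> {s..t} \<Longrightarrow> dist y x < d \<Longrightarrow> dist (u y) (u x) < e"
    using e(1) unfolding uniformly_continuous_on_def by metis
  obtain m0 where m0: "(t - s) / d < real m0" using reals_Archimedean2 by blast
  show "\<exists>no. \<forall>m\<ge>no. norm (left_sum u s t (Suc m) - integral {s..t} u) < r"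
  proof (intro exI allI impI)
    fix m assume "m0 \<le> m"
    define h where "h = (t - s) / real (Suc m)"
    have h0: "0 \<le> h" and hm: "real (Suc m) * h = t - s" using assms(1) by (auto simp: h_def)
    have "(t - s) / d < real (Suc m)" using m0 \<open>m0 \<le> m\<close> by simp
    then have hd: "h < d" using d(1) by (simp add: h_def field_simps)
    have tt: "t = s + real (Suc m) * h" using hm by simp
    have sub: "{s + real k * h..s + real (Suc k) * h} \<subseteq> {s..t}" if "k < Suc m" for k
    proof -
      have "real (Suc k) * h \<le> real (Suc m) * h" using that h0 by (intro mult_right_mono) auto
      moreover have "0 \<le> real k * h" using h0 by simp
      ultimately show ?thesis using tt by (intro subsetI) (unfold atLeastAtMost_iff, linarith)
    qed
    have "integral {s..t} u = (\<Sum>k<Suc m. integral {s + real k * h..s + real (Suc k) * h} u)"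
      unfolding tt by (rule integral_grid[OF h0]) (use assms(2) tt in simp)
    then have "left_sum u s t (Suc m) - integral {s..t} u =
      (\<Sum>k<Suc m. u (s + real k * h) * h - integral {s + real k * h..s + real (Suc k) * h} u)"
      unfolding left_sum_def h_def[symmetric] by (simp add: sum_subtractf)
    also have "\<bar>\<dots>\<bar> \<le> (\<Sum>k<Suc m. e * h)"
    proof (rule order_trans[OF sum_abs sum_mono])
      fix k assume k: "k \<in> {..<Suc m}"
      have "\<bar>integral {s + real k * h..s + real (Suc k) * h} u - u (s + real k * h) * (s + real (Suc k) * h - (s + real k * h))\<bar>
        \<le> e * (s + real (Suc k) * h - (s + real k * h))"
      proof (rule integral_diff_const_le)
        show "s + real k * h \<le> s + real (Suc k) * h" using h0 by (simp add: algebra_simps)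
        show "continuous_on {s + real k * h..s + real (Suc k) * h} u"
          using continuous_on_subset[OF assms(2) sub] k by auto
        fix r assume r: "r \<in> {s + real k * h..s + real (Suc k) * h}"
        moreover have "s + real k * h \<in> {s + real k * h..s + real (Suc k) * h}"
          using h0 by (simp add: algebra_simps)
        ultimately have "r \<in> {s..t}" "s + real k * h \<in> {s..t}" using sub[of k] k by blast+
        moreover have "dist r (s + real k * h) < d" using r hd by (auto simp: dist_real_def algebra_simps)
        ultimately show "\<bar>u r - u (s + real k * h)\<bar> \<le> e"
          using d(2)[of "s + real k * h" r] by (simp add: dist_real_def)
      qed
      then show "\<bar>u (s + real k * h) * h - integral {s + real k * h..s + real (Suc k) * h} u\<bar> \<le> e * h"
        by (simp add: algebra_simps)
    qed
    also have "\<dots> = e * (t - s)" by (simp add: hm[symmetric])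
    also have "\<dots> < r" by (rule e(2))
    finally show "norm (left_sum u s t (Suc m) - integral {s..t} u) < r" by simp
  qed
qed

text \<open>A left Riemann sum is a finite combination of the \<open>U r\<close> with total weight
  \<open>t - s\<close>, so it has the claimed bound for every mesh; path continuity and Fatou's
  lemma carry the bound to the integral.\<close>

lemma L1_bound_integral:
  assumes "s \<le> t" and cont: "AE \<omega> in M. continuous_on {s..t} (\<lambda>r. U r \<omega>)"
    and U: "\<And>r. r \<in> {s..t} \<Longrightarrow> L1_bound M (U r) c"
  shows "L1_bound M (\<lambda>\<omega>. integral {s..t} (\<lambda>r. U r \<omega>)) ((t - s) * c)"
proof (rule L1_bound_Fatou)
  show "AE \<omega> in M. (\<lambda>m. left_sum (\<lambda>r. U r \<omega>) s t (Suc m)) \<longlonglongrightarrow> integral {s..t} (\<lambda>r. U r \<omega>)"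
    using cont by eventually_elim (rule left_sum_tendsto[OF assms(1)])
  show "L1_bound M (\<lambda>\<omega>. left_sum (\<lambda>r. U r \<omega>) s t (Suc m)) ((t - s) * c)" for m
  proof -
    define h where "h = (t - s) / real (Suc m)"
    have h0: "0 \<le> h" and hm: "real (Suc m) * h = t - s" using assms(1) by (auto simp: h_def)
    have "L1_bound M (\<lambda>\<omega>. \<Sum>k<Suc m. h * U (s + real k * h) \<omega>) (\<Sum>k<Suc m. \<bar>h\<bar> * c)"
    proof (intro L1_bound_sum L1_bound_cmult U)
      fix k assume "k \<in> {..<Suc m}"
      then have "real k * h \<le> real (Suc m) * h" using h0 by (intro mult_right_mono) auto
      then show "s + real k * h \<in> {s..t}" using h0 hm by auto
    qed
    moreover have "(\<Sum>k<Suc m. \<bar>h\<bar> * c) = (t - s) * c"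
      using h0 hm by (simp only: sum_constant card_lessThan abs_of_nonneg flip: mult.assoc)
    ultimately show ?thesis unfolding left_sum_def h_def[symmetric]
      by (simp only: mult.commute[of h])
  qed
qed auto

section \<open>Adaptedness and independence of increments\<close>

primrec euler :: "(real \<Rightarrow> real) \<Rightarrow> real \<Rightarrow> real \<Rightarrow> (real \<Rightarrow> real) \<Rightarrow> real \<Rightarrow> nat \<Rightarrow> real" where
  "euler b c h \<beta> x0 0 = x0"
| "euler b c h \<beta> x0 (Suc k) = euler b c h \<beta> x0 k + h * b (euler b c h \<beta> x0 k)
     + c * (\<beta> (real (Suc k) * h) - \<beta> (real k * h))"

lemma Lipschitz_imp_continuous:
  fixes b :: "real \<Rightarrow> real"
  assumes "\<And>y z. \<bar>b y - b z\<bar> \<le> K * \<bar>y - z\<bar>" "0 \<le> K"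
  shows "continuous_on UNIV b"
proof -
  have "K-lipschitz_on UNIV b" using assms by (intro lipschitz_onI) (auto simp: dist_real_def)
  then show ?thesis by (rule lipschitz_on_continuous_on)
qed

lemma integral_increment:
  fixes u :: "real \<Rightarrow> real"
  assumes "continuous_on {0..} u" "0 \<le> s" "s \<le> t"
  shows "integral {0..t} u - integral {0..s} u = integral {s..t} u"
proof -
  have "u integrable_on {0..t}"
    by (rule integrable_continuous_real) (rule continuous_on_subset[OF assms(1)], auto)
  from Henstock_Kurzweil_Integration.integral_combine[OF assms(2,3) this] show ?thesis by simp
qed

lemma discrete_Gronwall:
  fixes d :: "nat \<Rightarrow> real"
  assumes "d 0 = 0" "0 \<le> a" "0 \<le> e" "\<And>k. k < n \<Longrightarrow> d (Suc k) \<le> (1 + a) * d k + e"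
  shows "k \<le> n \<Longrightarrow> d k \<le> real k * e * exp (real k * a)"
proof (induction k)
  case (Suc k)
  have ex: "1 + a \<le> exp a" by (rule exp_ge_add_one_self)
  have "d (Suc k) \<le> (1 + a) * d k + e" using assms(4) Suc.prems by simp
  also have "\<dots> \<le> (1 + a) * (real k * e * exp (real k * a)) + e"
    using Suc assms(2) by (intro add_right_mono mult_left_mono) auto
  also have "\<dots> \<le> exp a * (real k * e * exp (real k * a)) + e * exp (real (Suc k) * a)"
  proof (rule add_mono[OF mult_right_mono[OF ex]])
    show "e \<le> e * exp (real (Suc k) * a)"
      using mult_left_mono[of 1 "exp (real (Suc k) * a)" e] assms(2,3) by simp
  qed (use assms in simp)
  also have "\<dots> = real (Suc k) * e * exp (real (Suc k) * a)"
    by (simp add: algebra_simps flip: exp_add)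
  finally show ?case .
qed (use assms in auto)

text \<open>The noise is additive, so the scheme and the solution receive the same noise increment
  in each step and their difference feels only the drift. One step then costs \<open>h * K\<close>
  times the oscillation of \<open>x\<close> over the step, which uniform continuity makes small, and
  the discrete Gronwall inequality accumulates these costs.\<close>

lemma euler_tendsto:
  fixes x \<beta> :: "real \<Rightarrow> real"
  assumes lip: "\<And>y z. \<bar>b y - b z\<bar> \<le> K * \<bar>y - z\<bar>" and K: "0 \<le> K"
    and cont: "continuous_on {0..} x"
    and eq: "\<And>t. 0 \<le> t \<Longrightarrow> x t = x 0 + integral {0..t} (\<lambda>s. b (x s)) + c * \<beta> t"
    and t: "0 \<le> t"
  shows "(\<lambda>m. euler b c (t / real (Suc m)) \<beta> (x 0) (Suc m)) \<longlonglongrightarrow> x t"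
proof (rule LIMSEQ_I)
  fix r :: real assume "0 < r"
  \<comment> \<open>Gronwall will multiply the oscillation by \<open>K * t * exp (K * t)\<close>;
    the summand 1 covers the case in which this factor is 0.\<close>
  define e where "e = r / (2 * (K * t * exp (K * t) + 1))"
  have den: "0 \<le> K * t * exp (K * t)" using K t by simp
  have e: "0 < e" using \<open>0 < r\<close> den by (simp add: e_def)
  have "K * t * exp (K * t) * e \<le> (K * t * exp (K * t) + 1) * e" using e by simp
  also have "\<dots> = r / 2" using den unfolding e_def by (simp add: field_simps)
  finally have er: "K * t * exp (K * t) * e < r" using \<open>0 < r\<close> by simp
  have contb: "continuous_on UNIV b" by (rule Lipschitz_imp_continuous[OF lip K])
  have contbx: "continuous_on {0..} (\<lambda>s. b (x s))"
    by (rule continuous_on_compose2[OF contb cont]) auto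
  have "uniformly_continuous_on {0..t} x"
    by (rule compact_uniformly_continuous) (auto intro: continuous_on_subset[OF cont])
  then obtain d where d: "0 < d" "\<And>u v. u \<in> {0..t} \<Longrightarrow> v \<in> {0..t} \<Longrightarrow> dist v u < d \<Longrightarrow> dist (x v) (x u) < e"
    using e unfolding uniformly_continuous_on_def by metis
  obtain m0 where m0: "t / d < real m0" using reals_Archimedean2 by blast
  show "\<exists>no. \<forall>m\<ge>no. norm (euler b c (t / real (Suc m)) \<beta> (x 0) (Suc m) - x t) < r"
  proof (intro exI allI impI)
    fix m assume "m0 \<le> m"
    define h where "h = t / real (Suc m)"
    define y where "y = euler b c h \<beta> (x 0)"
    define D where "D k = \<bar>y k - x (real k * h)\<bar>" for k
    have h0: "0 \<le> h" and hm: "real (Suc m) * h = t" using t by (auto simp: h_def)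
    have "t / d < real (Suc m)" using m0 \<open>m0 \<le> m\<close> by simp
    then have hd: "h < d" using d(1) by (simp add: h_def field_simps)
    have step: "D (Suc k) \<le> (1 + h * K) * D k + h * K * e" if k: "k < Suc m" for k
    proof -
      define s s' where "s = real k * h" and "s' = real (Suc k) * h"
      have ss: "0 \<le> s" "s \<le> s'" "s' - s = h" using h0 by (auto simp: s_def s'_def algebra_simps)
      have "s' \<le> t" using k h0 hm unfolding s'_def by (metis Suc_leI mult_right_mono of_nat_mono)
      have xs: "x s' = x s + integral {s..s'} (\<lambda>s. b (x s)) + c * (\<beta> s' - \<beta> s)"
        using eq[of s] eq[of s'] ss integral_increment[OF contbx ss(1,2)] by (simp add: algebra_simps)
      have "\<bar>integral {s..s'} (\<lambda>s. b (x s)) - b (x s) * (s' - s)\<bar> \<le> (K * e) * (s' - s)"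
      proof (rule integral_diff_const_le[OF ss(2)])
        show "continuous_on {s..s'} (\<lambda>s. b (x s))"
          using ss by (intro continuous_on_subset[OF contbx]) auto
        fix r assume r: "r \<in> {s..s'}"
        have "\<bar>x r - x s\<bar> < e" using d(2)[of s r] r ss \<open>s' \<le> t\<close> hd by (auto simp: dist_real_def)
        then show "\<bar>b (x r) - b (x s)\<bar> \<le> K * e"
          using lip[of "x r" "x s"] K by (meson less_imp_le mult_left_mono order_trans)
      qed
      then have 1: "\<bar>integral {s..s'} (\<lambda>s. b (x s)) - h * b (x s)\<bar> \<le> h * K * e"
        using ss by (simp add: mult_ac)
      have 2: "\<bar>h * b (y k) - h * b (x s)\<bar> \<le> h * K * D k"
        using mult_left_mono[OF lip[of "y k" "x s"] h0] h0 unfolding D_def s_def[symmetric]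
        by (simp add: abs_mult mult.assoc flip: right_diff_distrib)
      have ys: "y (Suc k) = y k + h * b (y k) + c * (\<beta> s' - \<beta> s)"
        by (simp add: y_def s_def s'_def)
      have "D (Suc k) = \<bar>y (Suc k) - x s'\<bar>" by (simp only: D_def s'_def)
      moreover have "D k = \<bar>y k - x s\<bar>" by (simp only: D_def s_def)
      ultimately show ?thesis using 1 2 unfolding xs ys by (simp add: algebra_simps)
    qed
    have "D (Suc m) \<le> real (Suc m) * (h * K * e) * exp (real (Suc m) * (h * K))"
      by (rule discrete_Gronwall[of D "h * K" "h * K * e" "Suc m"])
        (use h0 K e step in \<open>auto simp: D_def y_def\<close>)
    also have "\<dots> = K * t * exp (K * t) * e" using hm by (metis mult.assoc mult.commute)
    also have "\<dots> < r" by (rule er)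
    finally show "norm (euler b c (t / real (Suc m)) \<beta> (x 0) (Suc m) - x t) < r"
      unfolding D_def y_def hm by (simp add: h_def)
  qed
qed

section \<open>The history and its independence of later increments\<close>

text \<open>Index \<open>-1\<close> stands for the initial value, an index \<open>s \<ge> 0\<close> for the Brownian motion at time \<open>s\<close>.\<close>

definition noise :: "('a \<Rightarrow> real) \<Rightarrow> ('a \<Rightarrow> real \<Rightarrow> real) \<Rightarrow> real \<Rightarrow> 'a \<Rightarrow> real" where
  "noise xi B s \<omega> = (if s < 0 then xi \<omega> else B \<omega> s - B \<omega> 0)"

definition past :: "real \<Rightarrow> real set" where
  "past t = insert (-1) {0..t}"

text \<open>This is the sigma-algebra generated by the initial value and by the motion up to time
  \<open>t\<close>. Pulling it back from a product space provides its generating cylinders. It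
  consists of genuine events of the noise and is not completed by null sets.\<close>

definition history :: "'a measure \<Rightarrow> ('a \<Rightarrow> real) \<Rightarrow> ('a \<Rightarrow> real \<Rightarrow> real) \<Rightarrow> real \<Rightarrow> 'a measure" where
  "history M xi B t = vimage_algebra (space M) (\<lambda>\<omega>. \<lambda>s\<in>past t. noise xi B s \<omega>) (PiM (past t) (\<lambda>_. borel))"

lemma space_history [simp]: "space (history M xi B t) = space M"
  by (simp add: history_def)

lemma measurable_noise_history:
  assumes "s \<in> past t" shows "noise xi B s \<in> borel_measurable (history M xi B t)"
proof -
  have "(\<lambda>\<omega>. \<lambda>s\<in>past t. noise xi B s \<omega>) \<in> measurable (history M xi B t) (PiM (past t) (\<lambda>_. borel))"
    unfolding history_def by (rule measurable_vimage_algebra1) (auto simp: space_PiM)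
  from measurable_compose[OF this measurable_component_singleton[OF assms]] show ?thesis
    using assms by simp
qed

lemma sets_history_subset:
  assumes "space N = space M" "\<And>s. s \<in> past t \<Longrightarrow> noise xi B s \<in> borel_measurable N"
  shows "sets (history M xi B t) \<subseteq> sets N"
proof -
  have "(\<lambda>\<omega>. \<lambda>s\<in>past t. noise xi B s \<omega>) \<in> measurable N (PiM (past t) (\<lambda>_. borel))"
    by (rule measurable_restrict) (rule assms(2))
  then show ?thesis
    unfolding history_def assms(1)[symmetric] by (auto simp: in_vimage_algebra sets_vimage_algebra2 space_PiM measurable_space)
qed

lemma sets_history_mono: "s \<le> t \<Longrightarrow> sets (history M xi B s) \<subseteq> sets (history M xi B t)"
  by (rule sets_history_subset) (auto intro!: measurable_noise_history simp: past_def)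

locale brownian = prob_space M for M :: "'a measure" +
  fixes xi :: "'a \<Rightarrow> real" and B :: "'a \<Rightarrow> real \<Rightarrow> real"
  assumes brownian: "brownian_motion_indep M xi B"
begin

abbreviation hist :: "real \<Rightarrow> 'a measure" where "hist \<equiv> history M xi B"

lemma measurable_xi [measurable]: "xi \<in> borel_measurable M"
  and measurable_B [measurable]: "(\<lambda>\<omega>. B \<omega> t) \<in> borel_measurable M"
  using brownian by (auto simp: brownian_motion_indep_def)

lemma measurable_noise: "noise xi B s \<in> borel_measurable M"
  unfolding noise_def[abs_def] by measurable

lemma sets_hist_le: "sets (hist t) \<subseteq> sets M"
  by (rule sets_history_subset) (auto intro: measurable_noise)

lemma subalgebra_hist: "subalgebra M (hist t)"
  by (simp add: subalgebra_def sets_hist_le)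

text \<open>The finitely many times of the cylinder are sorted and followed by \<open>u\<close>. By
  assumption the initial value and the successive increments are independent. Each coordinate of the
  cylinder is the initial value or a partial sum of increments up to \<open>t\<close>, so the
  cylinder is an event of the first block and the last increment forms the second block.\<close>

lemma cylinder_indep:
  assumes J: "finite J" "J \<subseteq> past t" and E: "\<And>j. j \<in> J \<Longrightarrow> E j \<in> sets borel"
    and A: "A \<in> sets borel" and t: "0 \<le> t" "t < u"
  shows "prob ({\<omega>\<in>space M. \<forall>j\<in>J. noise xi B j \<omega> \<in> E j} \<inter> ((\<lambda>\<omega>. B \<omega> u - B \<omega> t) -` A \<inter> space M))
    = prob {\<omega>\<in>space M. \<forall>j\<in>J. noise xi B j \<omega> \<in> E j} * prob ((\<lambda>\<omega>. B \<omega> u - B \<omega> t) -` A \<inter> space M)"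
proof -
  \<comment> \<open>Adding 0 makes the partial sums telescope down to \<open>B \<omega> 0\<close>;
    adding \<open>t\<close> makes the increment that ends at \<open>u\<close> start exactly at
    \<open>t\<close>.\<close>
  define T where "T = insert 0 (insert t (J \<inter> {0..}))"
  define l where "l = sorted_list_of_set T"
  define n where "n = length l - 1"
  define ts where "ts i = (if i \<le> n then l ! i else u)" for i
  have T: "finite T" "T \<subseteq> {0..t}" "0 \<in> T" "t \<in> T" using J t by (auto simp: T_def past_def)
  have l: "set l = T" "sorted_wrt (<) l" using T by (auto simp: l_def)
  have "l \<noteq> []" using T(3) l(1) by auto
  then have l: "set l = T" "sorted_wrt (<) l" "length l = Suc n" "l \<noteq> []"
    using l by (auto simp: n_def)
  have len: "length l = Suc n" using l(4) by (simp add: n_def)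
  have mono: "l ! i < l ! j" if "i < j" "j \<le> n" for i j
    using sorted_wrt_nth_less[OF l(2)] that len by simp
  have lT: "l ! i \<in> T" if "i \<le> n" for i using that len l(1) by (metis le_imp_less_Suc nth_mem)
  have l0: "l ! 0 = 0"
  proof -
    obtain i where i: "i \<le> n" "l ! i = 0" using T(3) l(1) len by (metis in_set_conv_nth less_Suc_eq_le)
    have "0 \<le> l ! 0" using lT[of 0] T(2) by auto
    then show ?thesis using i mono[of 0 i] by (cases "i = 0") auto
  qed
  have ln: "l ! n = t"
  proof -
    obtain i where i: "i \<le> n" "l ! i = t" using T(4) l(1) len by (metis in_set_conv_nth less_Suc_eq_le)
    have "l ! n \<le> t" using lT[of n] T(2) by auto
    then show ?thesis using i mono[of i n] by (cases "i = n") auto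
  qed
  have inc: "ts i < ts (Suc i)" if "i < Suc n" for i
    using that mono[of i "Suc i"] ln t by (auto simp: ts_def not_le less_Suc_eq)
  define Y where "Y = (\<lambda>i \<omega>. if i = 0 then xi \<omega> else B \<omega> (ts i) - B \<omega> (ts (i - 1)))"
  have ind: "indep_vars (\<lambda>_. borel) Y {0..Suc n}"
    using brownian inc l0 unfolding brownian_motion_indep_def Y_def by (auto simp: ts_def)
  have pair: "indep_var (PiM {0..n} (\<lambda>_. borel)) (\<lambda>\<omega>. \<lambda>i\<in>{0..n}. Y i \<omega>)
      (PiM {Suc n} (\<lambda>_. borel)) (\<lambda>\<omega>. \<lambda>i\<in>{Suc n}. Y i \<omega>)"
    by (rule indep_var_restrict[OF ind]) auto
  have "\<exists>k\<le>n. ts k = j" if "j \<in> J" "0 \<le> j" for j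
  proof -
    have "j \<in> set l" using that l(1) by (auto simp: T_def)
    then show ?thesis using len by (auto simp: in_set_conv_nth ts_def less_Suc_eq_le)
  qed
  then obtain kk where kk: "\<And>j. j \<in> J \<Longrightarrow> 0 \<le> j \<Longrightarrow> kk j \<le> n \<and> ts (kk j) = j" by metis
  \<comment> \<open>\<open>\<phi> j\<close> recovers coordinate \<open>j\<close> of the noise from
    the vector of initial value and increments.\<close>
  define \<phi> where "\<phi> j v = (if j < 0 then v 0 else (\<Sum>i\<in>{1..kk j}. v i))" for j :: real and v :: "nat \<Rightarrow> real"
  have tel: "(\<Sum>i\<in>{1..k}. Y i \<omega>) = B \<omega> (ts k) - B \<omega> 0" for k \<omega>
  proof (induction k)
    case 0 then show ?case using l0 by (simp add: ts_def)
  next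
    case (Suc k) then show ?case by (simp add: Y_def)
  qed
  have phiY: "\<phi> j (\<lambda>i\<in>{0..n}. Y i \<omega>) = noise xi B j \<omega>" if "j \<in> J" for j \<omega>
  proof (cases "j < 0")
    case True then show ?thesis by (simp add: \<phi>_def noise_def Y_def)
  next
    case False
    then have k: "kk j \<le> n" "ts (kk j) = j" using kk[OF that] by auto
    have "(\<Sum>i\<in>{1..kk j}. (\<lambda>i\<in>{0..n}. Y i \<omega>) i) = (\<Sum>i\<in>{1..kk j}. Y i \<omega>)"
      using k(1) by (intro sum.cong) auto
    then show ?thesis using False k(2) tel by (simp add: \<phi>_def noise_def)
  qed
  define C where "C = {v\<in>space (PiM {0..n} (\<lambda>_. borel)). \<forall>j\<in>J. \<phi> j v \<in> E j}"
  have phi_meas: "\<phi> j \<in> borel_measurable (PiM {0..n} (\<lambda>_. borel))" if "j \<in> J" for j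
  proof (cases "j < 0")
    case True then show ?thesis unfolding \<phi>_def[abs_def] by simp
  next
    case False
    then have "kk j \<le> n" using kk[OF that] by auto
    then show ?thesis using False unfolding \<phi>_def[abs_def]
      by (auto intro!: borel_measurable_sum measurable_component_singleton)
  qed
  have C: "C \<in> sets (PiM {0..n} (\<lambda>_. borel))"
  proof -
    have "{v\<in>space (PiM {0..n} (\<lambda>_. borel)). \<phi> j v \<in> E j} \<in> sets (PiM {0..n} (\<lambda>_. borel))" if "j \<in> J" for j
      using measurable_sets[OF phi_meas[OF that] E[OF that]] by (simp add: vimage_def Int_def conj_commute)
    then show ?thesis unfolding C_def using J(1) by (intro sets.sets_Collect_finite_All) auto
  qed
  define A' where "A' = {v\<in>space (PiM {Suc n} (\<lambda>_. borel :: real measure)). v (Suc n) \<in> A}"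
  have A': "A' \<in> sets (PiM {Suc n} (\<lambda>_. borel))"
    using measurable_sets[OF measurable_component_singleton[of "Suc n" "{Suc n}" "\<lambda>_. borel"] A]
    unfolding A'_def by (simp add: vimage_def Int_def conj_commute)
  have last: "Y (Suc n) \<omega> = B \<omega> u - B \<omega> t" for \<omega> using ln by (simp add: Y_def ts_def)
  have e1: "(\<lambda>\<omega>. \<lambda>i\<in>{0..n}. Y i \<omega>) -` C \<inter> space M = {\<omega>\<in>space M. \<forall>j\<in>J. noise xi B j \<omega> \<in> E j}"
    using phiY by (auto simp: C_def space_PiM)
  have e2: "(\<lambda>\<omega>. \<lambda>i\<in>{Suc n}. Y i \<omega>) -` A' \<inter> space M = (\<lambda>\<omega>. B \<omega> u - B \<omega> t) -` A \<inter> space M"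
    by (auto simp: A'_def space_PiM last)
  have "(\<lambda>x. (\<lambda>i\<in>{0..n}. Y i x, \<lambda>i\<in>{Suc n}. Y i x)) -` (C \<times> A') \<inter> space M =
    ((\<lambda>\<omega>. \<lambda>i\<in>{0..n}. Y i \<omega>) -` C \<inter> space M) \<inter> ((\<lambda>\<omega>. \<lambda>i\<in>{Suc n}. Y i \<omega>) -` A' \<inter> space M)"
    by auto
  then show ?thesis using indep_varD[OF pair C A'] unfolding e1 e2 by simp
qed

text \<open>Cylinders are stable under intersection and generate the history, so the product formula
  for them extends to the generated sigma-algebras, and from there to every variable measurable with
  respect to the history.\<close>

lemma hist_indep:
  assumes U: "U \<in> borel_measurable (hist t)" and t: "0 \<le> t" "t < u"
  shows "indep_var borel U borel (\<lambda>\<omega>. B \<omega> u - B \<omega> t)"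
proof -
  let ?Z = "\<lambda>\<omega>. \<lambda>s\<in>past t. noise xi B s \<omega>"
  let ?P = "prod_algebra (past t) (\<lambda>_. borel :: real measure)"
  define G where "G = {?Z -` X \<inter> space M | X. X \<in> ?P}"
  define H where "H = {(\<lambda>\<omega>. B \<omega> u - B \<omega> t) -` A \<inter> space M | A. A \<in> sets borel}"
  have U': "U \<in> borel_measurable M" using measurable_from_subalg[OF subalgebra_hist U] .
  have Zm: "?Z \<in> measurable M (PiM (past t) (\<lambda>_. borel))"
    by (rule measurable_restrict) (rule measurable_noise)
  have Pne: "?Z \<in> space M \<rightarrow> (\<Pi>\<^sub>E i\<in>past t. space (borel :: real measure))" by auto
  have sets_hist: "sets (hist t) = sigma_sets (space M) G"
  proof -
    have "sets (hist t) = {?Z -` A \<inter> space M | A. A \<in> sigma_sets (\<Pi>\<^sub>E i\<in>past t. space (borel :: real measure)) ?P}"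
      unfolding history_def by (subst sets_vimage_algebra2) (auto simp: sets_PiM space_PiM)
    also have "\<dots> = sigma_sets (space M) {?Z -` A \<inter> space M | A. A \<in> ?P}"
      by (rule sigma_sets_vimage_commute[OF Pne])
    finally show ?thesis by (simp add: G_def)
  qed
  have "indep_set (sigma_sets (space M) G) (sigma_sets (space M) H)"
  proof (rule indep_set_sigma_sets)
    show "Int_stable G"
    proof (rule Int_stableI)
      fix a b assume "a \<in> G" "b \<in> G"
      then obtain X Y where XY: "X \<in> ?P" "Y \<in> ?P" "a = ?Z -` X \<inter> space M" "b = ?Z -` Y \<inter> space M"
        by (auto simp: G_def)
      have "X \<inter> Y \<in> ?P" using Int_stable_prod_algebra XY(1,2) by (auto simp: Int_stable_def)
      moreover have "a \<inter> b = ?Z -` (X \<inter> Y) \<inter> space M" using XY by auto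
      ultimately show "a \<inter> b \<in> G" unfolding G_def by blast
    qed
    show "Int_stable H"
    proof (rule Int_stableI)
      fix a b assume "a \<in> H" "b \<in> H"
      then obtain X Y where XY: "X \<in> sets borel" "Y \<in> sets borel"
        "a = (\<lambda>\<omega>. B \<omega> u - B \<omega> t) -` X \<inter> space M" "b = (\<lambda>\<omega>. B \<omega> u - B \<omega> t) -` Y \<inter> space M"
        by (auto simp: H_def)
      have "X \<inter> Y \<in> sets borel" using XY by auto
      moreover have "a \<inter> b = (\<lambda>\<omega>. B \<omega> u - B \<omega> t) -` (X \<inter> Y) \<inter> space M" using XY by auto
      ultimately show "a \<inter> b \<in> H" unfolding H_def by blast
    qed
    show "indep_set G H"
    proof (rule indep_setI)
      show "G \<subseteq> events" using sets_hist sets_hist_le[of t] by (metis sigma_sets_superset_generator subset_trans)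
      show "H \<subseteq> events" unfolding H_def by (auto intro!: measurable_sets)
      fix a b assume ab: "a \<in> G" "b \<in> H"
      then obtain X A where X: "X \<in> ?P" "a = ?Z -` X \<inter> space M"
        and A: "A \<in> sets borel" "b = (\<lambda>\<omega>. B \<omega> u - B \<omega> t) -` A \<inter> space M"
        by (auto simp: G_def H_def)
      obtain J E where JE: "X = prod_emb (past t) (\<lambda>_. borel) J (Pi\<^sub>E J E)" "finite J" "J \<subseteq> past t"
        "\<And>i. i \<in> J \<Longrightarrow> E i \<in> sets borel"
        using prod_algebraE[OF X(1)] by metis
      have "a = {\<omega>\<in>space M. \<forall>j\<in>J. noise xi B j \<omega> \<in> E j}"
        using JE(3) unfolding X(2) JE(1) by (fastforce simp: prod_emb_def PiE_iff subset_iff)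
      then show "prob (a \<inter> b) = prob a * prob b"
        using cylinder_indep[OF JE(2,3,4) A(1) t] A(2) by simp
    qed
  qed
  moreover have "sigma_sets (space M) {U -` A \<inter> space M | A. A \<in> sets borel} \<subseteq> sigma_sets (space M) G"
  proof -
    have "{U -` A \<inter> space M | A. A \<in> sets borel} \<subseteq> sigma_sets (space M) G"
      using measurable_sets[OF U] sets_hist by auto
    moreover have "sigma_algebra (space M) (sigma_sets (space M) G)"
      using sets.sigma_algebra_axioms[of "hist t"] sets_hist by simp
    ultimately show ?thesis by (rule sigma_algebra.sigma_sets_subset[rotated])
  qed
  ultimately have "indep_set (sigma_sets (space M) {U -` A \<inter> space M | A. A \<in> sets borel}) (sigma_sets (space M) H)"
    by (meson indep_setD indep_setD_ev1 indep_setD_ev2 indep_setI subset_iff subset_trans)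
  then show ?thesis unfolding indep_var_eq H_def using U' by simp
qed

lemma euler_hist_measurable:
  assumes b: "b \<in> borel_measurable borel" and h: "0 \<le> h"
  shows "real k * h \<le> t \<Longrightarrow> (\<lambda>\<omega>. euler b c h (B \<omega>) (xi \<omega>) k) \<in> borel_measurable (hist t)"
proof (induction k)
  case 0
  have "noise xi B (-1) \<in> borel_measurable (hist t)" by (rule measurable_noise_history) (simp add: past_def)
  then show ?case by (simp add: noise_def[abs_def])
next
  case (Suc k)
  have le: "real k * h \<le> real (Suc k) * h" using h by (simp add: algebra_simps)
  then have [measurable]: "(\<lambda>\<omega>. euler b c h (B \<omega>) (xi \<omega>) k) \<in> borel_measurable (hist t)"
    using Suc by linarith
  have [measurable]: "noise xi B (real (Suc k) * h) \<in> borel_measurable (hist t)"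
    "noise xi B (real k * h) \<in> borel_measurable (hist t)"
    using Suc.prems h le by (auto intro!: measurable_noise_history simp: past_def simp del: of_nat_Suc)
  have "(\<lambda>\<omega>. euler b c h (B \<omega>) (xi \<omega>) (Suc k)) = (\<lambda>\<omega>. euler b c h (B \<omega>) (xi \<omega>) k
     + h * b (euler b c h (B \<omega>) (xi \<omega>) k)
     + c * (noise xi B (real (Suc k) * h) \<omega> - noise xi B (real k * h) \<omega>))"
    using mult_nonneg_nonneg[OF of_nat_0_le_iff h, of k] mult_nonneg_nonneg[OF of_nat_0_le_iff h, of "Suc k"]
    by (intro ext) (simp only: noise_def not_less[symmetric] euler.simps if_False, simp)
  then show ?case using b by (simp del: of_nat_Suc euler.simps)
qed

text \<open>The given solution obeys its equation only almost surely and need not be measurable for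
  the uncompleted history. The pathwise limit of Euler schemes is measurable for it everywhere,
  whatever value \<open>lim\<close> takes where the schemes diverge, and it agrees with the given
  solution almost surely.\<close>

definition solution :: "(real \<Rightarrow> real) \<Rightarrow> real \<Rightarrow> real \<Rightarrow> 'a \<Rightarrow> real" where
  "solution b c t \<omega> = lim (\<lambda>m. euler b c (t / real (Suc m)) (B \<omega>) (xi \<omega>) (Suc m))"

lemma solution_hist_measurable:
  assumes b: "b \<in> borel_measurable borel" and t: "0 \<le> t"
  shows "solution b c t \<in> borel_measurable (hist t)"
  unfolding solution_def[abs_def]
  by (rule borel_measurable_lim_metric, rule euler_hist_measurable) (use assms in auto)

lemma increment_hist_measurable:
  assumes "0 \<le> s" "s \<le> t"
  shows "(\<lambda>\<omega>. B \<omega> t - B \<omega> s) \<in> borel_measurable (hist t)"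
proof -
  have [measurable]: "noise xi B t \<in> borel_measurable (hist t)" "noise xi B s \<in> borel_measurable (hist t)"
    using assms by (auto intro!: measurable_noise_history simp: past_def)
  have "(\<lambda>\<omega>. B \<omega> t - B \<omega> s) = (\<lambda>\<omega>. noise xi B t \<omega> - noise xi B s \<omega>)"
    using assms by (auto simp: noise_def fun_eq_iff)
  then show ?thesis by simp
qed

end

section \<open>Additive-noise equations with a stationary law\<close>

lemma L1_bound_limit:
  assumes "\<And>e. 0 < e \<Longrightarrow> L1_bound M U (c + e)"
  shows "L1_bound M U c"
proof (rule L1_bound_Fatou)
  show "L1_bound M U (c + 1 / real (Suc n))" for n by (rule assms) simp
  show "(\<lambda>n. c + 1 / real (Suc n)) \<longlonglongrightarrow> c"
    using tendsto_add[OF tendsto_const[of c] lim_1_over_real_power[of 1]] LIMSEQ_inverse_real_of_nat_add[of c]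
    by (simp add: inverse_eq_divide)
qed auto

text \<open>Cauchy-Schwarz was stated for positive constants; the value 0 is reached through
  \<open>a + e\<close>.\<close>

lemma (in prob_space) L1_bound_of_square_nonneg:
  assumes "L1_bound M (\<lambda>\<omega>. (U \<omega>)\<^sup>2) (a\<^sup>2)" "0 \<le> a"
  shows "L1_bound M U a"
proof (rule L1_bound_limit)
  fix e :: real assume "0 < e"
  have "a\<^sup>2 \<le> (a + e)\<^sup>2" using assms(2) \<open>0 < e\<close> by (intro power_mono) auto
  then show "L1_bound M U (a + e)"
    using L1_bound_of_square[OF L1_bound_weaken[OF assms(1)]] assms(2) \<open>0 < e\<close> by simp
qed

text \<open>Expand the nonnegative integral of \<open>(u r - k)^2\<close>, where \<open>k\<close> is
  the mean of \<open>u\<close> over the interval.\<close>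

lemma integral_square_le:
  fixes u :: "real \<Rightarrow> real"
  assumes "s \<le> t" "continuous_on {s..t} u"
  shows "(integral {s..t} u)\<^sup>2 \<le> (t - s) * integral {s..t} (\<lambda>r. (u r)\<^sup>2)"
proof (cases "s = t")
  case False
  then have st: "0 < t - s" using assms(1) by simp
  define I where "I = integral {s..t} u"
  define k where "k = I / (t - s)"
  have i1: "u integrable_on {s..t}" by (rule integrable_continuous_real[OF assms(2)])
  have i2: "(\<lambda>r. (u r)\<^sup>2) integrable_on {s..t}"
    by (rule integrable_continuous_real) (intro continuous_intros assms(2))
  have i3: "(\<lambda>r. (2 * k) * u r) integrable_on {s..t}" by (rule integrable_on_mult_right[OF i1])
  have "0 \<le> integral {s..t} (\<lambda>r. (u r - k)\<^sup>2)"
    by (rule Henstock_Kurzweil_Integration.integral_nonneg)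
      (auto intro!: integrable_continuous_real continuous_intros assms(2))
  also have "(\<lambda>r. (u r - k)\<^sup>2) = (\<lambda>r. ((u r)\<^sup>2 - (2 * k) * u r) + k\<^sup>2)"
    by (simp add: fun_eq_iff power2_eq_square algebra_simps)
  also have "integral {s..t} (\<lambda>r. ((u r)\<^sup>2 - (2 * k) * u r) + k\<^sup>2) = integral {s..t} (\<lambda>r. (u r)\<^sup>2) - 2 * k * I + (t - s) * k\<^sup>2"
  proof -
    have "integral {s..t} (\<lambda>r. ((u r)\<^sup>2 - (2 * k) * u r) + k\<^sup>2) =
        integral {s..t} (\<lambda>r. (u r)\<^sup>2 - (2 * k) * u r) + integral {s..t} (\<lambda>r. k\<^sup>2)"
      by (rule Henstock_Kurzweil_Integration.integral_add) (use i2 i3 in \<open>auto intro: integrable_diff\<close>)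
    also have "integral {s..t} (\<lambda>r. (u r)\<^sup>2 - (2 * k) * u r) = integral {s..t} (\<lambda>r. (u r)\<^sup>2) - integral {s..t} (\<lambda>r. (2 * k) * u r)"
      by (rule Henstock_Kurzweil_Integration.integral_diff[OF i2 i3])
    finally show ?thesis using st by (simp add: I_def)
  qed
  also have "\<dots> = integral {s..t} (\<lambda>r. (u r)\<^sup>2) - I\<^sup>2 / (t - s)"
  proof -
    have "(t - s) * k = I" "I\<^sup>2 / (t - s) = I * k" using st by (simp_all add: k_def power2_eq_square)
    then show ?thesis by (simp add: power2_eq_square mult.assoc[symmetric])
  qed
  finally show ?thesis using st unfolding I_def[symmetric] by (simp add: field_simps)
qed simp

section \<open>Taylor estimates for test functions\<close>

lemma derivative_bound_diff:
  fixes f :: "real \<Rightarrow> real"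
  assumes "\<And>z. \<bar>z\<bar> \<le> \<bar>w\<bar> \<Longrightarrow> (f has_real_derivative f' z) (at z)" "\<And>z. \<bar>z\<bar> \<le> \<bar>w\<bar> \<Longrightarrow> \<bar>f' z\<bar> \<le> C"
  shows "\<bar>f w - f 0\<bar> \<le> C * \<bar>w\<bar>"
proof -
  have "norm (f w - f 0) \<le> C * norm (w - 0)"
    by (rule field_differentiable_bound[of "{-\<bar>w\<bar>..\<bar>w\<bar>}" f f'])
      (use assms in \<open>auto simp: abs_le_iff has_field_derivative_at_within\<close>)
  then show ?thesis by simp
qed

lemma derivative_bound_Lipschitz:
  fixes f :: "real \<Rightarrow> real"
  assumes "\<And>z. (f has_real_derivative f' z) (at z)" "\<And>z. \<bar>f' z\<bar> \<le> C"
  shows "\<bar>f y - f x\<bar> \<le> C * \<bar>y - x\<bar>"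
  using field_differentiable_bound[of UNIV f f' C y x] assms by auto


text \<open>Three bounded derivatives give a second-order expansion with cubic remainder. The
  function itself may grow linearly, as the corrected coordinate does.\<close>

definition test_fn :: "(real \<Rightarrow> real) \<Rightarrow> (real \<Rightarrow> real) \<Rightarrow> (real \<Rightarrow> real) \<Rightarrow> bool" where
  "test_fn f f1 f2 \<longleftrightarrow> (\<exists>f3 C. 0 < C \<and> (\<forall>x. (f has_real_derivative f1 x) (at x) \<and>
     (f1 has_real_derivative f2 x) (at x) \<and> (f2 has_real_derivative f3 x) (at x) \<and>
     \<bar>f1 x\<bar> \<le> C \<and> \<bar>f2 x\<bar> \<le> C \<and> \<bar>f3 x\<bar> \<le> C))"

text \<open>The Taylor bounds follow by applying the mean value inequality to one remainder after
  the other, since the derivative of each remainder is the remainder of the next lower order. The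
  factorials are given away: one constant \<open>C\<close> serves for all bounds.\<close>

lemma test_fnE:
  assumes "test_fn f f1 f2"
  obtains C where "0 < C" "\<And>x. \<bar>f1 x\<bar> \<le> C" "\<And>x. \<bar>f2 x\<bar> \<le> C"
    "\<And>x y. \<bar>f y - f x\<bar> \<le> C * \<bar>y - x\<bar>" "\<And>x y. \<bar>f1 y - f1 x\<bar> \<le> C * \<bar>y - x\<bar>" "\<And>x y. \<bar>f2 y - f2 x\<bar> \<le> C * \<bar>y - x\<bar>"
    "\<And>x w. \<bar>f (x + w) - f x - f1 x * w - f2 x / 2 * w\<^sup>2\<bar> \<le> C * \<bar>w\<bar> ^ 3"
    "\<And>x I. \<bar>f (x + I) - f x - f1 x * I\<bar> \<le> C * I\<^sup>2"
    "continuous_on UNIV f" "continuous_on UNIV f1" "continuous_on UNIV f2"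
proof -
  from assms obtain f3 C where C: "0 < C" "\<And>x. (f has_real_derivative f1 x) (at x)"
     "\<And>x. (f1 has_real_derivative f2 x) (at x)" "\<And>x. (f2 has_real_derivative f3 x) (at x)"
     "\<And>x. \<bar>f1 x\<bar> \<le> C" "\<And>x. \<bar>f2 x\<bar> \<le> C" "\<And>x. \<bar>f3 x\<bar> \<le> C" unfolding test_fn_def by blast
  have shift: "((\<lambda>z. g (x + z)) has_real_derivative g' (x + z)) (at z)"
    if "\<And>x. (g has_real_derivative g' x) (at x)" for g g' :: "real \<Rightarrow> real" and x z
    using that[of "z + x"] by (simp only: DERIV_shift add.commute[of x])
  have T2: "\<bar>f1 (x + z) - f1 x - f2 x * z\<bar> \<le> C * z\<^sup>2" for x z
  proof -
    have "\<bar>(\<lambda>z. f1 (x + z) - f1 x - f2 x * z) z - (\<lambda>z. f1 (x + z) - f1 x - f2 x * z) 0\<bar> \<le> (C * \<bar>z\<bar>) * \<bar>z\<bar>"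
    proof (rule derivative_bound_diff[where f' = "\<lambda>z. f2 (x + z) - f2 x"])
      show "((\<lambda>z. f1 (x + z) - f1 x - f2 x * z) has_real_derivative f2 (x + y) - f2 x) (at y)" for y
        by (auto intro!: derivative_eq_intros shift[OF C(3)])
      fix y assume "\<bar>y\<bar> \<le> \<bar>z\<bar>"
      then show "\<bar>f2 (x + y) - f2 x\<bar> \<le> C * \<bar>z\<bar>"
        using derivative_bound_Lipschitz[OF C(4,7), of "x + y" x] C(1) by (smt (verit) mult_left_mono)
    qed
    then show ?thesis by (simp add: power2_eq_square abs_mult_self_eq mult.assoc)
  qed
  have T2': "\<bar>f (x + z) - f x - f1 x * z\<bar> \<le> C * z\<^sup>2" for x z
  proof -
    have "\<bar>(\<lambda>z. f (x + z) - f x - f1 x * z) z - (\<lambda>z. f (x + z) - f x - f1 x * z) 0\<bar> \<le> (C * \<bar>z\<bar>) * \<bar>z\<bar>"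
    proof (rule derivative_bound_diff[where f' = "\<lambda>z. f1 (x + z) - f1 x"])
      show "((\<lambda>z. f (x + z) - f x - f1 x * z) has_real_derivative f1 (x + y) - f1 x) (at y)" for y
        by (auto intro!: derivative_eq_intros shift[OF C(2)])
      fix y assume "\<bar>y\<bar> \<le> \<bar>z\<bar>"
      then show "\<bar>f1 (x + y) - f1 x\<bar> \<le> C * \<bar>z\<bar>"
        using derivative_bound_Lipschitz[OF C(3,6), of "x + y" x] C(1) by (smt (verit) mult_left_mono)
    qed
    then show ?thesis by (simp add: power2_eq_square abs_mult_self_eq mult.assoc)
  qed
  have T3: "\<bar>f (x + w) - f x - f1 x * w - f2 x / 2 * w\<^sup>2\<bar> \<le> C * \<bar>w\<bar> ^ 3" for x w
  proof -
    have "\<bar>(\<lambda>z. f (x + z) - f x - f1 x * z - f2 x / 2 * z\<^sup>2) w - (\<lambda>z. f (x + z) - f x - f1 x * z - f2 x / 2 * z\<^sup>2) 0\<bar> \<le> (C * \<bar>w\<bar>\<^sup>2) * \<bar>w\<bar>"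
    proof (rule derivative_bound_diff[where f' = "\<lambda>z. f1 (x + z) - f1 x - f2 x * z"])
      show "((\<lambda>z. f (x + z) - f x - f1 x * z - f2 x / 2 * z\<^sup>2) has_real_derivative f1 (x + y) - f1 x - f2 x * y) (at y)" for y
        by (auto intro!: derivative_eq_intros shift[OF C(2)])
      fix y assume "\<bar>y\<bar> \<le> \<bar>w\<bar>"
      then have "\<bar>y\<bar>\<^sup>2 \<le> \<bar>w\<bar>\<^sup>2" by (intro power_mono) auto
      then have "C * y\<^sup>2 \<le> C * \<bar>w\<bar>\<^sup>2" using C(1) by simp
      with T2[of x y] show "\<bar>f1 (x + y) - f1 x - f2 x * y\<bar> \<le> C * \<bar>w\<bar>\<^sup>2" by linarith
    qed
    then show ?thesis by (simp add: power2_eq_square power3_eq_cube mult.assoc)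
  qed
  have cont: "continuous_on UNIV f" "continuous_on UNIV f1" "continuous_on UNIV f2"
    using C(2-4) by (auto intro!: DERIV_isCont continuous_at_imp_continuous_on)
  show ?thesis
  proof (rule that[of C])
    show "\<bar>f y - f x\<bar> \<le> C * \<bar>y - x\<bar>" "\<bar>f1 y - f1 x\<bar> \<le> C * \<bar>y - x\<bar>" "\<bar>f2 y - f2 x\<bar> \<le> C * \<bar>y - x\<bar>" for x y
      by (rule derivative_bound_Lipschitz[OF C(2,5)] derivative_bound_Lipschitz[OF C(3,6)]
          derivative_bound_Lipschitz[OF C(4,7)])+
  qed (fact C(1) C(5) C(6) T3 T2' cont)+
qed

text \<open>Orthogonality to a partial sum may be proved under the assumption that this sum is
  square integrable. The induction supplies that fact, and callers use it to make the cross term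
  integrable.\<close>

lemma (in prob_space) orthogonal_sum_square:
  fixes Y :: "nat \<Rightarrow> 'a \<Rightarrow> real"
  assumes "\<And>i. i < n \<Longrightarrow> Y i \<in> borel_measurable M" "\<And>i. i < n \<Longrightarrow> integrable M (\<lambda>\<omega>. (Y i \<omega>)\<^sup>2)"
    "\<And>i. i < n \<Longrightarrow> integrable M (\<lambda>\<omega>. (\<Sum>j<i. Y j \<omega>)\<^sup>2) \<Longrightarrow> (\<integral>\<omega>. (\<Sum>j<i. Y j \<omega>) * Y i \<omega> \<partial>M) = 0"
  shows "integrable M (\<lambda>\<omega>. (\<Sum>j<n. Y j \<omega>)\<^sup>2) \<and> (\<integral>\<omega>. (\<Sum>j<n. Y j \<omega>)\<^sup>2 \<partial>M) = (\<Sum>j<n. \<integral>\<omega>. (Y j \<omega>)\<^sup>2 \<partial>M)"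
  using assms
proof (induction n)
  case (Suc n)
  define S where "S \<omega> = (\<Sum>j<n. Y j \<omega>)" for \<omega>
  have IH: "integrable M (\<lambda>\<omega>. (S \<omega>)\<^sup>2)" "(\<integral>\<omega>. (S \<omega>)\<^sup>2 \<partial>M) = (\<Sum>j<n. \<integral>\<omega>. (Y j \<omega>)\<^sup>2 \<partial>M)"
    unfolding S_def using Suc.IH Suc.prems by auto
  have [measurable]: "Y n \<in> borel_measurable M" "S \<in> borel_measurable M"
    using Suc.prems(1) unfolding S_def by (auto intro!: borel_measurable_sum)
  have iY: "integrable M (\<lambda>\<omega>. (Y n \<omega>)\<^sup>2)" using Suc.prems by simp
  have iSY: "integrable M (\<lambda>\<omega>. S \<omega> * Y n \<omega>)"
  proof (rule Bochner_Integration.integrable_bound[OF Bochner_Integration.integrable_add[OF IH(1) iY]])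
    show "AE \<omega> in M. norm (S \<omega> * Y n \<omega>) \<le> norm ((S \<omega>)\<^sup>2 + (Y n \<omega>)\<^sup>2)"
    proof (rule AE_I2)
      fix \<omega>
      have "\<bar>S \<omega> * Y n \<omega>\<bar> \<le> ((S \<omega>)\<^sup>2 + (Y n \<omega>)\<^sup>2) / 2"
        using abs_mult_le_weighted_squares[OF zero_less_one, of "S \<omega>" "Y n \<omega>"] by simp
      also have "\<dots> \<le> (S \<omega>)\<^sup>2 + (Y n \<omega>)\<^sup>2" by simp
      finally show "norm (S \<omega> * Y n \<omega>) \<le> norm ((S \<omega>)\<^sup>2 + (Y n \<omega>)\<^sup>2)" by simp
    qed
  qed measurable
  have eq: "(\<Sum>j<Suc n. Y j \<omega>)\<^sup>2 = (S \<omega>)\<^sup>2 + (Y n \<omega>)\<^sup>2 + 2 * (S \<omega> * Y n \<omega>)" for \<omega>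
    by (simp add: S_def power2_sum)
  have z: "(\<integral>\<omega>. S \<omega> * Y n \<omega> \<partial>M) = 0"
    using Suc.prems(3)[of n] IH(1) unfolding S_def by simp
  show ?case unfolding eq using IH iY iSY z by simp
qed simp

text \<open>The filtration is abstract and enters only through adaptedness and the independence of
  later increments. Adaptedness of \<open>B\<close> is stated for its increments, because
  \<open>B\<close> starts at 0 only almost surely. Stationarity concerns the laws at single
  times.\<close>

locale adapted_sde = prob_space M for M :: "'a measure" +
  fixes F :: "real \<Rightarrow> 'a measure" and X B :: "real \<Rightarrow> 'a \<Rightarrow> real"
    and b :: "real \<Rightarrow> real" and c K :: real
  assumes subalg: "\<And>t. subalgebra M (F t)"
    and F_mono: "\<And>s t. s \<le> t \<Longrightarrow> sets (F s) \<subseteq> sets (F t)"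
    and X_adapted: "\<And>t. 0 \<le> t \<Longrightarrow> X t \<in> borel_measurable (F t)"
    and B_adapted: "\<And>s t. 0 \<le> s \<Longrightarrow> s \<le> t \<Longrightarrow> (\<lambda>\<omega>. B t \<omega> - B s \<omega>) \<in> borel_measurable (F t)"
    and increment_indep: "\<And>s t U. 0 \<le> s \<Longrightarrow> s < t \<Longrightarrow> U \<in> borel_measurable (F s) \<Longrightarrow>
        indep_var borel U borel (\<lambda>\<omega>. B t \<omega> - B s \<omega>)"
    and increment_normal: "\<And>s t. 0 \<le> s \<Longrightarrow> s < t \<Longrightarrow>
        distributed M lborel (\<lambda>\<omega>. B t \<omega> - B s \<omega>) (\<lambda>x. ennreal (normal_density 0 (sqrt (t - s)) x))"
    and paths: "AE \<omega> in M. continuous_on {0..} (\<lambda>t. X t \<omega>) \<and> continuous_on {0..} (\<lambda>t. B t \<omega>) \<and> B 0 \<omega> = 0 \<and>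
        (\<forall>t\<ge>0. X t \<omega> = X 0 \<omega> + integral {0..t} (\<lambda>s. b (X s \<omega>)) + c * B t \<omega>)"
    and stationary: "\<And>t. 0 \<le> t \<Longrightarrow> distr M borel (X t) = distr M borel (X 0)"
    and Lipschitz: "\<And>x y. \<bar>b x - b y\<bar> \<le> K * \<bar>x - y\<bar>"
    and K_nonneg: "0 \<le> K" and c_pos: "0 < c"
begin

lemma F_measurable_mono: "s \<le> t \<Longrightarrow> U \<in> borel_measurable (F s) \<Longrightarrow> U \<in> borel_measurable (F t)"
proof -
  assume "s \<le> t" "U \<in> borel_measurable (F s)"
  then have "subalgebra (F t) (F s)" using F_mono[OF \<open>s \<le> t\<close>] subalg[of s] subalg[of t] by (auto simp: subalgebra_def)
  then show ?thesis using \<open>U \<in> borel_measurable (F s)\<close> by (rule measurable_from_subalg)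
qed

lemma F_measurable: "U \<in> borel_measurable (F t) \<Longrightarrow> U \<in> borel_measurable M"
  by (rule measurable_from_subalg[OF subalg])

lemma X_measurable: "0 \<le> t \<Longrightarrow> X t \<in> borel_measurable M"
  by (rule F_measurable[OF X_adapted])

lemma X_F_measurable: "0 \<le> s \<Longrightarrow> s \<le> t \<Longrightarrow> X s \<in> borel_measurable (F t)"
  by (rule F_measurable_mono[OF _ X_adapted])

lemma increment_measurable: "0 \<le> s \<Longrightarrow> s \<le> t \<Longrightarrow> (\<lambda>\<omega>. B t \<omega> - B s \<omega>) \<in> borel_measurable M"
  by (rule F_measurable[OF B_adapted])

lemma b_continuous: "continuous_on UNIV b"
  by (rule Lipschitz_imp_continuous[OF Lipschitz K_nonneg])

lemma b_measurable [measurable]: "b \<in> borel_measurable borel"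
  using b_continuous by (rule borel_measurable_continuous_onI)

lemma stationary_integral:
  fixes g :: "real \<Rightarrow> real"
  assumes "0 \<le> t" "g \<in> borel_measurable borel"
  shows "integrable M (\<lambda>\<omega>. g (X t \<omega>)) \<longleftrightarrow> integrable M (\<lambda>\<omega>. g (X 0 \<omega>))"
    "(\<integral>\<omega>. g (X t \<omega>) \<partial>M) = (\<integral>\<omega>. g (X 0 \<omega>) \<partial>M)"
proof -
  note m = X_measurable[OF assms(1)] X_measurable[OF order_refl]
  show "integrable M (\<lambda>\<omega>. g (X t \<omega>)) \<longleftrightarrow> integrable M (\<lambda>\<omega>. g (X 0 \<omega>))"
    using integrable_distr_eq[OF m(1) assms(2)] integrable_distr_eq[OF m(2) assms(2)] stationary[OF assms(1)] by simp
  show "(\<integral>\<omega>. g (X t \<omega>) \<partial>M) = (\<integral>\<omega>. g (X 0 \<omega>) \<partial>M)"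
    using integral_distr[OF m(1) assms(2)] integral_distr[OF m(2) assms(2)] stationary[OF assms(1)] by simp
qed

lemma L1_bound_stationary:
  assumes "0 \<le> t" and g: "g \<in> borel_measurable borel" and L: "L1_bound M (\<lambda>\<omega>. g (X 0 \<omega>)) a"
  shows "L1_bound M (\<lambda>\<omega>. g (X t \<omega>)) a"
proof (rule L1_bound_integrable)
  have m: "(\<lambda>\<omega>. g (X 0 \<omega>)) \<in> borel_measurable M" using g X_measurable[of 0] by measurable
  show "integrable M (\<lambda>\<omega>. g (X t \<omega>))"
    using stationary_integral(1)[OF assms(1) g] L1_bound_imp_integrable(1)[OF L m] by simp
  show "(\<integral>\<omega>. \<bar>g (X t \<omega>)\<bar> \<partial>M) \<le> a"
    using stationary_integral(2)[OF assms(1), of "\<lambda>x. \<bar>g x\<bar>"] g L1_bound_imp_integrable(2)[OF L m] by simp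
qed

lemma increment_moments:
  assumes "0 \<le> s" "s < t"
  shows "integrable M (\<lambda>\<omega>. (B t \<omega> - B s \<omega>) ^ k)"
    "(\<integral>\<omega>. B t \<omega> - B s \<omega> \<partial>M) = 0" "(\<integral>\<omega>. (B t \<omega> - B s \<omega>)\<^sup>2 \<partial>M) = t - s"
    "(\<integral>\<omega>. (B t \<omega> - B s \<omega>) ^ 4 \<partial>M) = 3 * (t - s)\<^sup>2"
proof -
  note D = increment_normal[OF assms]
  have pos: "0 < sqrt (t - s)" using assms by simp
  show "integrable M (\<lambda>\<omega>. (B t \<omega> - B s \<omega>) ^ k)"
    using distributed_integrable[OF D, of "\<lambda>x. x ^ k"] integrable_normal_moment[OF pos, of 0 k] by simp
  have E: "(\<integral>\<omega>. (B t \<omega> - B s \<omega>) ^ k \<partial>M) = integral\<^sup>L lborel (\<lambda>x. normal_density 0 (sqrt (t - s)) x * (x - 0) ^ k)" for k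
    using distributed_integral[OF D, of "\<lambda>x. x ^ k"] by simp
  show "(\<integral>\<omega>. B t \<omega> - B s \<omega> \<partial>M) = 0"
    using E[of 1] integral_normal_moment_odd[OF pos, of 0 0] by simp
  show "(\<integral>\<omega>. (B t \<omega> - B s \<omega>)\<^sup>2 \<partial>M) = t - s"
    using E[of 2] integral_normal_moment_even[OF pos, of 0 1] assms by simp
  show "(\<integral>\<omega>. (B t \<omega> - B s \<omega>) ^ 4 \<partial>M) = 3 * (t - s)\<^sup>2"
    using E[of 4] integral_normal_moment_even[OF pos, of 0 2] assms by (simp add: fact_numeral power_divide)
qed

lemma increment_mult:
  fixes g :: "real \<Rightarrow> real"
  assumes "0 \<le> s" "s < t" and U: "U \<in> borel_measurable (F s)" "integrable M U"
    and g: "g \<in> borel_measurable borel" "integrable M (\<lambda>\<omega>. g (B t \<omega> - B s \<omega>))"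
  shows "integrable M (\<lambda>\<omega>. U \<omega> * g (B t \<omega> - B s \<omega>))"
    "(\<integral>\<omega>. U \<omega> * g (B t \<omega> - B s \<omega>) \<partial>M) = (\<integral>\<omega>. U \<omega> \<partial>M) * (\<integral>\<omega>. g (B t \<omega> - B s \<omega>) \<partial>M)"
proof -
  have "indep_var borel (id \<circ> U) borel (g \<circ> (\<lambda>\<omega>. B t \<omega> - B s \<omega>))"
    by (rule indep_var_compose[OF increment_indep[OF assms(1-3)]]) (use g in auto)
  then have i: "indep_var borel U borel (\<lambda>\<omega>. g (B t \<omega> - B s \<omega>))" by (simp add: comp_def)
  show "integrable M (\<lambda>\<omega>. U \<omega> * g (B t \<omega> - B s \<omega>))"
    by (rule indep_var_integrable[OF i U(2) g(2)])
  show "(\<integral>\<omega>. U \<omega> * g (B t \<omega> - B s \<omega>) \<partial>M) = (\<integral>\<omega>. U \<omega> \<partial>M) * (\<integral>\<omega>. g (B t \<omega> - B s \<omega>) \<partial>M)"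
    by (rule indep_var_lebesgue_integral[OF i U(2) g(2)])
qed

lemma path_increment:
  "AE \<omega> in M. continuous_on {0..} (\<lambda>t. X t \<omega>) \<and> continuous_on {0..} (\<lambda>t. b (X t \<omega>)) \<and>
    (\<forall>s t. 0 \<le> s \<longrightarrow> s \<le> t \<longrightarrow> X t \<omega> - X s \<omega> = integral {s..t} (\<lambda>r. b (X r \<omega>)) + c * (B t \<omega> - B s \<omega>))"
  using paths
proof eventually_elim
  case (elim \<omega>)
  have c2: "continuous_on {0..} (\<lambda>t. b (X t \<omega>))"
    by (rule continuous_on_compose2[OF b_continuous conjunct1[OF elim]]) auto
  have eq: "X t \<omega> = X 0 \<omega> + integral {0..t} (\<lambda>s. b (X s \<omega>)) + c * B t \<omega>" if "0 \<le> t" for t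
    using elim that by blast
  have "X t \<omega> - X s \<omega> = integral {s..t} (\<lambda>r. b (X r \<omega>)) + c * (B t \<omega> - B s \<omega>)" if "0 \<le> s" "s \<le> t" for s t
    using integral_increment[OF c2 that] eq[OF that(1)] eq[of t] that by (simp add: algebra_simps)
  then show ?case using elim c2 by blast
qed

lemma continuous_path_comp:
  assumes "continuous_on UNIV g" "0 \<le> s"
  shows "AE \<omega> in M. continuous_on {s..t} (\<lambda>r. (g (X r \<omega>) :: real))"
  using paths
proof eventually_elim
  case (elim \<omega>)
  show ?case
    by (rule continuous_on_compose2[OF assms(1) continuous_on_subset[OF conjunct1[OF elim]]])
      (use assms(2) in auto)
qed

definition gen :: "(real \<Rightarrow> real) \<Rightarrow> (real \<Rightarrow> real) \<Rightarrow> real \<Rightarrow> real" where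
  "gen f1 f2 x = c\<^sup>2 / 2 * f2 x + b x * f1 x"

text \<open>These are the first-order term and the centred second-order term of the expansion of
  \<open>f (X (t + h))\<close> around \<open>X t\<close>. Given the past of \<open>t\<close> both
  have mean zero, so this replaces the increment of a stochastic integral.\<close>

definition mart :: "(real \<Rightarrow> real) \<Rightarrow> (real \<Rightarrow> real) \<Rightarrow> real \<Rightarrow> real \<Rightarrow> 'a \<Rightarrow> real" where
  "mart f1 f2 t h \<omega> = c * f1 (X t \<omega>) * (B (t + h) \<omega> - B t \<omega>)
     + c\<^sup>2 / 2 * f2 (X t \<omega>) * ((B (t + h) \<omega> - B t \<omega>)\<^sup>2 - h)"

end

section \<open>One-step expansion of test functions\<close>

lemma abs_sum3_le:
  fixes p q r :: real
  assumes "\<bar>p\<bar> \<le> p'" "\<bar>q\<bar> \<le> q'" "\<bar>r\<bar> \<le> r'"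
  shows "\<bar>p + q + r\<bar> \<le> p' + q' + r'"
  using assms by linarith

lemma abs_sum4_le:
  fixes p q r s :: real
  assumes "\<bar>p\<bar> \<le> p'" "\<bar>q\<bar> \<le> q'" "\<bar>r\<bar> \<le> r'" "\<bar>s\<bar> \<le> s'"
  shows "\<bar>p + q + r + s\<bar> \<le> p' + q' + r' + s'"
  using assms by linarith

text \<open>The second moment is only known to be finite. Bounds built from it and from
  \<open>K\<close> are not uniform over equations; they serve in remainders that vanish with the
  mesh.\<close>

locale square_integrable_sde = adapted_sde +
  assumes square_integrable: "integrable M (\<lambda>\<omega>. (X 0 \<omega>)\<^sup>2)"
begin

lemma L1_bound_X_square: "0 \<le> t \<Longrightarrow> L1_bound M (\<lambda>\<omega>. (X t \<omega>)\<^sup>2) (\<integral>\<omega>. (X 0 \<omega>)\<^sup>2 \<partial>M)"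
  by (rule L1_bound_stationary[where g = "\<lambda>x. x\<^sup>2"]) (use square_integrable in \<open>auto intro!: L1_bound_integrable\<close>)

lemma L1_bound_b_square:
  obtains m where "0 < m" "\<And>t. 0 \<le> t \<Longrightarrow> L1_bound M (\<lambda>\<omega>. (b (X t \<omega>))\<^sup>2) (m\<^sup>2)"
proof -
  define E where "E = (\<integral>\<omega>. (X 0 \<omega>)\<^sup>2 \<partial>M)"
  \<comment> \<open>The final 1 makes the resulting \<open>m\<close> positive, as the Cauchy-Schwarz
    rule requires.\<close>
  define A where "A = 2 * (b 0)\<^sup>2 + 2 * (K\<^sup>2 * E) + 1"
  have E0: "0 \<le> E" by (simp add: E_def)
  have A0: "0 < A" using E0 by (simp add: A_def add_nonneg_pos)
  have "L1_bound M (\<lambda>\<omega>. (b (X t \<omega>))\<^sup>2) A" if "0 \<le> t" for t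
  proof -
    have "L1_bound M (\<lambda>\<omega>. \<bar>K * X t \<omega>\<bar>\<^sup>2) (K\<^sup>2 * E)"
      using L1_bound_cmult[OF L1_bound_X_square[OF that], of "K\<^sup>2"] by (simp add: power_mult_distrib E_def)
    from L1_bound_sum_squares[OF L1_bound_const_le[of "\<bar>b 0\<bar>\<^sup>2" "(b 0)\<^sup>2"] this]
    have 1: "L1_bound M (\<lambda>\<omega>. (\<bar>b 0\<bar> + \<bar>K * X t \<omega>\<bar>)\<^sup>2) A"
      by (auto simp: A_def intro: L1_bound_weaken)
    show ?thesis
    proof (rule L1_bound_mono[OF 1])
      have "\<bar>b x\<bar> \<le> \<bar>b 0\<bar> + \<bar>K * x\<bar>" for x
        using Lipschitz[of x 0] K_nonneg by (simp add: abs_mult)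
      then show "AE \<omega> in M. \<bar>(b (X t \<omega>))\<^sup>2\<bar> \<le> \<bar>(\<bar>b 0\<bar> + \<bar>K * X t \<omega>\<bar>)\<^sup>2\<bar>"
        by (intro AE_I2) (metis abs_ge_zero abs_power2 power2_abs power_mono)
    qed simp
  qed
  then show ?thesis using A0 by (intro that[of "sqrt A"]) auto
qed

lemma L1_bound_increment_powers:
  assumes "0 \<le> t" "0 < h"
  shows "L1_bound M (\<lambda>\<omega>. (c * (B (t + h) \<omega> - B t \<omega>))\<^sup>2) ((c * sqrt h)\<^sup>2)"
    "L1_bound M (\<lambda>\<omega>. ((c * (B (t + h) \<omega> - B t \<omega>))\<^sup>2)\<^sup>2) ((2 * c\<^sup>2 * h)\<^sup>2)"
proof -
  note mom = increment_moments[of t "t + h"]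
  show "L1_bound M (\<lambda>\<omega>. (c * (B (t + h) \<omega> - B t \<omega>))\<^sup>2) ((c * sqrt h)\<^sup>2)"
    by (rule L1_bound_integrable) (use mom(1)[where k = 2] mom(3) assms in \<open>auto simp: power_mult_distrib\<close>)
  have eq: "((c * (B (t + h) \<omega> - B t \<omega>))\<^sup>2)\<^sup>2 = c ^ 4 * (B (t + h) \<omega> - B t \<omega>) ^ 4" for \<omega>
    by (simp add: power_mult_distrib flip: power_mult)
  show "L1_bound M (\<lambda>\<omega>. ((c * (B (t + h) \<omega> - B t \<omega>))\<^sup>2)\<^sup>2) ((2 * c\<^sup>2 * h)\<^sup>2)"
  proof (rule L1_bound_weaken)
    show "L1_bound M (\<lambda>\<omega>. ((c * (B (t + h) \<omega> - B t \<omega>))\<^sup>2)\<^sup>2) (c ^ 4 * (3 * h\<^sup>2))"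
      unfolding eq
      by (rule L1_bound_integrable) (use mom(1)[where k = 4] mom(4) assms in \<open>auto simp: abs_mult power_even_abs\<close>)
    \<comment> \<open>The Gaussian fourth moment \<open>3 * h^2\<close> is rounded up to
      \<open>4 * h^2\<close> to obtain a perfect square.\<close>
    show "c ^ 4 * (3 * h\<^sup>2) \<le> (2 * c\<^sup>2 * h)\<^sup>2"
      using c_pos by (simp add: power_mult_distrib flip: power_mult)
  qed
qed

lemma L1_bound_drift_integral_square:
  assumes m: "\<And>t. 0 \<le> t \<Longrightarrow> L1_bound M (\<lambda>\<omega>. (b (X t \<omega>))\<^sup>2) (m\<^sup>2)"
    and "0 \<le> t" "0 \<le> h"
  shows "L1_bound M (\<lambda>\<omega>. (integral {t..t + h} (\<lambda>r. b (X r \<omega>)))\<^sup>2) ((h * m)\<^sup>2)"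
proof -
  have "L1_bound M (\<lambda>\<omega>. integral {t..t + h} (\<lambda>r. (b (X r \<omega>))\<^sup>2)) ((t + h - t) * m\<^sup>2)"
  proof (rule L1_bound_integral)
    show "AE \<omega> in M. continuous_on {t..t + h} (\<lambda>r. (b (X r \<omega>))\<^sup>2)"
      by (rule continuous_path_comp[where g = "\<lambda>x. (b x)\<^sup>2"]) (use assms in \<open>auto intro!: continuous_intros b_continuous\<close>)
  qed (use assms in auto)
  from L1_bound_cmult[OF this, of h] have 1: "L1_bound M (\<lambda>\<omega>. h * integral {t..t + h} (\<lambda>r. (b (X r \<omega>))\<^sup>2)) ((h * m)\<^sup>2)"
    using assms(3) by (simp add: power_mult_distrib power2_eq_square mult_ac)
  show ?thesis
  proof (rule L1_bound_mono[OF 1 _ order_refl])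
    show "AE \<omega> in M. \<bar>(integral {t..t + h} (\<lambda>r. b (X r \<omega>)))\<^sup>2\<bar> \<le> \<bar>h * integral {t..t + h} (\<lambda>r. (b (X r \<omega>))\<^sup>2)\<bar>"
      using continuous_path_comp[OF b_continuous assms(2), of "t + h"]
    proof eventually_elim
      case (elim \<omega>)
      show ?case using integral_square_le[OF _ elim] assms(3) by simp
    qed
  qed
qed

lemma L1_bound_X_increment_square:
  obtains D where "0 < D" "\<And>t h. 0 \<le> t \<Longrightarrow> 0 \<le> h \<Longrightarrow> h \<le> 1 \<Longrightarrow>
    L1_bound M (\<lambda>\<omega>. (X (t + h) \<omega> - X t \<omega>)\<^sup>2) ((D * sqrt h)\<^sup>2)"
proof -
  obtain m where m: "0 < m" "\<And>t. 0 \<le> t \<Longrightarrow> L1_bound M (\<lambda>\<omega>. (b (X t \<omega>))\<^sup>2) (m\<^sup>2)"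
    using L1_bound_b_square by blast
  define D where "D = sqrt (2 * m\<^sup>2 + 2 * c\<^sup>2)"
  have D: "0 < D" "D\<^sup>2 = 2 * m\<^sup>2 + 2 * c\<^sup>2" using m(1) c_pos by (auto simp: D_def add_pos_pos)
  show ?thesis
  proof (rule that[OF D(1)])
    fix t h :: real assume th: "0 \<le> t" "0 \<le> h" "h \<le> 1"
    show "L1_bound M (\<lambda>\<omega>. (X (t + h) \<omega> - X t \<omega>)\<^sup>2) ((D * sqrt h)\<^sup>2)"
    proof (cases "h = 0")
      case True then show ?thesis using L1_bound_zero by simp
    next
      case False
      then have h: "0 < h" using th by simp
      note S = L1_bound_sum_squares[OF L1_bound_drift_integral_square[OF m(2) th(1,2)] L1_bound_increment_powers(1)[OF th(1) h]]
      show ?thesis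
      proof (rule L1_bound_mono[OF S])
        show "AE \<omega> in M. \<bar>(X (t + h) \<omega> - X t \<omega>)\<^sup>2\<bar> \<le>
          \<bar>(integral {t..t + h} (\<lambda>r. b (X r \<omega>)) + c * (B (t + h) \<omega> - B t \<omega>))\<^sup>2\<bar>"
          using path_increment
        proof eventually_elim
          case (elim \<omega>)
          then have "X (t + h) \<omega> - X t \<omega> = integral {t..t + h} (\<lambda>r. b (X r \<omega>)) + c * (B (t + h) \<omega> - B t \<omega>)"
            using th by (metis add_increasing2 le_add_same_cancel1)
          then show ?case by simp
        qed
        have "h * h \<le> h" using th mult_left_mono[of h 1 h] by simp
        then have "m\<^sup>2 * (h * h) \<le> m\<^sup>2 * h" by (intro mult_left_mono) auto
        then show "2 * (h * m)\<^sup>2 + 2 * (c * sqrt h)\<^sup>2 \<le> (D * sqrt h)\<^sup>2"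
          using h D by (simp add: power_mult_distrib power2_eq_square[of h] algebra_simps)
      qed
    qed
  qed
qed

definition gen_rem :: "(real \<Rightarrow> real) \<Rightarrow> (real \<Rightarrow> real) \<Rightarrow> real \<Rightarrow> real \<Rightarrow> 'a \<Rightarrow> real" where
  "gen_rem f1 f2 t h \<omega> = integral {t..t + h} (\<lambda>r. gen f1 f2 (X r \<omega>)) - h * gen f1 f2 (X t \<omega>)"

text \<open>The increment of \<open>f\<close> minus the time integral of its generator equals
  \<open>mart + step_rem - gen_rem\<close>. Both remainders are of order \<open>h * sqrt h\<close>
  in L1, so that \<open>1 / h\<close> of them still vanish as the mesh is refined.\<close>

definition step_rem :: "(real \<Rightarrow> real) \<Rightarrow> (real \<Rightarrow> real) \<Rightarrow> (real \<Rightarrow> real) \<Rightarrow> real \<Rightarrow> real \<Rightarrow> 'a \<Rightarrow> real" where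
  "step_rem f f1 f2 t h \<omega> = f (X (t + h) \<omega>) - f (X t \<omega>) - h * gen f1 f2 (X t \<omega>) - mart f1 f2 t h \<omega>"

lemma gen_continuous: "continuous_on UNIV f1 \<Longrightarrow> continuous_on UNIV f2 \<Longrightarrow> continuous_on UNIV (gen f1 f2)"
  unfolding gen_def[abs_def] by (intro continuous_intros b_continuous)

text \<open>The generator is not Lipschitz, because the unbounded drift multiplies
  \<open>f1\<close>. The product rule isolates the bad term \<open>b y * (f1 y - f1 x)\<close>, and
  Cauchy-Schwarz with the second moments of the drift and of the displacement gives it order
  \<open>sqrt h\<close>.\<close>

lemma L1_bound_gen_integral_remainder:
  assumes "test_fn f f1 f2"
  obtains C where "0 < C" "\<And>t h. 0 \<le> t \<Longrightarrow> 0 \<le> h \<Longrightarrow> h \<le> 1 \<Longrightarrow>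
    L1_bound M (gen_rem f1 f2 t h) (C * h * sqrt h)"
proof -
  obtain Cf where Cf: "0 < Cf" "\<And>x. \<bar>f1 x\<bar> \<le> Cf" "\<And>x. \<bar>f2 x\<bar> \<le> Cf"
    "\<And>x y. \<bar>f1 y - f1 x\<bar> \<le> Cf * \<bar>y - x\<bar>" "\<And>x y. \<bar>f2 y - f2 x\<bar> \<le> Cf * \<bar>y - x\<bar>"
    "continuous_on UNIV f1" "continuous_on UNIV f2"
    by (rule test_fnE[OF assms], rule that; assumption)
  obtain m where m: "0 < m" "\<And>t. 0 \<le> t \<Longrightarrow> L1_bound M (\<lambda>\<omega>. (b (X t \<omega>))\<^sup>2) (m\<^sup>2)"
    using L1_bound_b_square by blast
  obtain D where D: "0 < D" "\<And>t h. 0 \<le> t \<Longrightarrow> 0 \<le> h \<Longrightarrow> h \<le> 1 \<Longrightarrow>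
    L1_bound M (\<lambda>\<omega>. (X (t + h) \<omega> - X t \<omega>)\<^sup>2) ((D * sqrt h)\<^sup>2)"
    using L1_bound_X_increment_square by blast
  define k where "k = c\<^sup>2 / 2 * Cf + K * Cf"
  have k: "0 < k" using Cf(1) c_pos K_nonneg by (simp add: k_def add_pos_nonneg)
  define C where "C = k * D + Cf * (m * D)"
  have C: "0 < C" using k Cf(1) m(1) D(1) by (simp add: C_def add_pos_pos)
  have gL: "\<bar>gen f1 f2 y - gen f1 f2 x\<bar> \<le> k * \<bar>y - x\<bar> + Cf * \<bar>b y * (y - x)\<bar>" for x y
  proof -
    have eq: "gen f1 f2 y - gen f1 f2 x = c\<^sup>2 / 2 * (f2 y - f2 x) + (b y - b x) * f1 x + b y * (f1 y - f1 x)"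
      by (simp add: gen_def field_simps)
    have 1: "\<bar>c\<^sup>2 / 2 * (f2 y - f2 x)\<bar> \<le> c\<^sup>2 / 2 * (Cf * \<bar>y - x\<bar>)"
      unfolding abs_mult using Cf(5)[of y x] by (simp add: mult_left_mono)
    have 2: "\<bar>(b y - b x) * f1 x\<bar> \<le> (K * \<bar>y - x\<bar>) * Cf"
      unfolding abs_mult using Lipschitz[of y x] Cf(2)[of x] K_nonneg by (intro mult_mono) auto
    have 3: "\<bar>b y * (f1 y - f1 x)\<bar> \<le> Cf * \<bar>b y * (y - x)\<bar>"
      unfolding abs_mult using mult_left_mono[OF Cf(4)[of y x], of "\<bar>b y\<bar>"] by (simp add: mult_ac)
    show ?thesis unfolding eq k_def
      by (rule order_trans[OF abs_sum3_le[OF 1 2 3]]) (simp add: field_simps)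
  qed
  show ?thesis
  proof (rule that[OF C])
    fix t h :: real assume th: "0 \<le> t" "0 \<le> h" "h \<le> 1"
    show "L1_bound M (gen_rem f1 f2 t h) (C * h * sqrt h)"
    proof (cases "h = 0")
      case True then show ?thesis using L1_bound_zero by (simp add: gen_rem_def[abs_def])
    next
      case False
      then have h: "0 < h" using th by simp
      have pt: "L1_bound M (\<lambda>\<omega>. gen f1 f2 (X r \<omega>) - gen f1 f2 (X t \<omega>)) (C * sqrt h)" if "r \<in> {t..t + h}" for r
      proof -
        have sq: "L1_bound M (\<lambda>\<omega>. (X r \<omega> - X t \<omega>)\<^sup>2) ((D * sqrt h)\<^sup>2)"
          using D(2)[of t "r - t"] that th D(1)
          by (auto intro!: L1_bound_weaken[where d = "(D * sqrt h)\<^sup>2"] power_mono mult_left_mono)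
        have pos: "0 < D * sqrt h" using D(1) h by simp
        have "L1_bound M (\<lambda>\<omega>. k * \<bar>X r \<omega> - X t \<omega>\<bar> + Cf * \<bar>b (X r \<omega>) * (X r \<omega> - X t \<omega>)\<bar>) (\<bar>k\<bar> * (D * sqrt h) + \<bar>Cf\<bar> * (m * (D * sqrt h)))"
          by (intro L1_bound_add L1_bound_cmult)
            (use L1_bound_of_square[OF sq pos] L1_bound_mult[OF m(2) sq m(1) pos, of r] that th in \<open>auto simp: L1_bound_abs_iff\<close>)
        then show ?thesis
        proof (rule L1_bound_mono)
          show "AE \<omega> in M. \<bar>gen f1 f2 (X r \<omega>) - gen f1 f2 (X t \<omega>)\<bar> \<le>
            \<bar>k * \<bar>X r \<omega> - X t \<omega>\<bar> + Cf * \<bar>b (X r \<omega>) * (X r \<omega> - X t \<omega>)\<bar>\<bar>"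
            using gL by (intro AE_I2) (rule order_trans[OF _ abs_ge_self])
        qed (use k Cf(1) in \<open>simp add: C_def algebra_simps\<close>)
      qed
      have cont: "AE \<omega> in M. continuous_on {t..t + h} (\<lambda>r. gen f1 f2 (X r \<omega>))"
        by (rule continuous_path_comp[OF gen_continuous[OF Cf(6,7)] th(1)])
      have "L1_bound M (\<lambda>\<omega>. integral {t..t + h} (\<lambda>r. gen f1 f2 (X r \<omega>) - gen f1 f2 (X t \<omega>))) ((t + h - t) * (C * sqrt h))"
        by (rule L1_bound_integral[OF _ _ pt]) (use th cont in \<open>auto elim!: eventually_mono intro!: continuous_intros\<close>)
      then show ?thesis
      proof (rule L1_bound_mono)
        show "AE \<omega> in M. \<bar>gen_rem f1 f2 t h \<omega>\<bar> \<le>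
          \<bar>integral {t..t + h} (\<lambda>r. gen f1 f2 (X r \<omega>) - gen f1 f2 (X t \<omega>))\<bar>"
          using cont
        proof eventually_elim
          case (elim \<omega>)
          have "integral {t..t + h} (\<lambda>r. gen f1 f2 (X r \<omega>) - gen f1 f2 (X t \<omega>))
            = integral {t..t + h} (\<lambda>r. gen f1 f2 (X r \<omega>)) - integral {t..t + h} (\<lambda>r. gen f1 f2 (X t \<omega>))"
            by (rule Henstock_Kurzweil_Integration.integral_diff) (use elim integrable_continuous_real in auto)
          then show ?case using th by (simp add: gen_rem_def)
        qed
      qed simp
    qed
  qed
qed

text \<open>The displacement is split into the noise \<open>w\<close>, of order
  \<open>sqrt h\<close>, and the drift integral \<open>I\<close>, of order \<open>h\<close>.
  Expanding to second order in \<open>w\<close> at the left endpoint, and only to first order in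
  \<open>I\<close>, leaves exactly the generator, \<open>mart\<close>, and terms of order at least
  \<open>h * sqrt h\<close>. The third moment of \<open>w\<close> comes from its second and fourth
  moments.\<close>

lemma L1_bound_step_remainder:
  assumes "test_fn f f1 f2"
  obtains C where "0 < C" "\<And>t h. 0 \<le> t \<Longrightarrow> 0 < h \<Longrightarrow> h \<le> 1 \<Longrightarrow>
    L1_bound M (step_rem f f1 f2 t h) (C * h * sqrt h)"
proof -
  obtain Cf where Cf: "0 < Cf" "\<And>x. \<bar>f1 x\<bar> \<le> Cf"
    "\<And>x y. \<bar>f1 y - f1 x\<bar> \<le> Cf * \<bar>y - x\<bar>"
    "\<And>x w. \<bar>f (x + w) - f x - f1 x * w - f2 x / 2 * w\<^sup>2\<bar> \<le> Cf * \<bar>w\<bar> ^ 3"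
    "\<And>x I. \<bar>f (x + I) - f x - f1 x * I\<bar> \<le> Cf * I\<^sup>2"
    by (rule test_fnE[OF assms], rule that; assumption)
  obtain m where m: "0 < m" "\<And>t. 0 \<le> t \<Longrightarrow> L1_bound M (\<lambda>\<omega>. (b (X t \<omega>))\<^sup>2) (m\<^sup>2)"
    using L1_bound_b_square by blast
  obtain D where D: "0 < D" "\<And>t h. 0 \<le> t \<Longrightarrow> 0 \<le> h \<Longrightarrow> h \<le> 1 \<Longrightarrow>
    L1_bound M (\<lambda>\<omega>. (X (t + h) \<omega> - X t \<omega>)\<^sup>2) ((D * sqrt h)\<^sup>2)"
    using L1_bound_X_increment_square by blast
  define C where "C = Cf * (K * D) + Cf * (c * m) + Cf * m\<^sup>2 + Cf * (2 * c ^ 3)"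
  have C: "0 < C" using Cf(1) D(1) m(1) c_pos K_nonneg by (simp add: C_def add_nonneg_pos)
  \<comment> \<open>The noise is applied first, so that its Taylor coefficients are evaluated at
    \<open>x\<close> and match \<open>mart\<close>; the drift then acts at \<open>x + w\<close>, and
    moving its coefficient back to \<open>x\<close> costs \<open>\<bar>w * I\<bar>\<close>.\<close>
  have expand: "\<bar>f y - f x - h * gen f1 f2 x - (f1 x * w + f2 x / 2 * (w\<^sup>2 - c\<^sup>2 * h))\<bar>
     \<le> Cf * \<bar>I - h * b x\<bar> + Cf * \<bar>w * I\<bar> + Cf * I\<^sup>2 + Cf * \<bar>w * w\<^sup>2\<bar>"
    if "y = x + w + I" for x y w I h
  proof -
    have eq: "f y - f x - h * gen f1 f2 x - (f1 x * w + f2 x / 2 * (w\<^sup>2 - c\<^sup>2 * h)) =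
      (f (x + w + I) - f (x + w) - f1 (x + w) * I) + (f1 (x + w) - f1 x) * I + f1 x * (I - h * b x)
      + (f (x + w) - f x - f1 x * w - f2 x / 2 * w\<^sup>2)"
      unfolding that gen_def by (simp add: field_simps)
    have 1: "\<bar>(f1 (x + w) - f1 x) * I\<bar> \<le> Cf * \<bar>w * I\<bar>"
      unfolding abs_mult using mult_right_mono[OF Cf(3)[of "x + w" x], of "\<bar>I\<bar>"] by (simp add: mult_ac)
    have 2: "\<bar>f1 x * (I - h * b x)\<bar> \<le> Cf * \<bar>I - h * b x\<bar>"
      unfolding abs_mult using Cf(2)[of x] by (intro mult_right_mono) auto
    have 3: "\<bar>f (x + w) - f x - f1 x * w - f2 x / 2 * w\<^sup>2\<bar> \<le> Cf * \<bar>w * w\<^sup>2\<bar>"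
      using Cf(4)[of x w] by (simp add: abs_mult power3_eq_cube power2_eq_square mult.assoc)
    show ?thesis unfolding eq using abs_sum4_le[OF Cf(5)[of "x + w" I] 1 2 3] by simp
  qed
  show ?thesis
  proof (rule that[OF C])
    fix t h :: real assume th: "0 \<le> t" "0 < h" "h \<le> 1"
    define I where "I \<omega> = integral {t..t + h} (\<lambda>r. b (X r \<omega>))" for \<omega>
    define w where "w \<omega> = c * (B (t + h) \<omega> - B t \<omega>)" for \<omega>
    have pos: "0 < c * sqrt h" "0 < h * m" "0 < 2 * c\<^sup>2 * h" using th m(1) c_pos by auto
    have sh: "sqrt h * sqrt h = h" "h \<le> sqrt h" using th by (auto intro: real_le_rsqrt simp: power2_eq_square mult_left_le)
    note w2 = L1_bound_increment_powers[OF th(1,2), folded w_def]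
    have I2: "L1_bound M (\<lambda>\<omega>. (I \<omega>)\<^sup>2) ((h * m)\<^sup>2)"
      unfolding I_def by (rule L1_bound_drift_integral_square[OF m(2)]) (use th in auto)
    have contb: "AE \<omega> in M. continuous_on {t..t + h} (\<lambda>r. b (X r \<omega>))"
      by (rule continuous_path_comp[OF b_continuous th(1)])
    have db: "L1_bound M (\<lambda>\<omega>. I \<omega> - h * b (X t \<omega>)) (h * (K * (D * sqrt h)))"
    proof -
      have "L1_bound M (\<lambda>\<omega>. b (X r \<omega>) - b (X t \<omega>)) (K * (D * sqrt h))" if "r \<in> {t..t + h}" for r
      proof -
        have sq: "L1_bound M (\<lambda>\<omega>. (X r \<omega> - X t \<omega>)\<^sup>2) ((D * sqrt h)\<^sup>2)"
          using D(2)[of t "r - t"] that th D(1)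
          by (auto intro!: L1_bound_weaken[where d = "(D * sqrt h)\<^sup>2"] power_mono mult_left_mono)
        have "L1_bound M (\<lambda>\<omega>. K * (X r \<omega> - X t \<omega>)) (\<bar>K\<bar> * (D * sqrt h))"
          by (intro L1_bound_cmult L1_bound_of_square[OF sq]) (use D(1) th in auto)
        then show ?thesis
          by (rule L1_bound_mono) (use Lipschitz K_nonneg in \<open>auto simp: abs_mult\<close>)
      qed
      then have "L1_bound M (\<lambda>\<omega>. integral {t..t + h} (\<lambda>r. b (X r \<omega>) - b (X t \<omega>))) ((t + h - t) * (K * (D * sqrt h)))"
        by (intro L1_bound_integral) (use th contb in \<open>auto elim!: eventually_mono intro!: continuous_intros\<close>)
      then show ?thesis
      proof (rule L1_bound_mono)
        show "AE \<omega> in M. \<bar>I \<omega> - h * b (X t \<omega>)\<bar> \<le> \<bar>integral {t..t + h} (\<lambda>r. b (X r \<omega>) - b (X t \<omega>))\<bar>"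
          using contb
        proof eventually_elim
          case (elim \<omega>)
          have "integral {t..t + h} (\<lambda>r. b (X r \<omega>) - b (X t \<omega>))
            = integral {t..t + h} (\<lambda>r. b (X r \<omega>)) - integral {t..t + h} (\<lambda>r. b (X t \<omega>))"
            by (rule Henstock_Kurzweil_Integration.integral_diff) (use elim integrable_continuous_real in auto)
          then show ?case using th by (simp add: I_def)
        qed
      qed simp
    qed
    have "L1_bound M (\<lambda>\<omega>. Cf * \<bar>I \<omega> - h * b (X t \<omega>)\<bar> + Cf * \<bar>w \<omega> * I \<omega>\<bar> + Cf * (I \<omega>)\<^sup>2 + Cf * \<bar>w \<omega> * (w \<omega>)\<^sup>2\<bar>)
      (\<bar>Cf\<bar> * (h * (K * (D * sqrt h))) + \<bar>Cf\<bar> * ((c * sqrt h) * (h * m)) + \<bar>Cf\<bar> * (h * m)\<^sup>2 + \<bar>Cf\<bar> * ((c * sqrt h) * (2 * c\<^sup>2 * h)))"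
      by (intro L1_bound_add L1_bound_cmult; (simp only: L1_bound_abs_iff)?; (intro db I2 L1_bound_mult[OF w2(1) I2 pos(1,2)] L1_bound_mult[OF w2 pos(1,3)]))
    then show "L1_bound M (step_rem f f1 f2 t h) (C * h * sqrt h)"
    proof (rule L1_bound_mono)
      show "AE \<omega> in M. \<bar>step_rem f f1 f2 t h \<omega>\<bar>
        \<le> \<bar>Cf * \<bar>I \<omega> - h * b (X t \<omega>)\<bar> + Cf * \<bar>w \<omega> * I \<omega>\<bar> + Cf * (I \<omega>)\<^sup>2 + Cf * \<bar>w \<omega> * (w \<omega>)\<^sup>2\<bar>\<bar>"
        using path_increment
      proof eventually_elim
        case (elim \<omega>)
        then have "X (t + h) \<omega> - X t \<omega> = I \<omega> + w \<omega>"
          unfolding I_def w_def using th by (metis add_increasing2 le_add_same_cancel1 less_imp_le)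
        then have eq: "X (t + h) \<omega> = X t \<omega> + w \<omega> + I \<omega>" by simp
        have "mart f1 f2 t h \<omega> = f1 (X t \<omega>) * w \<omega> + f2 (X t \<omega>) / 2 * ((w \<omega>)\<^sup>2 - c\<^sup>2 * h)"
        proof -
          define d where "d = B (t + h) \<omega> - B t \<omega>"
          show ?thesis unfolding mart_def w_def d_def[symmetric] by (simp add: power_mult_distrib field_simps)
        qed
        then show ?case using expand[OF eq, of h] by (simp only: step_rem_def)
      qed
      have "h * h \<le> h * sqrt h" using sh(2) th by (intro mult_left_mono) auto
      then have "(Cf * m\<^sup>2) * (h * h) \<le> (Cf * m\<^sup>2) * (h * sqrt h)" by (rule mult_left_mono) (use Cf(1) in simp)
      then show "\<bar>Cf\<bar> * (h * (K * (D * sqrt h))) + \<bar>Cf\<bar> * ((c * sqrt h) * (h * m)) + \<bar>Cf\<bar> * (h * m)\<^sup>2 + \<bar>Cf\<bar> * ((c * sqrt h) * (2 * c\<^sup>2 * h)) \<le> C * h * sqrt h"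
        using Cf(1) by (simp add: C_def power_mult_distrib power2_eq_square power3_eq_cube algebra_simps)
    qed
  qed
qed

end

section \<open>Martingale estimates\<close>

context square_integrable_sde
begin

lemma increment_variance_square:
  assumes "0 \<le> t" "0 < h"
  shows "integrable M (\<lambda>\<omega>. ((B (t + h) \<omega> - B t \<omega>)\<^sup>2 - h)\<^sup>2)"
    "(\<integral>\<omega>. ((B (t + h) \<omega> - B t \<omega>)\<^sup>2 - h)\<^sup>2 \<partial>M) = 2 * h\<^sup>2"
    "integrable M (\<lambda>\<omega>. (B (t + h) \<omega> - B t \<omega>)\<^sup>2 - h)"
    "(\<integral>\<omega>. (B (t + h) \<omega> - B t \<omega>)\<^sup>2 - h \<partial>M) = 0"
proof -
  note mom = increment_moments[of t "t + h"]
  have eq: "((B (t + h) \<omega> - B t \<omega>)\<^sup>2 - h)\<^sup>2 = (B (t + h) \<omega> - B t \<omega>) ^ 4 - (2 * h) * (B (t + h) \<omega> - B t \<omega>)\<^sup>2 + h\<^sup>2" for \<omega>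
  proof -
    have "(d\<^sup>2 - h)\<^sup>2 = d ^ 4 - (2 * h) * d\<^sup>2 + h\<^sup>2" for d :: real
      by (simp add: power2_eq_square power4_eq_xxxx algebra_simps)
    then show ?thesis .
  qed
  have i: "integrable M (\<lambda>\<omega>. (B (t + h) \<omega> - B t \<omega>) ^ 4)" "integrable M (\<lambda>\<omega>. (B (t + h) \<omega> - B t \<omega>)\<^sup>2)"
    using mom(1) assms by auto
  show "integrable M (\<lambda>\<omega>. ((B (t + h) \<omega> - B t \<omega>)\<^sup>2 - h)\<^sup>2)" "integrable M (\<lambda>\<omega>. (B (t + h) \<omega> - B t \<omega>)\<^sup>2 - h)"
    unfolding eq using i by auto
  show "(\<integral>\<omega>. ((B (t + h) \<omega> - B t \<omega>)\<^sup>2 - h)\<^sup>2 \<partial>M) = 2 * h\<^sup>2"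
    unfolding eq using i mom(3,4) assms by (simp add: prob_space power2_eq_square)
  show "(\<integral>\<omega>. (B (t + h) \<omega> - B t \<omega>)\<^sup>2 - h \<partial>M) = 0"
    using i mom(3) assms by (simp add: prob_space)
qed

lemma integrable_mult_bounded:
  fixes U V :: "'a \<Rightarrow> real"
  assumes "integrable M U" "V \<in> borel_measurable M" "\<And>\<omega>. \<bar>V \<omega>\<bar> \<le> C"
  shows "integrable M (\<lambda>\<omega>. U \<omega> * V \<omega>)"
proof (rule Bochner_Integration.integrable_bound[of _ "\<lambda>\<omega>. C * U \<omega>"])
  show "AE \<omega> in M. norm (U \<omega> * V \<omega>) \<le> norm (C * U \<omega>)"
  proof (rule AE_I2)
    fix \<omega>
    have "\<bar>V \<omega>\<bar> \<le> \<bar>C\<bar>" using assms(3)[of \<omega>] by linarith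
    then show "norm (U \<omega> * V \<omega>) \<le> norm (C * U \<omega>)"
      using mult_right_mono[of "\<bar>V \<omega>\<bar>" "\<bar>C\<bar>" "\<bar>U \<omega>\<bar>"] by (simp add: abs_mult mult.commute)
  qed
qed (use assms in auto)

text \<open>Each term of \<open>mart\<close> is a variable known at time \<open>t\<close> times a
  centred function of the later increment, so independence factors the expectation. The bounds on
  \<open>f1\<close> and \<open>f2\<close> keep the first factor integrable.\<close>

lemma mart_orthogonal:
  assumes f: "continuous_on UNIV f1" "continuous_on UNIV f2" "\<And>x. \<bar>f1 x\<bar> \<le> C1" "\<And>x. \<bar>f2 x\<bar> \<le> C2"
    and t: "0 \<le> t" "0 < h" and V: "V \<in> borel_measurable (F t)" "integrable M V"
  shows "integrable M (\<lambda>\<omega>. V \<omega> * mart f1 f2 t h \<omega>)" "(\<integral>\<omega>. V \<omega> * mart f1 f2 t h \<omega> \<partial>M) = 0"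
proof -
  have [measurable]: "f1 \<in> borel_measurable borel" "f2 \<in> borel_measurable borel"
    using f by (auto intro: borel_measurable_continuous_onI)
  have [measurable]: "X t \<in> borel_measurable (F t)" "V \<in> borel_measurable (F t)" using X_adapted[OF t(1)] V by auto
  define U1 U2 where "U1 = (\<lambda>\<omega>. V \<omega> * (c * f1 (X t \<omega>)))" and "U2 = (\<lambda>\<omega>. V \<omega> * (c\<^sup>2 / 2 * f2 (X t \<omega>)))"
  have [measurable]: "U1 \<in> borel_measurable (F t)" "U2 \<in> borel_measurable (F t)" unfolding U1_def U2_def by measurable
  have i: "integrable M U1" "integrable M U2"
    unfolding U1_def U2_def
    by (rule integrable_mult_bounded[OF V(2), of _ "c * C1"], (rule F_measurable[of _ t], measurable),
        (use f c_pos in \<open>simp add: abs_mult\<close>))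
      (rule integrable_mult_bounded[OF V(2), of _ "c\<^sup>2 / 2 * C2"], (rule F_measurable[of _ t], measurable),
        (use f c_pos in \<open>simp add: abs_mult\<close>))
  have eq: "V \<omega> * mart f1 f2 t h \<omega> = U1 \<omega> * (B (t + h) \<omega> - B t \<omega>) + U2 \<omega> * ((B (t + h) \<omega> - B t \<omega>)\<^sup>2 - h)" for \<omega>
    by (simp add: mart_def U1_def U2_def field_simps)
  have th: "t < t + h" using t by simp
  have j1: "integrable M (\<lambda>\<omega>. (B (t + h) \<omega> - B t \<omega>))" using increment_moments(1)[OF t(1) th, of 1] by simp

  have mm1: "integrable M (\<lambda>\<omega>. U1 \<omega> * (B (t + h) \<omega> - B t \<omega>))" "(\<integral>\<omega>. U1 \<omega> * (B (t + h) \<omega> - B t \<omega>) \<partial>M) = 0"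
  proof -
    show "integrable M (\<lambda>\<omega>. U1 \<omega> * (B (t + h) \<omega> - B t \<omega>))"
      by (rule increment_mult(1)[OF t(1) th _ i(1), of "\<lambda>x. x"]) (measurable, rule j1)
    have "(\<integral>\<omega>. U1 \<omega> * (B (t + h) \<omega> - B t \<omega>) \<partial>M) = (\<integral>\<omega>. U1 \<omega> \<partial>M) * (\<integral>\<omega>. B (t + h) \<omega> - B t \<omega> \<partial>M)"
      by (rule increment_mult(2)[OF t(1) th _ i(1), of "\<lambda>x. x"]) (measurable, rule j1)
    then show "(\<integral>\<omega>. U1 \<omega> * (B (t + h) \<omega> - B t \<omega>) \<partial>M) = 0"
      unfolding increment_moments(2)[OF t(1) th] by (simp only: mult_zero_right)
  qed
  have mm2: "integrable M (\<lambda>\<omega>. U2 \<omega> * ((B (t + h) \<omega> - B t \<omega>)\<^sup>2 - h))" "(\<integral>\<omega>. U2 \<omega> * ((B (t + h) \<omega> - B t \<omega>)\<^sup>2 - h) \<partial>M) = 0"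
    using increment_mult[OF t(1) th _ i(2), of "\<lambda>x. x\<^sup>2 - h"] increment_variance_square(3,4)[OF t] by simp_all
  show "integrable M (\<lambda>\<omega>. V \<omega> * mart f1 f2 t h \<omega>)" "(\<integral>\<omega>. V \<omega> * mart f1 f2 t h \<omega> \<partial>M) = 0"
    unfolding eq using mm1 mm2 by simp_all
qed

text \<open>The bound \<open>C2\<close> on the second derivative, which is of order
  \<open>1 / \<epsilon>\<close> in the application, comes with \<open>h^2\<close>, while the part
  linear in \<open>h\<close> contains \<open>C1\<close> alone. After summation over a fine grid only
  the latter remains. The factor 2 stems from estimating the square of a sum of two terms.\<close>

lemma mart_square:
  assumes f: "continuous_on UNIV f1" "continuous_on UNIV f2" "\<And>x. \<bar>f1 x\<bar> \<le> C1" "\<And>x. \<bar>f2 x\<bar> \<le> C2"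
    and t: "0 \<le> t" "0 < h" and g: "g \<in> borel_measurable (F t)" "\<And>\<omega>. \<bar>g \<omega>\<bar> \<le> \<Gamma>"
  shows "integrable M (\<lambda>\<omega>. (g \<omega> * mart f1 f2 t h \<omega>)\<^sup>2)"
    "(\<integral>\<omega>. (g \<omega> * mart f1 f2 t h \<omega>)\<^sup>2 \<partial>M) \<le> (2 * c\<^sup>2 * C1\<^sup>2 * h + c ^ 4 * C2\<^sup>2 * h\<^sup>2) * (\<integral>\<omega>. (g \<omega>)\<^sup>2 \<partial>M)"
proof -
  have [measurable]: "f1 \<in> borel_measurable borel" "f2 \<in> borel_measurable borel"
    using f by (auto intro: borel_measurable_continuous_onI)
  have [measurable]: "X t \<in> borel_measurable (F t)" "g \<in> borel_measurable (F t)" using X_adapted[OF t(1)] g by auto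
  have [measurable]: "X t \<in> borel_measurable M" "g \<in> borel_measurable M"
    using X_measurable[OF t(1)] F_measurable[OF g(1)] by auto
  have th: "t < t + h" "t \<le> t + h" using t by auto
  have [measurable]: "(\<lambda>\<omega>. B (t + h) \<omega> - B t \<omega>) \<in> borel_measurable M" by (rule increment_measurable[OF t(1) th(2)])
  have C0: "0 \<le> C1" "0 \<le> C2" using f(3,4)[of 0] by linarith+
  have bnd: "\<bar>(g \<omega>)\<^sup>2\<bar> \<le> \<Gamma>\<^sup>2" for \<omega>
    using g(2)[of \<omega>] by (metis abs_power2 abs_ge_zero power2_abs power_mono)
  have ig: "integrable M (\<lambda>\<omega>. (g \<omega>)\<^sup>2)"
    using integrable_mult_bounded[of "\<lambda>_. 1" "\<lambda>\<omega>. (g \<omega>)\<^sup>2", OF _ _ bnd] by simp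
  define U1 U2 where "U1 = (\<lambda>\<omega>. (g \<omega>)\<^sup>2 * (2 * c\<^sup>2 * C1\<^sup>2))" and "U2 = (\<lambda>\<omega>. (g \<omega>)\<^sup>2 * (c ^ 4 / 2 * C2\<^sup>2))"
  have [measurable]: "U1 \<in> borel_measurable (F t)" "U2 \<in> borel_measurable (F t)" unfolding U1_def U2_def by measurable
  have i: "integrable M U1" "integrable M U2" unfolding U1_def U2_def using ig by auto
  define P where "P = (\<lambda>\<omega>. U1 \<omega> * (B (t + h) \<omega> - B t \<omega>)\<^sup>2)"
  define Q where "Q = (\<lambda>\<omega>. U2 \<omega> * ((B (t + h) \<omega> - B t \<omega>)\<^sup>2 - h)\<^sup>2)"
  have P: "integrable M P" "integral\<^sup>L M P = integral\<^sup>L M U1 * h"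
    using increment_mult[OF t(1) th(1) _ i(1), of "\<lambda>x. x\<^sup>2"] increment_moments(1)[OF t(1) th(1), of 2]
      increment_moments(3)[OF t(1) th(1)] by (simp_all add: P_def)
  have Q: "integrable M Q" "integral\<^sup>L M Q = integral\<^sup>L M U2 * (2 * h\<^sup>2)"
    using increment_mult[OF t(1) th(1) _ i(2), of "\<lambda>x. (x\<^sup>2 - h)\<^sup>2"] increment_variance_square(1,2)[OF t]
    by (simp_all add: Q_def)
  have le: "(g \<omega> * mart f1 f2 t h \<omega>)\<^sup>2 \<le> P \<omega> + Q \<omega>" for \<omega>
  proof -
    define d where "d = B (t + h) \<omega> - B t \<omega>"
    have eq: "(g \<omega> * mart f1 f2 t h \<omega>)\<^sup>2 = (g \<omega>)\<^sup>2 * (c * f1 (X t \<omega>) * d + c\<^sup>2 / 2 * f2 (X t \<omega>) * (d\<^sup>2 - h))\<^sup>2"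
      unfolding mart_def d_def[symmetric] by (rule power_mult_distrib)
    have "(c * f1 (X t \<omega>) * d + c\<^sup>2 / 2 * f2 (X t \<omega>) * (d\<^sup>2 - h))\<^sup>2
      \<le> 2 * (c * f1 (X t \<omega>) * d)\<^sup>2 + 2 * (c\<^sup>2 / 2 * f2 (X t \<omega>) * (d\<^sup>2 - h))\<^sup>2"
      using zero_le_power2[of "c * f1 (X t \<omega>) * d - c\<^sup>2 / 2 * f2 (X t \<omega>) * (d\<^sup>2 - h)"] by (simp only: power2_sum power2_diff)
    also have "\<dots> = (2 * c\<^sup>2 * d\<^sup>2) * (f1 (X t \<omega>))\<^sup>2 + (c ^ 4 / 2 * (d\<^sup>2 - h)\<^sup>2) * (f2 (X t \<omega>))\<^sup>2"
      by (simp add: power_mult_distrib power_divide flip: power_mult)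
    also have "\<dots> \<le> (2 * c\<^sup>2 * d\<^sup>2) * C1\<^sup>2 + (c ^ 4 / 2 * (d\<^sup>2 - h)\<^sup>2) * C2\<^sup>2"
      using f(3,4) by (intro add_mono mult_left_mono abs_le_square_iff[THEN iffD1]) (auto simp: C0)
    finally have "(g \<omega> * mart f1 f2 t h \<omega>)\<^sup>2 \<le> (g \<omega>)\<^sup>2 * ((2 * c\<^sup>2 * d\<^sup>2) * C1\<^sup>2 + (c ^ 4 / 2 * (d\<^sup>2 - h)\<^sup>2) * C2\<^sup>2)"
      unfolding eq by (rule mult_left_mono) simp
    also have "\<dots> = P \<omega> + Q \<omega>"
      unfolding P_def Q_def U1_def U2_def d_def[symmetric] by (simp add: distrib_left mult_ac)
    finally show ?thesis .
  qed
  have [measurable]: "mart f1 f2 t h \<in> borel_measurable M" unfolding mart_def[abs_def] by measurable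
  show int: "integrable M (\<lambda>\<omega>. (g \<omega> * mart f1 f2 t h \<omega>)\<^sup>2)"
    by (rule Bochner_Integration.integrable_bound[OF Bochner_Integration.integrable_add[OF P(1) Q(1)]])
      (measurable, use le in \<open>auto intro!: AE_I2 order_trans[OF _ abs_ge_self]\<close>)
  have "(\<integral>\<omega>. (g \<omega> * mart f1 f2 t h \<omega>)\<^sup>2 \<partial>M) \<le> (\<integral>\<omega>. P \<omega> + Q \<omega> \<partial>M)"
    by (rule integral_mono[OF int Bochner_Integration.integrable_add[OF P(1) Q(1)] le])
  also have "\<dots> = (2 * c\<^sup>2 * C1\<^sup>2 * h + c ^ 4 * C2\<^sup>2 * h\<^sup>2) * (\<integral>\<omega>. (g \<omega>)\<^sup>2 \<partial>M)"
    using P Q by (simp add: U1_def U2_def algebra_simps)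
  finally show "(\<integral>\<omega>. (g \<omega> * mart f1 f2 t h \<omega>)\<^sup>2 \<partial>M) \<le> (2 * c\<^sup>2 * C1\<^sup>2 * h + c ^ 4 * C2\<^sup>2 * h\<^sup>2) * (\<integral>\<omega>. (g \<omega>)\<^sup>2 \<partial>M)" .
qed

lemma mart_adapted:
  assumes "continuous_on UNIV f1" "continuous_on UNIV f2" "0 \<le> t" "0 \<le> h"
  shows "mart f1 f2 t h \<in> borel_measurable (F (t + h))"
proof -
  have [measurable]: "f1 \<in> borel_measurable borel" "f2 \<in> borel_measurable borel"
    using assms by (auto intro: borel_measurable_continuous_onI)
  have [measurable]: "X t \<in> borel_measurable (F (t + h))" "(\<lambda>\<omega>. B (t + h) \<omega> - B t \<omega>) \<in> borel_measurable (F (t + h))"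
    using assms X_F_measurable B_adapted by auto
  show ?thesis unfolding mart_def[abs_def] by measurable
qed

text \<open>By stationarity \<open>f (X h)\<close> and \<open>f (X 0)\<close> have equal means, and
  \<open>mart\<close> has mean zero. Hence \<open>h\<close> times the mean of the generator is the
  mean of the step remainder, which is \<open>O(h * sqrt h)\<close>; divide by \<open>h\<close> and
  let \<open>h\<close> tend to 0.\<close>

lemma generator_stationary:
  assumes T: "test_fn f f1 f2"
  shows "integrable M (\<lambda>\<omega>. gen f1 f2 (X 0 \<omega>))" "(\<integral>\<omega>. gen f1 f2 (X 0 \<omega>) \<partial>M) = 0"
proof -
  obtain C where C: "0 < C" "\<And>x. \<bar>f1 x\<bar> \<le> C" "\<And>x. \<bar>f2 x\<bar> \<le> C" "\<And>x y. \<bar>f y - f x\<bar> \<le> C * \<bar>y - x\<bar>"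
    "continuous_on UNIV f" "continuous_on UNIV f1" "continuous_on UNIV f2"
    by (rule test_fnE[OF T], rule that; assumption)
  obtain R where R: "0 < R" "\<And>t h. 0 \<le> t \<Longrightarrow> 0 < h \<Longrightarrow> h \<le> 1 \<Longrightarrow>
    L1_bound M (step_rem f f1 f2 t h) (R * h * sqrt h)"
    using L1_bound_step_remainder[OF T] by blast
  obtain m where m: "0 < m" "\<And>t. 0 \<le> t \<Longrightarrow> L1_bound M (\<lambda>\<omega>. (b (X t \<omega>))\<^sup>2) (m\<^sup>2)"
    using L1_bound_b_square by blast
  have [measurable]: "f \<in> borel_measurable borel" "f1 \<in> borel_measurable borel" "f2 \<in> borel_measurable borel"
    "gen f1 f2 \<in> borel_measurable borel"
    using C(5,6,7) gen_continuous[OF C(6,7)] by (auto intro: borel_measurable_continuous_onI)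
  have X0 [measurable]: "X 0 \<in> borel_measurable M" by (rule X_measurable) simp
  have iX: "integrable M (X 0)"
    by (rule square_integrable_imp_integrable[OF _ square_integrable]) measurable
  have ib: "integrable M (\<lambda>\<omega>. b (X 0 \<omega>))"
  proof (rule L1_bound_imp_integrable(1))
    show "L1_bound M (\<lambda>\<omega>. b (X 0 \<omega>)) m" by (rule L1_bound_of_square[OF m(2)[OF order_refl] m(1)])
  qed measurable
  have if0: "integrable M (\<lambda>\<omega>. f (X 0 \<omega>))"
  proof (rule Bochner_Integration.integrable_bound[of _ "\<lambda>\<omega>. \<bar>f 0\<bar> + C * \<bar>X 0 \<omega>\<bar>"])
    show "AE \<omega> in M. norm (f (X 0 \<omega>)) \<le> norm (\<bar>f 0\<bar> + C * \<bar>X 0 \<omega>\<bar>)"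
    proof (rule AE_I2)
      fix \<omega>
      show "norm (f (X 0 \<omega>)) \<le> norm (\<bar>f 0\<bar> + C * \<bar>X 0 \<omega>\<bar>)"
        using C(4)[of "X 0 \<omega>" 0] C(1) by simp
    qed
  qed (use iX in auto)
  show ig: "integrable M (\<lambda>\<omega>. gen f1 f2 (X 0 \<omega>))"
  proof (rule Bochner_Integration.integrable_bound[of _ "\<lambda>\<omega>. c\<^sup>2 / 2 * C + \<bar>b (X 0 \<omega>)\<bar> * C"])
    show "AE \<omega> in M. norm (gen f1 f2 (X 0 \<omega>)) \<le> norm (c\<^sup>2 / 2 * C + \<bar>b (X 0 \<omega>)\<bar> * C)"
    proof (rule AE_I2)
      fix \<omega>
      have "\<bar>c\<^sup>2 / 2 * f2 (X 0 \<omega>) + b (X 0 \<omega>) * f1 (X 0 \<omega>)\<bar> \<le> c\<^sup>2 / 2 * C + \<bar>b (X 0 \<omega>)\<bar> * C"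
        by (intro order_trans[OF abs_triangle_ineq] add_mono) (use C(2,3) in \<open>auto simp: abs_mult intro!: mult_left_mono\<close>)
      then show "norm (gen f1 f2 (X 0 \<omega>)) \<le> norm (c\<^sup>2 / 2 * C + \<bar>b (X 0 \<omega>)\<bar> * C)" by (simp add: gen_def)
    qed
  qed (use ib in auto)
  define G where "G = (\<integral>\<omega>. gen f1 f2 (X 0 \<omega>) \<partial>M)"
  have bound: "\<bar>G\<bar> \<le> R * sqrt h" if h: "0 < h" "h \<le> 1" for h
  proof -
    have "integrable M (\<lambda>\<omega>. 1 * mart f1 f2 0 h \<omega>)"
      by (rule mart_orthogonal(1)[of f1 f2 C C]) (use C h in auto)
    moreover have "(\<integral>\<omega>. 1 * mart f1 f2 0 h \<omega> \<partial>M) = 0"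
      by (rule mart_orthogonal(2)[of f1 f2 C C]) (use C h in auto)
    ultimately have mo: "integrable M (mart f1 f2 0 h)" "(\<integral>\<omega>. mart f1 f2 0 h \<omega> \<partial>M) = 0" by simp_all
    have Xh [measurable]: "X h \<in> borel_measurable M" by (rule X_measurable) (use h in simp)
    have ifh: "integrable M (\<lambda>\<omega>. f (X h \<omega>))" "(\<integral>\<omega>. f (X h \<omega>) \<partial>M) = (\<integral>\<omega>. f (X 0 \<omega>) \<partial>M)"
      by (rule stationary_integral(1)[THEN iffD2, OF _ _ if0]; use h in simp)
        (rule stationary_integral(2); use h in simp)
    have mm [measurable]: "mart f1 f2 0 h \<in> borel_measurable M" by (rule borel_measurable_integrable[OF mo(1)])
    have "L1_bound M (\<lambda>\<omega>. f (X h \<omega>) - f (X 0 \<omega>) - h * gen f1 f2 (X 0 \<omega>) - mart f1 f2 0 h \<omega>) (R * h * sqrt h)"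
      using R(2)[OF order_refl h] by (simp add: step_rem_def[abs_def])
    then have "\<bar>\<integral>\<omega>. f (X h \<omega>) - f (X 0 \<omega>) - h * gen f1 f2 (X 0 \<omega>) - mart f1 f2 0 h \<omega> \<partial>M\<bar> \<le> R * h * sqrt h"
      by (rule L1_bound_imp_integrable(3)) measurable
    also have "(\<integral>\<omega>. f (X h \<omega>) - f (X 0 \<omega>) - h * gen f1 f2 (X 0 \<omega>) - mart f1 f2 0 h \<omega> \<partial>M) = - (h * G)"
      using ifh if0 ig mo by (simp add: G_def)
    finally have "h * \<bar>G\<bar> \<le> h * (R * sqrt h)" using h by (simp add: abs_mult mult_ac)
    then show ?thesis using h by simp
  qed
  have "\<bar>G\<bar> \<le> 0"
  proof (rule LIMSEQ_le_const[of "\<lambda>n. R * sqrt (1 / real (Suc n))"])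
    have "(\<lambda>n. R * sqrt (1 / real (Suc n))) \<longlonglongrightarrow> R * sqrt 0"
      by (intro tendsto_intros LIMSEQ_Suc lim_1_over_n)
    then show "(\<lambda>n. R * sqrt (1 / real (Suc n))) \<longlonglongrightarrow> 0" by simp
    show "\<exists>N. \<forall>n\<ge>N. \<bar>G\<bar> \<le> R * sqrt (1 / real (Suc n))" by (intro exI allI impI bound) auto
  qed
  then show "(\<integral>\<omega>. gen f1 f2 (X 0 \<omega>) \<partial>M) = 0" by (simp add: G_def)
qed

text \<open>In stochastic calculus this is the integral of \<open>c * f1 (X r)\<close> against the
  Brownian motion over \<open>{s..t}\<close>.\<close>

definition dynkin :: "(real \<Rightarrow> real) \<Rightarrow> (real \<Rightarrow> real) \<Rightarrow> (real \<Rightarrow> real) \<Rightarrow> real \<Rightarrow> real \<Rightarrow> 'a \<Rightarrow> real" where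
  "dynkin f f1 f2 s t \<omega> = f (X t \<omega>) - f (X s \<omega>) - integral {s..t} (\<lambda>r. gen f1 f2 (X r \<omega>))"

text \<open>The weight and all earlier summands are known at the left endpoint of a step, so the new
  summand is orthogonal to the partial sum before it and the squares add up.\<close>

lemma L1_bound_mart_sum:
  assumes f: "continuous_on UNIV f1" "continuous_on UNIV f2" "\<And>x. \<bar>f1 x\<bar> \<le> C1" "\<And>x. \<bar>f2 x\<bar> \<le> C2"
    and t: "0 \<le> s0" "0 < h"
    and G: "\<And>i. i < J \<Longrightarrow> G i \<in> borel_measurable (F (s0 + real i * h))" "\<And>i \<omega>. \<bar>G i \<omega>\<bar> \<le> \<Gamma>"
      "\<And>i. i < J \<Longrightarrow> (\<integral>\<omega>. (G i \<omega>)\<^sup>2 \<partial>M) \<le> v" and v: "0 \<le> v"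
  shows "L1_bound M (\<lambda>\<omega>. \<Sum>i<J. G i \<omega> * mart f1 f2 (s0 + real i * h) h \<omega>)
    (sqrt (real J * ((2 * c\<^sup>2 * C1\<^sup>2 * h + c ^ 4 * C2\<^sup>2 * h\<^sup>2) * v)))"
proof -
  define t where "t i = s0 + real i * h" for i
  define Y where "Y i \<omega> = G i \<omega> * mart f1 f2 (t i) h \<omega>" for i \<omega>
  define A where "A = 2 * c\<^sup>2 * C1\<^sup>2 * h + c ^ 4 * C2\<^sup>2 * h\<^sup>2"
  have A: "0 \<le> A" using t by (simp add: A_def)
  have t0: "0 \<le> t i" for i using assms(5,6) by (simp add: t_def)
  have tS: "t i + h = t (Suc i)" for i by (simp add: t_def algebra_simps)
  have tm: "t i \<le> t j" if "i \<le> j" for i j using that assms(6) by (simp add: t_def mult_right_mono)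
  have GF: "G i \<in> borel_measurable (F (t i))" if "i < J" for i using G(1)[OF that] by (simp add: t_def)
  have YF: "Y i \<in> borel_measurable (F (t (Suc i)))" if "i < J" for i
    unfolding Y_def using mart_adapted[OF f(1,2) t0, of h i] GF[OF that] assms(6)
      F_measurable_mono[OF tm[of i "Suc i"]]
    by (auto simp: tS intro!: borel_measurable_times)
  have sq: "integrable M (\<lambda>\<omega>. (Y i \<omega>)\<^sup>2)" "(\<integral>\<omega>. (Y i \<omega>)\<^sup>2 \<partial>M) \<le> A * v" if "i < J" for i
  proof -
    note ms = mart_square[OF f t0[of i] assms(6) GF[OF that] G(2)]
    show "integrable M (\<lambda>\<omega>. (Y i \<omega>)\<^sup>2)" using ms(1) by (simp add: Y_def)
    have "(\<integral>\<omega>. (Y i \<omega>)\<^sup>2 \<partial>M) \<le> A * (\<integral>\<omega>. (G i \<omega>)\<^sup>2 \<partial>M)" using ms(2) by (simp add: Y_def A_def)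
    also have "\<dots> \<le> A * v" using G(3)[OF that] A by (rule mult_left_mono)
    finally show "(\<integral>\<omega>. (Y i \<omega>)\<^sup>2 \<partial>M) \<le> A * v" .
  qed
  have Ym: "Y i \<in> borel_measurable M" if "i < J" for i using F_measurable[OF YF[OF that]] .
  have "integrable M (\<lambda>\<omega>. (\<Sum>j<J. Y j \<omega>)\<^sup>2) \<and> (\<integral>\<omega>. (\<Sum>j<J. Y j \<omega>)\<^sup>2 \<partial>M) = (\<Sum>j<J. \<integral>\<omega>. (Y j \<omega>)\<^sup>2 \<partial>M)"
  proof (rule orthogonal_sum_square)
    fix i assume i: "i < J" and int: "integrable M (\<lambda>\<omega>. (\<Sum>j<i. Y j \<omega>)\<^sup>2)"
    have SF: "(\<lambda>\<omega>. \<Sum>j<i. Y j \<omega>) \<in> borel_measurable (F (t i))"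
    proof (rule borel_measurable_sum)
      fix j assume "j \<in> {..<i}"
      then show "Y j \<in> borel_measurable (F (t i))"
        using i by (intro F_measurable_mono[OF tm YF]) auto
    qed
    have SM: "(\<lambda>\<omega>. \<Sum>j<i. Y j \<omega>) \<in> borel_measurable M" by (rule F_measurable[OF SF])
    have "integrable M (\<lambda>\<omega>. \<Sum>j<i. Y j \<omega>)"
      by (rule square_integrable_imp_integrable[OF SM int])
    then have "integrable M (\<lambda>\<omega>. (\<Sum>j<i. Y j \<omega>) * G i \<omega>)"
      by (rule integrable_mult_bounded[OF _ F_measurable[OF GF[OF i]] G(2)])
    moreover have "(\<lambda>\<omega>. (\<Sum>j<i. Y j \<omega>) * G i \<omega>) \<in> borel_measurable (F (t i))"
      using SF GF[OF i] by measurable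
    ultimately have "(\<integral>\<omega>. ((\<Sum>j<i. Y j \<omega>) * G i \<omega>) * mart f1 f2 (t i) h \<omega> \<partial>M) = 0"
      by (intro mart_orthogonal(2)[OF f t0 assms(6)])
    then show "(\<integral>\<omega>. (\<Sum>j<i. Y j \<omega>) * Y i \<omega> \<partial>M) = 0" by (simp add: Y_def mult.assoc)
  qed (use Ym sq in auto)
  moreover have "(\<Sum>j<J. \<integral>\<omega>. (Y j \<omega>)\<^sup>2 \<partial>M) \<le> (\<Sum>j<J. A * v)" by (rule sum_mono) (use sq in auto)
  ultimately have "L1_bound M (\<lambda>\<omega>. (\<Sum>j<J. Y j \<omega>)\<^sup>2) ((sqrt (real J * (A * v)))\<^sup>2)"
    using A v by (intro L1_bound_integrable) auto
  then have "L1_bound M (\<lambda>\<omega>. \<Sum>j<J. Y j \<omega>) (sqrt (real J * (A * v)))"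
    by (rule L1_bound_of_square_nonneg) (use A v in simp)
  then show ?thesis by (simp add: Y_def t_def A_def)
qed

text \<open>Every interval of length \<open>\<delta>\<close> is cut into \<open>n m\<close> fine
  steps that share its weight. The fine martingale terms are orthogonal, and the remainders total
  order \<open>sqrt (h m)\<close>. In the limit the bound retains \<open>C1\<close> and the second
  moment \<open>v\<close> of the weights; the sup bound \<open>\<Gamma>\<close> occurs only in the
  vanishing part, and this is what later allows unbounded weights.\<close>

lemma L1_bound_dynkin_bounded:
  assumes T: "test_fn f f1 f2" and C1: "\<And>x. \<bar>f1 x\<bar> \<le> C1"
    and t: "0 \<le> s0" "0 < \<delta>"
    and g: "\<And>k. k < N \<Longrightarrow> g k \<in> borel_measurable (F (s0 + real k * \<delta>))" "\<And>k \<omega>. \<bar>g k \<omega>\<bar> \<le> \<Gamma>"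
      "\<And>k. k < N \<Longrightarrow> (\<integral>\<omega>. (g k \<omega>)\<^sup>2 \<partial>M) \<le> v" and v: "0 \<le> v"
  shows "L1_bound M (\<lambda>\<omega>. \<Sum>k<N. g k \<omega> * dynkin f f1 f2 (s0 + real k * \<delta>) (s0 + real (Suc k) * \<delta>) \<omega>)
    (c * C1 * sqrt (2 * real N * \<delta> * v))"
proof -
  obtain C where C: "0 < C" "\<And>x. \<bar>f2 x\<bar> \<le> C" "continuous_on UNIV f1" "continuous_on UNIV f2"
    by (rule test_fnE[OF T], rule that; assumption)
  obtain R where R: "0 < R" "\<And>t h. 0 \<le> t \<Longrightarrow> 0 < h \<Longrightarrow> h \<le> 1 \<Longrightarrow>
    L1_bound M (step_rem f f1 f2 t h) (R * h * sqrt h)"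
    using L1_bound_step_remainder[OF T] by blast
  obtain R' where R': "0 < R'" "\<And>t h. 0 \<le> t \<Longrightarrow> 0 \<le> h \<Longrightarrow> h \<le> 1 \<Longrightarrow>
    L1_bound M (gen_rem f1 f2 t h) (R' * h * sqrt h)"
    using L1_bound_gen_integral_remainder[OF T] by blast
  have G0: "0 \<le> \<Gamma>" using g(2)[of 0 undefined] by linarith
  have C10: "0 \<le> C1" using C1[of 0] by linarith
  obtain m0 :: nat where m0: "\<delta> < real m0" using reals_Archimedean2 by blast
  \<comment> \<open>Starting above \<open>\<delta>\<close> keeps the mesh at most 1, the range of
    the one-step estimates.\<close>
  define n where "n m = m + Suc m0" for m
  define h where "h m = \<delta> / real (n m)" for m
  have n0: "0 < n m" for m by (simp add: n_def)
  have h: "0 < h m" "h m \<le> 1" "real (n m) * h m = \<delta>" for m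
    using t m0 n0[of m] by (auto simp: h_def n_def field_simps)
  have hlim: "h \<longlonglongrightarrow> 0"
    unfolding h_def[abs_def] n_def by (rule LIMSEQ_ignore_initial_segment[OF lim_const_over_n])
  define a where "a m = sqrt (real N * \<delta> * v * (2 * c\<^sup>2 * C1\<^sup>2 + c ^ 4 * C\<^sup>2 * h m)) + real N * \<delta> * \<Gamma> * (R + R') * sqrt (h m)" for m
  show ?thesis
  proof (rule L1_bound_Fatou)
    have "a \<longlonglongrightarrow> sqrt (real N * \<delta> * v * (2 * c\<^sup>2 * C1\<^sup>2 + c ^ 4 * C\<^sup>2 * 0)) + real N * \<delta> * \<Gamma> * (R + R') * sqrt 0"
      unfolding a_def[abs_def] by (intro tendsto_intros hlim)
    moreover have "sqrt (real N * \<delta> * v * (2 * c\<^sup>2 * C1\<^sup>2)) = c * C1 * sqrt (2 * real N * \<delta> * v)"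
    proof -
      have "real N * \<delta> * v * (2 * c\<^sup>2 * C1\<^sup>2) = (c * C1)\<^sup>2 * (2 * real N * \<delta> * v)" by (simp add: power_mult_distrib)
      then show ?thesis using C10 c_pos by (simp only: real_sqrt_mult real_sqrt_abs) simp
    qed
    ultimately show "a \<longlonglongrightarrow> c * C1 * sqrt (2 * real N * \<delta> * v)" by simp
    \<comment> \<open>The weighted sum does not depend on the mesh: Fatou's lemma is used for a
      constant sequence, with bounds \<open>a m\<close> that converge.\<close>
    show "AE \<omega> in M. (\<lambda>_ :: nat. \<Sum>k<N. g k \<omega> * dynkin f f1 f2 (s0 + real k * \<delta>) (s0 + real (Suc k) * \<delta>) \<omega>)
      \<longlonglongrightarrow> (\<Sum>k<N. g k \<omega> * dynkin f f1 f2 (s0 + real k * \<delta>) (s0 + real (Suc k) * \<delta>) \<omega>)" by simp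
    fix m
    define J where "J = N * n m"
    define H where "H = h m"
    define t where "t i = s0 + real i * H" for i
    define G where "G i = g (i div n m)" for i
    have H: "0 < H" "H \<le> 1" "real (n m) * H = \<delta>" using h[of m] by (auto simp: H_def)
    have t0: "0 \<le> t i" for i using assms(3) H by (simp add: t_def)
    have tS: "t i + H = t (Suc i)" for i by (simp add: t_def algebra_simps)
    have div: "i div n m < N" if "i < J" for i
      using that n0[of m] by (simp add: J_def less_mult_imp_div_less)
    have tk: "t (k * n m) = s0 + real k * \<delta>" for k
      using H(3) by (simp add: t_def mult.assoc)
    have mart: "L1_bound M (\<lambda>\<omega>. \<Sum>i<J. G i \<omega> * mart f1 f2 (t i) H \<omega>)
      (sqrt (real J * ((2 * c\<^sup>2 * C1\<^sup>2 * H + c ^ 4 * C\<^sup>2 * H\<^sup>2) * v)))"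
      unfolding t_def
    proof (rule L1_bound_mart_sum[OF C(3,4) C1 C(2) assms(3) H(1) _ _ _ v])
      fix i assume i: "i < J"
      have le: "real (i div n m) * \<delta> \<le> real i * H"
      proof -
        have "real (i div n m) * real (n m) \<le> real i" by (metis div_times_less_eq_dividend of_nat_le_iff of_nat_mult)
        then have "(real (i div n m) * real (n m)) * H \<le> real i * H" using H(1) by (intro mult_right_mono) auto
        then show ?thesis by (simp add: mult.assoc H(3))
      qed
      show "G i \<in> borel_measurable (F (s0 + real i * H))"
        unfolding G_def by (rule F_measurable_mono[OF _ g(1)[OF div[OF i]]]) (use le in simp)
      show "(\<integral>\<omega>. (G i \<omega>)\<^sup>2 \<partial>M) \<le> v" unfolding G_def by (rule g(3)[OF div[OF i]])
    qed (use g(2) in \<open>simp add: G_def\<close>)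
    have rem: "L1_bound M (\<lambda>\<omega>. \<Sum>i<J. G i \<omega> * (step_rem f f1 f2 (t i) H \<omega> - gen_rem f1 f2 (t i) H \<omega>)) (\<Sum>i<J. \<Gamma> * (R * H * sqrt H + R' * H * sqrt H))"
    proof (rule L1_bound_sum)
      fix i
      have "L1_bound M (\<lambda>\<omega>. \<Gamma> * (step_rem f f1 f2 (t i) H \<omega> - gen_rem f1 f2 (t i) H \<omega>)) (\<bar>\<Gamma>\<bar> * (R * H * sqrt H + R' * H * sqrt H))"
        by (intro L1_bound_cmult L1_bound_diff R(2) R'(2)) (use t0 H in auto)
      then show "L1_bound M (\<lambda>\<omega>. G i \<omega> * (step_rem f f1 f2 (t i) H \<omega> - gen_rem f1 f2 (t i) H \<omega>)) (\<Gamma> * (R * H * sqrt H + R' * H * sqrt H))"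
      proof (rule L1_bound_mono)
        show "AE \<omega> in M. \<bar>G i \<omega> * (step_rem f f1 f2 (t i) H \<omega> - gen_rem f1 f2 (t i) H \<omega>)\<bar>
          \<le> \<bar>\<Gamma> * (step_rem f f1 f2 (t i) H \<omega> - gen_rem f1 f2 (t i) H \<omega>)\<bar>"
          unfolding abs_mult by (intro AE_I2 mult_right_mono) (use g(2) G0 in \<open>simp_all add: G_def\<close>)
      qed (use G0 in simp)
    qed
    have eqa: "sqrt (real J * ((2 * c\<^sup>2 * C1\<^sup>2 * H + c ^ 4 * C\<^sup>2 * H\<^sup>2) * v)) + (\<Sum>i<J. \<Gamma> * (R * H * sqrt H + R' * H * sqrt H)) = a m"
    proof -
      have JH: "real J * H = real N * \<delta>" using H(3) by (simp add: J_def mult.assoc)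
      have "real J * ((2 * c\<^sup>2 * C1\<^sup>2 * H + c ^ 4 * C\<^sup>2 * H\<^sup>2) * v) = (real J * H) * v * (2 * c\<^sup>2 * C1\<^sup>2 + c ^ 4 * C\<^sup>2 * H)"
        by (simp add: algebra_simps power2_eq_square)
      moreover have "(\<Sum>i<J. \<Gamma> * (R * H * sqrt H + R' * H * sqrt H)) = (real J * H) * \<Gamma> * (R + R') * sqrt H"
        by (simp add: algebra_simps)
      ultimately show ?thesis unfolding a_def H_def[symmetric] by (simp only: JH)
    qed
    show "L1_bound M (\<lambda>\<omega>. \<Sum>k<N. g k \<omega> * dynkin f f1 f2 (s0 + real k * \<delta>) (s0 + real (Suc k) * \<delta>) \<omega>) (a m)"
    proof (rule L1_bound_AE_cong[OF L1_bound_add[OF mart rem, unfolded eqa]])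
      show "AE \<omega> in M. (\<Sum>k<N. g k \<omega> * dynkin f f1 f2 (s0 + real k * \<delta>) (s0 + real (Suc k) * \<delta>) \<omega>) =
        (\<Sum>i<J. G i \<omega> * mart f1 f2 (t i) H \<omega>) +
        (\<Sum>i<J. G i \<omega> * (step_rem f f1 f2 (t i) H \<omega> - gen_rem f1 f2 (t i) H \<omega>))"
        using path_increment
      proof eventually_elim
        case (elim \<omega>)
        define u where "u r = gen f1 f2 (X r \<omega>)" for r
        define D where "D i = f (X (t (Suc i)) \<omega>) - f (X (t i) \<omega>) - integral {t i..t (Suc i)} u" for i
        have contX: "continuous_on {0..} (\<lambda>t. X t \<omega>)" using elim by blast
        have contu: "continuous_on {0..} u"
          unfolding u_def by (rule continuous_on_compose2[OF gen_continuous[OF C(3,4)] contX]) auto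
        have block: "(\<Sum>i\<in>{k * n m..<k * n m + n m}. D i) = dynkin f f1 f2 (s0 + real k * \<delta>) (s0 + real (Suc k) * \<delta>) \<omega>" for k
        proof -
          have "(\<Sum>i\<in>{k * n m..<k * n m + n m}. D i) = (\<Sum>r<n m. D (k * n m + r))"
            by (simp add: sum.atLeastLessThan_shift_0[of _ "k * n m"] lessThan_atLeast0 add.commute)
          also have "\<dots> = (\<Sum>r<n m. f (X (t (k * n m + Suc r)) \<omega>) - f (X (t (k * n m + r)) \<omega>))
              - (\<Sum>r<n m. integral {t (k * n m + r)..t (k * n m + Suc r)} u)"
            by (simp add: D_def sum_subtractf)
          also have "(\<Sum>r<n m. f (X (t (k * n m + Suc r)) \<omega>) - f (X (t (k * n m + r)) \<omega>)) =
              f (X (t (Suc k * n m)) \<omega>) - f (X (t (k * n m)) \<omega>)"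
            using sum_lessThan_telescope[of "\<lambda>r. f (X (t (k * n m + r)) \<omega>)" "n m"] by (simp add: add.commute)
          also have "(\<Sum>r<n m. integral {t (k * n m + r)..t (k * n m + Suc r)} u) = integral {t (k * n m)..t (Suc k * n m)} u"
          proof -
            have sh: "t (k * n m + r) = t (k * n m) + real r * H" for r by (simp add: t_def algebra_simps)
            have e: "t (Suc k * n m) = t (k * n m) + real (n m) * H" using sh[of "n m"] by (simp add: add.commute)
            have "continuous_on {t (k * n m)..t (k * n m) + real (n m) * H} u"
              using t0[of "k * n m"] by (intro continuous_on_subset[OF contu]) auto
            from integral_grid[OF less_imp_le[OF H(1)] this] show ?thesis unfolding e sh by simp
          qed
          finally show ?thesis unfolding tk dynkin_def u_def by simp
        qed
        have "(\<Sum>i<J. G i \<omega> * D i) = (\<Sum>k<N. \<Sum>i\<in>{k * n m..<k * n m + n m}. G i \<omega> * D i)"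
          unfolding J_def by (simp add: sum.nat_group)
        also have "\<dots> = (\<Sum>k<N. g k \<omega> * dynkin f f1 f2 (s0 + real k * \<delta>) (s0 + real (Suc k) * \<delta>) \<omega>)"
        proof (rule sum.cong[OF refl])
          fix k
          have "(\<Sum>i\<in>{k * n m..<k * n m + n m}. G i \<omega> * D i) = (\<Sum>i\<in>{k * n m..<k * n m + n m}. g k \<omega> * D i)"
          proof (rule sum.cong[OF refl])
            fix i assume "i \<in> {k * n m..<k * n m + n m}"
            then have "i div n m = k" by (intro div_nat_eqI) (auto simp: mult.commute)
            then show "G i \<omega> * D i = g k \<omega> * D i" by (simp add: G_def)
          qed
          then show "(\<Sum>i\<in>{k * n m..<k * n m + n m}. G i \<omega> * D i) = g k \<omega> * dynkin f f1 f2 (s0 + real k * \<delta>) (s0 + real (Suc k) * \<delta>) \<omega>"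
            by (simp only: block[symmetric] sum_distrib_left)
        qed
        finally have E: "(\<Sum>i<J. G i \<omega> * D i) =
          (\<Sum>k<N. g k \<omega> * dynkin f f1 f2 (s0 + real k * \<delta>) (s0 + real (Suc k) * \<delta>) \<omega>)" .
        show ?case
          unfolding E[symmetric] sum.distrib[symmetric] step_rem_def gen_rem_def tS D_def u_def
          by (rule sum.cong[OF refl]) (simp add: algebra_simps)
      qed
    qed
  qed
qed

text \<open>The weights \<open>g k\<close> are truncated and Fatou's lemma is applied.\<close>

lemma L1_bound_dynkin_sum:
  assumes T: "test_fn f f1 f2" and C1: "\<And>x. \<bar>f1 x\<bar> \<le> C1"
    and t: "0 \<le> s0" "0 < \<delta>"
    and g: "\<And>k. k < N \<Longrightarrow> g k \<in> borel_measurable (F (s0 + real k * \<delta>))"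
      "\<And>k. k < N \<Longrightarrow> L1_bound M (\<lambda>\<omega>. (g k \<omega>)\<^sup>2) v" and v: "0 \<le> v"
  shows "L1_bound M (\<lambda>\<omega>. \<Sum>k<N. g k \<omega> * dynkin f f1 f2 (s0 + real k * \<delta>) (s0 + real (Suc k) * \<delta>) \<omega>)
    (c * C1 * sqrt (2 * real N * \<delta> * v))"
proof (rule L1_bound_Fatou)
  define G where "G R k \<omega> = max (- real R) (min (real R) (g k \<omega>))" for R k \<omega>
  show "L1_bound M (\<lambda>\<omega>. \<Sum>k<N. G R k \<omega> * dynkin f f1 f2 (s0 + real k * \<delta>) (s0 + real (Suc k) * \<delta>) \<omega>)
    (c * C1 * sqrt (2 * real N * \<delta> * v))" for R
  proof (rule L1_bound_dynkin_bounded[OF T C1 t _ _ _ v])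
    fix k assume k: "k < N"
    have [measurable]: "g k \<in> borel_measurable (F (s0 + real k * \<delta>))" by (rule g(1)[OF k])
    show "G R k \<in> borel_measurable (F (s0 + real k * \<delta>))" unfolding G_def by measurable
    have [measurable]: "g k \<in> borel_measurable M" by (rule F_measurable[OF g(1)[OF k]])
    have ig: "integrable M (\<lambda>\<omega>. (g k \<omega>)\<^sup>2)" "(\<integral>\<omega>. (g k \<omega>)\<^sup>2 \<partial>M) \<le> v"
      using L1_bound_imp_integrable[OF g(2)[OF k]] by auto
    have le: "(G R k \<omega>)\<^sup>2 \<le> (g k \<omega>)\<^sup>2" for \<omega>
    proof -
      have "\<bar>G R k \<omega>\<bar> \<le> \<bar>g k \<omega>\<bar>" by (auto simp: G_def)
      then show ?thesis by (simp add: abs_le_square_iff)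
    qed
    have "integrable M (\<lambda>\<omega>. (G R k \<omega>)\<^sup>2)"
      by (rule Bochner_Integration.integrable_bound[OF ig(1)]) (use le in \<open>auto simp: G_def\<close>)
    then have "(\<integral>\<omega>. (G R k \<omega>)\<^sup>2 \<partial>M) \<le> (\<integral>\<omega>. (g k \<omega>)\<^sup>2 \<partial>M)" using ig(1) le by (rule integral_mono)
    then show "(\<integral>\<omega>. (G R k \<omega>)\<^sup>2 \<partial>M) \<le> v" using ig(2) by simp
  next
    show "\<bar>G R k \<omega>\<bar> \<le> real R" for k \<omega> by (auto simp: G_def)
  qed
  show "AE \<omega> in M. (\<lambda>R. \<Sum>k<N. G R k \<omega> * dynkin f f1 f2 (s0 + real k * \<delta>) (s0 + real (Suc k) * \<delta>) \<omega>)
    \<longlonglongrightarrow> (\<Sum>k<N. g k \<omega> * dynkin f f1 f2 (s0 + real k * \<delta>) (s0 + real (Suc k) * \<delta>) \<omega>)"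
  proof (intro AE_I2 tendsto_sum tendsto_mult tendsto_const)
    fix \<omega> k
    obtain R0 where R0: "\<bar>g k \<omega>\<bar> \<le> real R0" using real_arch_simple by blast
    show "(\<lambda>R. G R k \<omega>) \<longlonglongrightarrow> g k \<omega>"
      by (rule tendsto_eventually) (use R0 in \<open>auto simp: G_def eventually_sequentially intro!: exI[of _ R0]\<close>)
  qed
qed auto

lemma L1_bound_dynkin:
  assumes T: "test_fn f f1 f2" and C1: "\<And>x. \<bar>f1 x\<bar> \<le> C1"
    and t: "0 \<le> s" "s \<le> t" and g: "g \<in> borel_measurable (F s)" "L1_bound M (\<lambda>\<omega>. (g \<omega>)\<^sup>2) v"
  shows "L1_bound M (\<lambda>\<omega>. g \<omega> * dynkin f f1 f2 s t \<omega>) (c * C1 * sqrt (2 * (t - s) * v))"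
proof (cases "s = t")
  case True
  have "C1 \<ge> 0" using C1[of 0] by linarith
  then show ?thesis using True L1_bound_zero by (simp add: dynkin_def)
next
  case False
  have "L1_bound M (\<lambda>\<omega>. \<Sum>k<1. g \<omega> * dynkin f f1 f2 (s + real k * (t - s)) (s + real (Suc k) * (t - s)) \<omega>)
    (c * C1 * sqrt (2 * real 1 * (t - s) * v))"
    by (rule L1_bound_dynkin_sum[OF T C1]) (use False assms L1_bound_nonneg in auto)
  then show ?thesis by simp
qed

end

section \<open>Second moment of the stationary law\<close>

lemma has_real_derivative_integral:
  fixes u :: "real \<Rightarrow> real"
  assumes "continuous_on {0..T} u" "t \<in> {0..T}"
  shows "((\<lambda>t. integral {0..t} u) has_real_derivative u t) (at t within {0..T})"
  using integral_has_vector_derivative[OF assms] by (simp add: has_real_derivative_iff_has_vector_derivative)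

text \<open>The path itself is not differentiable, but \<open>z = x - \<beta>\<close> is, with
  derivative \<open>b (x t)\<close>. Dissipativity then makes \<open>exp (k * t) * (z t)^2\<close>
  grow no faster than an integral of \<open>\<beta>^2\<close> and constants.\<close>

lemma dissipative_path_bound:
  fixes x \<beta> :: "real \<Rightarrow> real"
  assumes lip: "\<And>y z. \<bar>b y - b z\<bar> \<le> K * \<bar>y - z\<bar>" and K: "0 \<le> K"
    and diss: "\<And>y. b y * y \<le> A - D * y\<^sup>2" and D: "0 < D"
    and cont: "continuous_on {0..} x" "continuous_on {0..} \<beta>"
    and eq: "\<And>t. 0 \<le> t \<Longrightarrow> x t = x 0 + integral {0..t} (\<lambda>s. b (x s)) + \<beta> t"
    and T: "0 \<le> T"
  shows "(x T)\<^sup>2 \<le> 2 * exp (- (D / 2) * T) * (x 0)\<^sup>2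
    + 2 * integral {0..T} (\<lambda>s. 2 * \<bar>A\<bar> + (b 0)\<^sup>2 + (1 + K\<^sup>2 / D + D) * (\<beta> s)\<^sup>2) + 2 * (\<beta> T)\<^sup>2"
proof -
  \<comment> \<open>Of the dissipation \<open>2 * D * x^2\<close>, one half absorbs the cross term
    \<open>\<beta> * b x\<close> and the other half absorbs \<open>k * z^2\<close>.\<close>
  define k where "k = D / 2"
  define z where "z t = x 0 + integral {0..t} (\<lambda>s. b (x s))" for t
  define q where "q t = exp (k * t) * (z t)\<^sup>2" for t
  define q' where "q' t = exp (k * t) * (k * (z t)\<^sup>2 + 2 * z t * b (x t))" for t
  define w where "w s = 2 * \<bar>A\<bar> + (b 0)\<^sup>2 + (1 + K\<^sup>2 / D + D) * (\<beta> s)\<^sup>2" for s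
  have k: "0 < k" using D by (simp add: k_def)
  have w0: "0 \<le> w s" for s using D by (simp add: w_def)
  have contb: "continuous_on UNIV b" by (rule Lipschitz_imp_continuous[OF lip K])
  have contbx: "continuous_on {0..T} (\<lambda>s. b (x s))"
    by (rule continuous_on_compose2[OF contb continuous_on_subset[OF cont(1)]]) auto
  have contw: "continuous_on {0..T} w"
    unfolding w_def[abs_def] by (intro continuous_intros continuous_on_subset[OF cont(2)]) auto
  have dz: "(z has_real_derivative b (x t)) (at t within {0..T})" if "t \<in> {0..T}" for t
    unfolding z_def[abs_def] using has_real_derivative_integral[OF contbx that]
    by (auto intro!: derivative_eq_intros)
  have dq: "(q has_real_derivative q' t) (at t within {0..T})" if "t \<in> {0..T}" for t
    unfolding q_def[abs_def] q'_def
    by (rule derivative_eq_intros dz[OF that] refl | simp)+ (simp add: algebra_simps)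
  have int: "(q' has_integral (q T - q 0)) {0..T}"
    by (rule fundamental_theorem_of_calculus[OF T]) (use dq in \<open>simp add: has_real_derivative_iff_has_vector_derivative\<close>)
  have young: "2 * u * v \<le> D * u\<^sup>2 + v\<^sup>2 / D" for u v :: real
    using abs_mult_le_weighted_squares[OF D, of u v] by (simp add: abs_le_iff field_simps)
  have le: "q' t \<le> exp (k * T) * w t" if t: "t \<in> {0..T}" for t
  proof -
    have xz: "z t = x t - \<beta> t" using eq[of t] t by (simp add: z_def)
    have "\<bar>b (x t)\<bar> \<le> \<bar>b 0\<bar> + K * \<bar>x t\<bar>" using lip[of "x t" 0] by simp
    then have "\<bar>\<beta> t * b (x t)\<bar> \<le> \<bar>\<beta> t\<bar> * (\<bar>b 0\<bar> + K * \<bar>x t\<bar>)"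
      unfolding abs_mult by (rule mult_left_mono) simp
    then have 1: "- 2 * \<beta> t * b (x t) \<le> 2 * \<bar>\<beta> t\<bar> * \<bar>b 0\<bar> + 2 * \<bar>x t\<bar> * (K * \<bar>\<beta> t\<bar>)"
      by (simp add: algebra_simps abs_le_iff)
    have 2: "2 * \<bar>x t\<bar> * (K * \<bar>\<beta> t\<bar>) \<le> D * (x t)\<^sup>2 + K\<^sup>2 / D * (\<beta> t)\<^sup>2"
      using young[of "\<bar>x t\<bar>" "K * \<bar>\<beta> t\<bar>"] by (simp add: power_mult_distrib)
    have 3: "2 * \<bar>\<beta> t\<bar> * \<bar>b 0\<bar> \<le> (\<beta> t)\<^sup>2 + (b 0)\<^sup>2"
      using zero_le_power2[of "\<bar>\<beta> t\<bar> - \<bar>b 0\<bar>"] by (simp add: power2_diff)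
    have 4: "(z t)\<^sup>2 \<le> 2 * (x t)\<^sup>2 + 2 * (\<beta> t)\<^sup>2"
      unfolding xz using zero_le_power2[of "x t + \<beta> t"] by (simp add: power2_diff power2_sum)
    have 5: "k * (z t)\<^sup>2 \<le> D * (x t)\<^sup>2 + D * (\<beta> t)\<^sup>2"
      using mult_left_mono[OF 4, of k] k by (simp add: k_def algebra_simps)
    have "2 * z t * b (x t) = 2 * (b (x t) * x t) + - 2 * \<beta> t * b (x t)" unfolding xz by (simp add: algebra_simps)
    also have "\<dots> \<le> 2 * (A - D * (x t)\<^sup>2) + - 2 * \<beta> t * b (x t)" using diss[of "x t"] by simp
    finally have 6: "2 * z t * b (x t) \<le> 2 * (A - D * (x t)\<^sup>2) + - 2 * \<beta> t * b (x t)" .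
    have arith: "kz + zb \<le> 2 * A + b0 + (B2 + KB + DB)"
      if "zb \<le> 2 * (A - Dx) + p" "p \<le> q + r" "r \<le> Dx + KB" "q \<le> B2 + b0" "kz \<le> Dx + DB"
      for kz zb b0 B2 KB DB Dx p q r :: real
      using that by simp
    have "k * (z t)\<^sup>2 + 2 * z t * b (x t) \<le> 2 * A + (b 0)\<^sup>2 + ((\<beta> t)\<^sup>2 + K\<^sup>2 / D * (\<beta> t)\<^sup>2 + D * (\<beta> t)\<^sup>2)"
      by (rule arith[OF 6 1 2 3 5])
    also have "\<dots> \<le> w t" by (simp add: w_def algebra_simps)
    finally have "q' t \<le> exp (k * t) * w t" unfolding q'_def by (rule mult_left_mono) simp
    also have "\<dots> \<le> exp (k * T) * w t" using t k w0 by (intro mult_right_mono) auto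
    finally show ?thesis .
  qed
  have intw: "((\<lambda>s. exp (k * T) * w s) has_integral (exp (k * T) * integral {0..T} w)) {0..T}"
    using integrable_continuous_real[OF contw] by (intro has_integral_mult_right) (simp add: has_integral_integral)
  have "q T - q 0 \<le> exp (k * T) * integral {0..T} w"
    by (rule has_integral_le[OF int intw le])
  then have "exp (k * T) * (z T)\<^sup>2 \<le> (x 0)\<^sup>2 + exp (k * T) * integral {0..T} w"
    by (simp add: q_def z_def)
  from mult_left_mono[OF this, of "exp (- k * T)"]
  have zT: "(z T)\<^sup>2 \<le> exp (- k * T) * (x 0)\<^sup>2 + integral {0..T} w"
    by (simp add: distrib_left flip: mult.assoc exp_add)
  have "(x T)\<^sup>2 \<le> 2 * (z T)\<^sup>2 + 2 * (\<beta> T)\<^sup>2"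
    using eq[OF T] zero_le_power2[of "z T - \<beta> T"] by (simp add: z_def power2_diff power2_sum)
  then show ?thesis using zT unfolding k_def w_def by simp
qed

context adapted_sde
begin

lemma L1_bound_B_square:
  assumes "0 \<le> s" "s \<le> T"
  shows "L1_bound M (\<lambda>\<omega>. (c * B s \<omega>)\<^sup>2) (c\<^sup>2 * T)"
proof -
  have B0: "AE \<omega> in M. (c * B s \<omega>)\<^sup>2 = c\<^sup>2 * (B s \<omega> - B 0 \<omega>)\<^sup>2"
    using paths by eventually_elim (simp only: power_mult_distrib diff_zero)
  have "L1_bound M (\<lambda>\<omega>. c\<^sup>2 * (B s \<omega> - B 0 \<omega>)\<^sup>2) (\<bar>c\<^sup>2\<bar> * s)"
  proof (cases "s = 0")
    case True then show ?thesis using L1_bound_zero by simp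
  next
    case False
    then have s: "0 < s" using assms by simp
    show ?thesis
    proof (intro L1_bound_cmult L1_bound_integrable)
      show "integrable M (\<lambda>\<omega>. (B s \<omega> - B 0 \<omega>)\<^sup>2)" by (rule increment_moments(1)[OF order_refl s])
      show "(\<integral>\<omega>. \<bar>(B s \<omega> - B 0 \<omega>)\<^sup>2\<bar> \<partial>M) \<le> s"
        unfolding abs_power2 increment_moments(3)[OF order_refl s] by simp
    qed
  qed
  then have "L1_bound M (\<lambda>\<omega>. (c * B s \<omega>)\<^sup>2) (\<bar>c\<^sup>2\<bar> * s)" by (rule L1_bound_AE_cong[OF _ B0])
  then show ?thesis by (rule L1_bound_weaken) (use assms in \<open>simp add: mult_left_mono\<close>)
qed

lemma dissipative_contraction:
  assumes diss: "\<And>y. b y * y \<le> A - D * y\<^sup>2" and D: "0 < D"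
  obtains T C H where "0 < T" "L1_bound M H C" "AE \<omega> in M. (X T \<omega>)\<^sup>2 \<le> (X 0 \<omega>)\<^sup>2 / 2 + H \<omega>"
proof -
  \<comment> \<open>The time is chosen to turn the factor \<open>2 * exp (- (D / 2) * T)\<close>
    into 1/2, a strict contraction.\<close>
  define T where "T = ln 4 / (D / 2)"
  have T: "0 < T" using D by (simp add: T_def)
  have half: "2 * exp (- (D / 2) * T) = 1 / 2"
    using D by (simp add: T_def exp_minus field_simps)
  define G where "G = 1 + K\<^sup>2 / D + D"
  define u where "u s \<omega> = 2 * \<bar>A\<bar> + (b 0)\<^sup>2 + G * (c * B s \<omega>)\<^sup>2" for s \<omega>
  define H where "H \<omega> = 2 * integral {0..T} (\<lambda>s. u s \<omega>) + 2 * (c * B T \<omega>)\<^sup>2" for \<omega>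
  have "L1_bound M H (\<bar>2\<bar> * ((T - 0) * (\<bar>2 * \<bar>A\<bar> + (b 0)\<^sup>2\<bar> + \<bar>G\<bar> * (c\<^sup>2 * T))) + \<bar>2\<bar> * (c\<^sup>2 * T))"
    unfolding H_def u_def
  proof (intro L1_bound_add L1_bound_cmult L1_bound_integral L1_bound_const)
    show "AE \<omega> in M. continuous_on {0..T} (\<lambda>r. 2 * \<bar>A\<bar> + (b 0)\<^sup>2 + G * (c * B r \<omega>)\<^sup>2)"
      using paths
    proof eventually_elim
      case (elim \<omega>)
      then have "continuous_on {0..} (\<lambda>t. B t \<omega>)" by blast
      then have "continuous_on {0..T} (\<lambda>t. B t \<omega>)" by (rule continuous_on_subset) auto
      then show ?case by (intro continuous_intros)
    qed
  qed (use T in \<open>auto intro: L1_bound_B_square\<close>)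
  moreover have "AE \<omega> in M. (X T \<omega>)\<^sup>2 \<le> (X 0 \<omega>)\<^sup>2 / 2 + H \<omega>"
    using paths
  proof eventually_elim
    case (elim \<omega>)
    have "(X T \<omega>)\<^sup>2 \<le> 2 * exp (- (D / 2) * T) * (X 0 \<omega>)\<^sup>2
      + 2 * integral {0..T} (\<lambda>s. 2 * \<bar>A\<bar> + (b 0)\<^sup>2 + (1 + K\<^sup>2 / D + D) * (c * B s \<omega>)\<^sup>2) + 2 * (c * B T \<omega>)\<^sup>2"
    proof (rule dissipative_path_bound[OF Lipschitz K_nonneg diss D])
      show "continuous_on {0..} (\<lambda>s. X s \<omega>)" using elim by blast
      show "continuous_on {0..} (\<lambda>s. c * B s \<omega>)" using elim by (intro continuous_intros) blast
      show "X t \<omega> = X 0 \<omega> + integral {0..t} (\<lambda>s. b (X s \<omega>)) + c * B t \<omega>" if "0 \<le> t" for t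
        using elim that by blast
    qed (use T in simp)
    then show ?case unfolding half H_def u_def G_def by simp
  qed
  ultimately show ?thesis using T that by blast
qed

text \<open>Taking expectations in the contraction would presuppose the moment in question. With the
  truncated moment \<open>\<phi> r\<close>, stationarity gives
  \<open>\<phi> r \<le> \<phi> (2 * r) / 2 + C\<close>; iteration leaves
  \<open>\<phi> (2^n * r) / 2^n\<close>, which tends to 0, so \<open>\<phi>\<close> is bounded by
  \<open>2 * C\<close> for all levels \<open>r\<close>.\<close>

lemma square_integrable_of_dissipative:
  assumes diss: "\<And>y. b y * y \<le> A - D * y\<^sup>2" and D: "0 < D"
  shows "integrable M (\<lambda>\<omega>. (X 0 \<omega>)\<^sup>2)"
proof -
  obtain T C H where T: "0 < T" and H: "L1_bound M H C"
    and con: "AE \<omega> in M. (X T \<omega>)\<^sup>2 \<le> (X 0 \<omega>)\<^sup>2 / 2 + H \<omega>"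
    using dissipative_contraction[OF diss D] by blast
  have [measurable]: "X 0 \<in> borel_measurable M" "X T \<in> borel_measurable M" using X_measurable T by auto
  have C: "0 \<le> C" using L1_bound_nonneg[OF H] .
  define \<phi> where "\<phi> r = (\<integral>\<omega>. min ((X 0 \<omega>)\<^sup>2) r \<partial>M)" for r
  have int: "integrable M (\<lambda>\<omega>. min (a * (X t \<omega>)\<^sup>2) r)" if "0 \<le> r" "0 \<le> a" "X t \<in> borel_measurable M" for a r t
    by (rule Bochner_Integration.integrable_bound[of _ "\<lambda>_. r"]) (use that in \<open>auto simp: min_def\<close>)
  have step: "\<phi> r \<le> \<phi> (2 * r) / 2 + C" if r: "0 \<le> r" for r
  proof -
    \<comment> \<open>\<open>H\<close> contains a time integral and carries only an outer bound;
      this positive part is a measurable function below it that can be integrated.\<close>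
    define U where "U \<omega> = max 0 (min ((X T \<omega>)\<^sup>2) r - min ((X 0 \<omega>)\<^sup>2 / 2) r)" for \<omega>
    have Um: "U \<in> borel_measurable M" unfolding U_def by measurable
    have "L1_bound M U C"
    proof (rule L1_bound_mono[OF H _ order_refl])
      show "AE \<omega> in M. \<bar>U \<omega>\<bar> \<le> \<bar>H \<omega>\<bar>"
        using con by eventually_elim (auto simp: U_def)
    qed
    note U = L1_bound_imp_integrable[OF this Um]
    have i1: "integrable M (\<lambda>\<omega>. min ((X T \<omega>)\<^sup>2) r)" "integrable M (\<lambda>\<omega>. min ((X 0 \<omega>)\<^sup>2 / 2) r)"
      using int[of r 1 T] int[of r "1/2" 0] r by auto
    have "\<phi> r = (\<integral>\<omega>. min ((X T \<omega>)\<^sup>2) r \<partial>M)"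
      unfolding \<phi>_def using stationary_integral(2)[of T "\<lambda>x. min (x\<^sup>2) r"] T by simp
    also have "\<dots> \<le> (\<integral>\<omega>. min ((X 0 \<omega>)\<^sup>2 / 2) r + U \<omega> \<partial>M)"
      using i1 U(1) by (intro integral_mono) (auto simp: U_def)
    also have "\<dots> = (\<integral>\<omega>. min ((X 0 \<omega>)\<^sup>2) (2 * r) / 2 \<partial>M) + (\<integral>\<omega>. U \<omega> \<partial>M)"
    proof -
      have "min (y / 2) r = min y (2 * r) / 2" for y :: real by (auto simp: min_def)
      then have e: "(\<lambda>\<omega>. min ((X 0 \<omega>)\<^sup>2 / 2) r) = (\<lambda>\<omega>. min ((X 0 \<omega>)\<^sup>2) (2 * r) / 2)" by (simp only:)
      show ?thesis using Bochner_Integration.integral_add[OF i1(2) U(1)] unfolding e .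
    qed
    also have "\<dots> \<le> \<phi> (2 * r) / 2 + C" using U(3) by (simp add: \<phi>_def)
    finally show ?thesis .
  qed
  have iter: "\<phi> r \<le> \<phi> (2 ^ n * r) / 2 ^ n + 2 * C * (1 - 1 / 2 ^ n)" if "0 \<le> r" for r n
  proof (induction n)
    case (Suc n)
    have "\<phi> (2 ^ n * r) / 2 ^ n \<le> (\<phi> (2 * (2 ^ n * r)) / 2 + C) / 2 ^ n"
      using step[of "2 ^ n * r"] that by (intro divide_right_mono) auto
    then show ?case using Suc by (simp add: field_simps)
  qed simp
  have bound: "\<phi> r \<le> 2 * C" if r: "0 \<le> r" for r
  proof (rule LIMSEQ_le_const)
    \<comment> \<open>Rescaled, \<open>\<phi> (2^n * r) / 2^n\<close> is the mean of a quantity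
      bounded by \<open>r\<close> that tends to 0 pointwise, so dominated convergence works before
      any moment is known.\<close>
    have "(\<lambda>n. \<integral>\<omega>. min ((X 0 \<omega>)\<^sup>2 * (1 / 2) ^ n) r \<partial>M) \<longlonglongrightarrow> (\<integral>\<omega>. 0 \<partial>M)"
    proof (rule integral_dominated_convergence[where w = "\<lambda>_. r"])
      show "AE \<omega> in M. (\<lambda>n. min ((X 0 \<omega>)\<^sup>2 * (1 / 2) ^ n) r) \<longlonglongrightarrow> 0"
      proof (rule AE_I2)
        fix \<omega>
        have "(\<lambda>n. min ((X 0 \<omega>)\<^sup>2 * (1 / 2) ^ n) r) \<longlonglongrightarrow> min ((X 0 \<omega>)\<^sup>2 * 0) r"
          by (intro tendsto_intros LIMSEQ_realpow_zero) auto
        then show "(\<lambda>n. min ((X 0 \<omega>)\<^sup>2 * (1 / 2) ^ n) r) \<longlonglongrightarrow> 0" using r by simp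
      qed
      show "AE \<omega> in M. norm (min ((X 0 \<omega>)\<^sup>2 * (1 / 2) ^ n) r) \<le> r" for n
        using r by (intro AE_I2) (auto simp: min_def)
    qed auto
    moreover have "(\<integral>\<omega>. min ((X 0 \<omega>)\<^sup>2 * (1 / 2) ^ n) r \<partial>M) = \<phi> (2 ^ n * r) / 2 ^ n" for n
    proof -
      have "min (y * (1 / 2) ^ n) r = min y (2 ^ n * r) / 2 ^ n" for y :: real
        by (auto simp: min_def power_divide field_simps)
      then show ?thesis by (simp add: \<phi>_def)
    qed
    ultimately have "(\<lambda>n. \<phi> (2 ^ n * r) / 2 ^ n) \<longlonglongrightarrow> 0" by simp
    from tendsto_add[OF this tendsto_const[of "2 * C"]]
    show "(\<lambda>n. \<phi> (2 ^ n * r) / 2 ^ n + 2 * C) \<longlonglongrightarrow> 2 * C" by simp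
    show "\<exists>N. \<forall>n\<ge>N. \<phi> r \<le> \<phi> (2 ^ n * r) / 2 ^ n + 2 * C"
    proof (intro exI allI impI)
      fix n :: nat
      have "2 * C * (1 - 1 / 2 ^ n) \<le> 2 * C * 1" using C by (intro mult_left_mono) auto
      then show "\<phi> r \<le> \<phi> (2 ^ n * r) / 2 ^ n + 2 * C" using iter[OF r, of n] by linarith
    qed
  qed
  have "L1_bound M (\<lambda>\<omega>. (X 0 \<omega>)\<^sup>2) (2 * C)"
  proof (rule L1_bound_Fatou)
    show "L1_bound M (\<lambda>\<omega>. min ((X 0 \<omega>)\<^sup>2) (real n)) (2 * C)" for n
      using int[of "real n" 1 0] bound[of "real n"] by (intro L1_bound_integrable) (auto simp: \<phi>_def)
    show "AE \<omega> in M. (\<lambda>n. min ((X 0 \<omega>)\<^sup>2) (real n)) \<longlonglongrightarrow> (X 0 \<omega>)\<^sup>2"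
    proof (rule AE_I2)
      fix \<omega>
      obtain n0 where n0: "(X 0 \<omega>)\<^sup>2 \<le> real n0" using real_arch_simple by blast
      show "(\<lambda>n. min ((X 0 \<omega>)\<^sup>2) (real n)) \<longlonglongrightarrow> (X 0 \<omega>)\<^sup>2"
        by (rule tendsto_eventually) (use n0 in \<open>auto simp: eventually_sequentially intro!: exI[of _ n0] min_absorb1\<close>)
    qed
  qed auto
  then show ?thesis by (rule L1_bound_imp_integrable(1)) measurable
qed

end

text \<open>Agreement holds almost surely for all times at once. The path properties, the integral
  equation and the laws therefore transfer to the adapted version, and so does any functional that
  reads the path at several times.\<close>

lemma (in brownian) adapted_sde_solution:
  fixes X :: "'a \<Rightarrow> real \<Rightarrow> real"
  assumes xi: "xi = (\<lambda>\<omega>. X \<omega> 0)"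
    and lip: "\<And>x y. \<bar>b x - b y\<bar> \<le> K * \<bar>x - y\<bar>" and K: "0 \<le> K" and c: "0 < c"
    and sol: "AE \<omega> in M. continuous_on {0..} (X \<omega>) \<and>
      (\<forall>t\<ge>0. X \<omega> t = X \<omega> 0 + integral {0..t} (\<lambda>s. b (X \<omega> s)) + c * B \<omega> t)"
    and meas: "\<And>t. 0 \<le> t \<Longrightarrow> (\<lambda>\<omega>. X \<omega> t) \<in> borel_measurable M"
    and inv: "\<And>t. 0 \<le> t \<Longrightarrow> distr M borel (\<lambda>\<omega>. X \<omega> t) = distr M borel (\<lambda>\<omega>. X \<omega> 0)"
  shows "AE \<omega> in M. \<forall>t\<ge>0. solution b c t \<omega> = X \<omega> t"
    "adapted_sde M hist (solution b c) (\<lambda>t \<omega>. B \<omega> t) b c K"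
proof -
  have bm: "b \<in> borel_measurable borel"
    by (rule borel_measurable_continuous_onI[OF Lipschitz_imp_continuous[OF lip K]])
  show AE_eq: "AE \<omega> in M. \<forall>t\<ge>0. solution b c t \<omega> = X \<omega> t"
    using sol
  proof eventually_elim
    case (elim \<omega>)
    show ?case
    proof (intro allI impI)
      fix t :: real assume t: "0 \<le> t"
      have "(\<lambda>m. euler b c (t / real (Suc m)) (B \<omega>) (X \<omega> 0) (Suc m)) \<longlonglongrightarrow> X \<omega> t"
      proof (rule euler_tendsto[OF lip K _ _ t])
        show "continuous_on {0..} (X \<omega>)" using elim by blast
        show "X \<omega> t = X \<omega> 0 + integral {0..t} (\<lambda>s. b (X \<omega> s)) + c * B \<omega> t" if "0 \<le> t" for t
          using elim that by blast
      qed
      moreover have "xi \<omega> = X \<omega> 0" using fun_cong[OF xi] by simp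
      ultimately show "solution b c t \<omega> = X \<omega> t" unfolding solution_def by (simp only: limI)
    qed
  qed
  have bmi: "AE \<omega> in M. B \<omega> 0 = 0 \<and> continuous_on {0..} (B \<omega>)"
    using brownian by (simp add: brownian_motion_indep_def)
  have sol_meas: "solution b c t \<in> borel_measurable M" if "0 \<le> t" for t
    by (rule measurable_from_subalg[OF subalgebra_hist solution_hist_measurable[OF bm that]])
  have distr_eq: "distr M borel (solution b c t) = distr M borel (\<lambda>\<omega>. X \<omega> t)" if "0 \<le> t" for t
  proof (rule distr_cong_AE)
    show "AE \<omega> in M. solution b c t \<omega> = X \<omega> t" using AE_eq that by (auto elim: eventually_mono)
  qed (use sol_meas meas that in auto)
  show "adapted_sde M hist (solution b c) (\<lambda>t \<omega>. B \<omega> t) b c K"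
  proof unfold_locales
    show "AE \<omega> in M. continuous_on {0..} (\<lambda>t. solution b c t \<omega>) \<and> continuous_on {0..} (\<lambda>t. B \<omega> t) \<and> B \<omega> 0 = 0 \<and>
        (\<forall>t\<ge>0. solution b c t \<omega> = solution b c 0 \<omega> + integral {0..t} (\<lambda>s. b (solution b c s \<omega>)) + c * B \<omega> t)"
      using sol bmi AE_eq
    proof eventually_elim
      case (elim \<omega>)
      have e: "solution b c t \<omega> = X \<omega> t" if "0 \<le> t" for t using elim(3) that by blast
      have cX: "continuous_on {0..} (X \<omega>)" using elim(1) by blast
      have "continuous_on {0..} (\<lambda>t. solution b c t \<omega>)"
        by (rule continuous_on_eq[OF cX]) (simp add: e)
      moreover have "solution b c t \<omega> = solution b c 0 \<omega> + integral {0..t} (\<lambda>s. b (solution b c s \<omega>)) + c * B \<omega> t" if t: "0 \<le> t" for t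
      proof -
        have "integral {0..t} (\<lambda>s. b (solution b c s \<omega>)) = integral {0..t} (\<lambda>s. b (X \<omega> s))"
          by (rule Henstock_Kurzweil_Integration.integral_cong) (simp add: e)
        then show ?thesis using elim(1) t e[OF t] e[OF order_refl] by presburger
      qed
      ultimately show ?case using elim(2) by blast
    qed
    show "distr M borel (solution b c t) = distr M borel (solution b c 0)" if "0 \<le> t" for t
      using distr_eq[OF that] distr_eq[OF order_refl] inv[OF that] by simp
    show "distributed M lborel (\<lambda>\<omega>. B \<omega> t - B \<omega> s) (\<lambda>x. ennreal (normal_density 0 (sqrt (t - s)) x))"
      if "0 \<le> s" "s < t" for s t using brownian that by (simp add: brownian_motion_indep_def)
  qed (rule subalgebra_hist sets_history_mono solution_hist_measurable[OF bm] increment_hist_measurable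
      hist_indep lip K c; assumption)+
qed

section \<open>Periodic cell problems\<close>

lemma antiderivative_exists:
  fixes f :: "real \<Rightarrow> real"
  assumes "continuous_on UNIV f"
  obtains G where "\<And>x. (G has_real_derivative f x) (at x)"
proof -
  have "\<exists>G. \<forall>x::real. - \<infinity> < ereal x \<longrightarrow> ereal x < \<infinity> \<longrightarrow> (G has_vector_derivative f x) (at x)"
    by (rule einterval_antiderivative) (use assms in \<open>auto simp: continuous_on_eq_continuous_at\<close>)
  then show ?thesis using that by (auto simp: has_real_derivative_iff_has_vector_derivative)
qed

lemma periodic_add_nat:
  fixes f :: "real \<Rightarrow> 'b"
  assumes "\<And>x. f (x + L) = f x"
  shows "f (x + real n * L) = f x"
proof (induction n)
  case (Suc n)
  have "f (x + real (Suc n) * L) = f ((x + real n * L) + L)" by (simp add: algebra_simps)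
  then show ?case using Suc assms by simp
qed simp

lemma periodic_bounded:
  fixes f :: "real \<Rightarrow> real"
  assumes per: "\<And>x. f (x + L) = f x" and L: "0 < L" and cont: "continuous_on UNIV f"
  obtains C where "0 < C" "\<And>x. \<bar>f x\<bar> \<le> C"
proof -
  have "bounded (f ` {0..L})"
    by (intro compact_imp_bounded compact_continuous_image continuous_on_subset[OF cont]) auto
  then obtain C where C: "0 < C" "\<And>x. x \<in> {0..L} \<Longrightarrow> \<bar>f x\<bar> \<le> C" by (auto simp: bounded_pos)
  have "\<bar>f x\<bar> \<le> C" for x
  proof -
    define k where "k = \<lfloor>x / L\<rfloor>"
    define y where "y = x - of_int k * L"
    have y: "y \<in> {0..L}"
    proof -
      have "of_int k \<le> x / L" "x / L < of_int k + 1" unfolding k_def by linarith+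
      then show ?thesis using L by (simp add: y_def field_simps)
    qed
    have "f x = f y"
    proof (cases "0 \<le> k")
      case True
      then have "x = y + real (nat k) * L" by (simp add: y_def)
      then show ?thesis using periodic_add_nat[of f L y "nat k", OF per] by simp
    next
      case False
      then have "y = x + real (nat (- k)) * L" by (simp add: y_def)
      then show ?thesis using periodic_add_nat[of f L x "nat (- k)", OF per] by simp
    qed
    then show ?thesis using C(2)[OF y] by simp
  qed
  then show ?thesis using C(1) that by blast
qed

text \<open>The difference \<open>G (x + L) - G x\<close> has derivative 0, hence is a constant,
  namely the integral over a period; mean zero makes \<open>G\<close> periodic and therefore
  bounded.\<close>

lemma periodic_antiderivative_bounded:
  fixes f :: "real \<Rightarrow> real"
  assumes per: "\<And>x. f (x + L) = f x" and L: "0 < L" and cont: "continuous_on UNIV f"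
    and mean: "integral {0..L} f = 0"
  obtains G C where "\<And>x. (G has_real_derivative f x) (at x)" "0 < C" "\<And>x. \<bar>G x\<bar> \<le> C"
proof -
  obtain G where G: "\<And>x. (G has_real_derivative f x) (at x)" using antiderivative_exists[OF cont] by blast
  have "((\<lambda>x. G (x + L) - G x) has_real_derivative f (x + L) - f x) (at x)" for x
    using G[of "x + L"] by (intro derivative_intros G) (simp add: DERIV_shift)
  then have "((\<lambda>x. G (x + L) - G x) has_real_derivative 0) (at x)" for x using per by simp
  then have const: "G (x + L) - G x = G (0 + L) - G 0" for x
    by (intro DERIV_isconst_all) blast
  have "(f has_integral (G L - G 0)) {0..L}"
    by (rule fundamental_theorem_of_calculus)
      (use L G in \<open>auto simp: has_real_derivative_iff_has_vector_derivative[symmetric] intro: has_field_derivative_at_within\<close>)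
  then have "G L - G 0 = 0" using mean by (simp add: integral_unique)
  then have perG: "G (x + L) = G x" for x using const[of x] by simp
  have "continuous_on UNIV G" using G by (auto intro!: DERIV_isCont continuous_at_imp_continuous_on)
  then obtain C where "0 < C" "\<And>x. \<bar>G x\<bar> \<le> C" using periodic_bounded[of G L] perG L by blast
  then show ?thesis using G that by blast
qed

lemma periodic_derivative:
  fixes f f' :: "real \<Rightarrow> real"
  assumes per: "\<And>x. f (x + L) = f x" and d: "\<And>x. (f has_real_derivative f' x) (at x)"
  shows "f' (x + L) = f' x"
proof -
  have "((\<lambda>x. f (x + L)) has_real_derivative f' (x + L)) (at x)" using d[of "x + L"] by (simp add: DERIV_shift)
  then show ?thesis using d[of x] per DERIV_unique by simp
qed

text \<open>\<open>q\<close> is the derivative of the corrected coordinate \<open>y + H y\<close> in which the fast drift disappears;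
  \<open>G\<close> provides the corrector that replaces \<open>q\<close> by its mean \<open>Kh\<close> under the invariant density.\<close>

locale cell_problem =
  fixes \<alpha> \<sigma> a d Kv P \<kappa>0 s0 S1 CH CG Kh :: real
    and dV p dp ddp q H G :: "real \<Rightarrow> real"
  assumes alpha: "0 < \<alpha>" and sigma: "0 < \<sigma>"
    and dV_Lipschitz: "\<And>x y. \<bar>dV x - dV y\<bar> \<le> Kv * \<bar>x - y\<bar>" and Kv: "0 < Kv"
    and dissipative: "\<And>x. d * x\<^sup>2 - a \<le> dV x * x" and d: "0 < d" and a: "0 < a"
    and p_deriv: "\<And>x. (p has_real_derivative dp x) (at x)"
    and dp_deriv: "\<And>x. (dp has_real_derivative ddp x) (at x)"
    and dp_bound: "\<And>x. \<bar>dp x\<bar> \<le> P" and ddp_bound: "\<And>x. \<bar>ddp x\<bar> \<le> P"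
    and q_eq: "\<And>y. q y = \<kappa>0 * exp (p y / \<sigma>)" and kappa0: "0 < \<kappa>0"
    and s0: "0 < s0" "\<And>y. s0 \<le> q y" and S1: "\<And>y. q y \<le> S1"
    and H_deriv: "\<And>y. (H has_real_derivative q y - 1) (at y)" and H_bound: "\<And>y. \<bar>H y\<bar> \<le> CH"
    and G_deriv: "\<And>y. (G has_real_derivative (q y - Kh) * exp (- p y / \<sigma>)) (at y)"
    and G_bound: "\<And>y. \<bar>G y\<bar> \<le> CG"

text \<open>Both correctors are bounded antiderivatives of periodic functions of mean zero, and the
  two mean conditions fix the two constants: the normalisation \<open>\<kappa>0\<close> of
  \<open>q\<close>, and the effective coefficient \<open>L^2 / (Z * Zh)\<close>.\<close>

lemma periodic_cell_problem:
  fixes p dp ddp :: "real \<Rightarrow> real"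
  assumes "0 < \<alpha>" "0 < \<sigma>" and L: "0 < L"
    and "\<And>x y. \<bar>dV x - dV y\<bar> \<le> Kv * \<bar>x - y\<bar>" "0 < Kv"
    and "\<And>x. d * x\<^sup>2 - a \<le> dV x * x" "0 < d" "0 < a"
    and per: "\<And>x. p (x + L) = p x"
    and dp: "\<And>x. (p has_real_derivative dp x) (at x)" and ddp: "\<And>x. (dp has_real_derivative ddp x) (at x)"
    and ddp_cont: "continuous_on UNIV ddp"
  defines "Z \<equiv> integral {0..L} (\<lambda>y. exp (- p y / \<sigma>))" and "Zh \<equiv> integral {0..L} (\<lambda>y. exp (p y / \<sigma>))"
  obtains P \<kappa>0 s0 S1 CH CG q H G where
    "cell_problem \<alpha> \<sigma> a d Kv P \<kappa>0 s0 S1 CH CG (L\<^sup>2 / (Z * Zh)) dV p dp ddp q H G"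
proof -
  have pc: "continuous_on UNIV p" and dpc: "continuous_on UNIV dp"
    using dp ddp by (auto intro!: DERIV_isCont continuous_at_imp_continuous_on)
  have dpper: "dp (x + L) = dp x" for x by (rule periodic_derivative[OF per dp])
  have ddpper: "ddp (x + L) = ddp x" for x by (rule periodic_derivative[OF dpper ddp])
  obtain P0 where P0: "0 < P0" "\<And>x. \<bar>p x\<bar> \<le> P0" using periodic_bounded[OF per L pc] by blast
  obtain P1 where P1: "0 < P1" "\<And>x. \<bar>dp x\<bar> \<le> P1" using periodic_bounded[OF dpper L dpc] by blast
  obtain P2 where P2: "0 < P2" "\<And>x. \<bar>ddp x\<bar> \<le> P2" using periodic_bounded[OF ddpper L ddp_cont] by blast
  have e1: "continuous_on A (\<lambda>y. exp (- p y / \<sigma>))" "continuous_on A (\<lambda>y. exp (p y / \<sigma>))" for A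
    using assms(2) by (auto intro!: continuous_intros continuous_on_subset[OF pc])
  have pos: "0 < integral {0..L} u" if "continuous_on UNIV u" "\<And>x. 0 < u x" for u :: "real \<Rightarrow> real"
  proof -
    have c: "continuous_on {0..L} u" by (rule continuous_on_subset[OF that(1)]) simp
    have "0 \<le> integral {0..L} u"
      by (rule Henstock_Kurzweil_Integration.integral_nonneg[OF integrable_continuous_real[OF c]]) (use that(2) less_imp_le in blast)
    moreover have "integral {0..L} u \<noteq> 0"
    proof
      assume "integral {0..L} u = 0"
      then have "u 0 = 0"
        using integral_eq_0_iff[OF c L] that(2) L less_imp_le by (metis atLeastAtMost_iff less_eq_real_def)
      then show False using that(2)[of 0] by simp
    qed
    ultimately show ?thesis by simp
  qed
  have Z: "0 < Z" "0 < Zh" unfolding Z_def Zh_def by (rule pos[OF e1(1)] pos[OF e1(2)], simp)+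
  define Kh where "Kh = L\<^sup>2 / (Z * Zh)"
  \<comment> \<open>This normalisation gives \<open>q\<close> mean 1 over a period, so that
    \<open>q - 1\<close> has a bounded antiderivative.\<close>
  define \<kappa>0 where "\<kappa>0 = L / Zh"
  define q where "q y = \<kappa>0 * exp (p y / \<sigma>)" for y
  have k0: "0 < \<kappa>0" using L Z by (simp add: \<kappa>0_def)
  have qc: "continuous_on A q" for A unfolding q_def[abs_def] by (intro continuous_intros e1)
  have i1: "(\<lambda>y. exp (p y / \<sigma>)) integrable_on {0..L}" "(\<lambda>y. exp (- p y / \<sigma>)) integrable_on {0..L}"
    by (rule integrable_continuous_real, rule e1)+
  have "integral {0..L} (\<lambda>y. q y - 1) = integral {0..L} q - integral {0..L} (\<lambda>y. 1)"
    by (rule Henstock_Kurzweil_Integration.integral_diff) (auto intro!: integrable_continuous_real qc)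
  also have "\<dots> = 0" using L Z i1 by (simp add: q_def[abs_def] \<kappa>0_def Zh_def[symmetric])
  finally have mH: "integral {0..L} (\<lambda>y. q y - 1) = 0" .
  obtain H CH where H: "\<And>x. (H has_real_derivative q x - 1) (at x)" "\<And>x. \<bar>H x\<bar> \<le> CH"
  proof (rule periodic_antiderivative_bounded[OF _ L _ mH])
    show "continuous_on UNIV (\<lambda>y. q y - 1)"
      by (intro continuous_on_diff continuous_on_const qc)
  qed (auto simp: q_def per)
  \<comment> \<open>The product of \<open>q\<close> with the weight
    \<open>exp (- p y / \<sigma>)\<close> is the constant \<open>\<kappa>0\<close>. The weighted
    mean of \<open>q\<close> is thus \<open>\<kappa>0 * L / Z\<close>, and this is
    \<open>Kh\<close>.\<close>
  have qe: "(q y - Kh) * exp (- p y / \<sigma>) = \<kappa>0 - Kh * exp (- p y / \<sigma>)" for y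
    by (simp add: q_def left_diff_distrib flip: exp_add)
  have "integral {0..L} (\<lambda>y. \<kappa>0 - Kh * exp (- p y / \<sigma>)) = integral {0..L} (\<lambda>y. \<kappa>0) - integral {0..L} (\<lambda>y. Kh * exp (- p y / \<sigma>))"
    by (rule Henstock_Kurzweil_Integration.integral_diff) (intro integrable_continuous_real continuous_on_mult continuous_on_const e1)+
  also have "integral {0..L} (\<lambda>y. Kh * exp (- p y / \<sigma>)) = Kh * Z"
    unfolding Z_def by (rule integral_mult_right)
  also have "integral {0..L} (\<lambda>y. \<kappa>0) - Kh * Z = 0"
    using L Z by (simp add: \<kappa>0_def Kh_def power2_eq_square)
  finally have mG: "integral {0..L} (\<lambda>y. (q y - Kh) * exp (- p y / \<sigma>)) = 0" unfolding qe .
  obtain G CG where G: "\<And>x. (G has_real_derivative (q x - Kh) * exp (- p x / \<sigma>)) (at x)" "\<And>x. \<bar>G x\<bar> \<le> CG"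
  proof (rule periodic_antiderivative_bounded[OF _ L _ mG])
    show "continuous_on UNIV (\<lambda>y. (q y - Kh) * exp (- p y / \<sigma>))"
      by (intro continuous_on_mult continuous_on_diff continuous_on_const qc e1)
  qed (auto simp: q_def per)
  have "cell_problem \<alpha> \<sigma> a d Kv (max P1 P2) \<kappa>0 (\<kappa>0 * exp (- P0 / \<sigma>)) (\<kappa>0 * exp (P0 / \<sigma>)) CH CG Kh dV p dp ddp q H G"
  proof
    fix y
    show "\<bar>dp y\<bar> \<le> max P1 P2" "\<bar>ddp y\<bar> \<le> max P1 P2" using P1(2)[of y] P2(2)[of y] by auto
    have "- P0 / \<sigma> \<le> p y / \<sigma>" "p y / \<sigma> \<le> P0 / \<sigma>"
    proof -
      have "- P0 \<le> p y" "p y \<le> P0" using P0(2)[of y] by (simp_all add: abs_le_iff)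
      then show "- P0 / \<sigma> \<le> p y / \<sigma>" "p y / \<sigma> \<le> P0 / \<sigma>" using assms(2) by (intro divide_right_mono; simp)+
    qed
    then show "\<kappa>0 * exp (- P0 / \<sigma>) \<le> q y" "q y \<le> \<kappa>0 * exp (P0 / \<sigma>)" using k0 by (auto simp: q_def)
  qed (use assms(1,2,4-8) dp ddp k0 H G in \<open>auto simp: q_def\<close>)
  then show ?thesis unfolding Kh_def by (rule that)
qed

text \<open>Boundedness without a named constant lets introduction rules handle the long third
  derivatives of the test functions, whose actual size is irrelevant for the limit of vanishing
  mesh.\<close>

definition bfun :: "(real \<Rightarrow> real) \<Rightarrow> bool" where
  "bfun f \<longleftrightarrow> (\<exists>C. \<forall>x. \<bar>f x\<bar> \<le> C)"

lemma bfunI: "(\<And>x. \<bar>f x\<bar> \<le> C) \<Longrightarrow> bfun f"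
  by (auto simp: bfun_def)

lemma bfun_const: "bfun (\<lambda>_. a)"
  by (rule bfunI[of _ "\<bar>a\<bar>"]) simp

lemma bfun_add: "bfun f \<Longrightarrow> bfun g \<Longrightarrow> bfun (\<lambda>x. f x + g x)"
  unfolding bfun_def by (metis abs_triangle_ineq add_mono order_trans)

lemma bfun_mult: "bfun f \<Longrightarrow> bfun g \<Longrightarrow> bfun (\<lambda>x. f x * g x)"
proof -
  assume "bfun f" "bfun g"
  then obtain C D where C: "\<And>x. \<bar>f x\<bar> \<le> C" "\<And>x. \<bar>g x\<bar> \<le> D" by (auto simp: bfun_def)
  show ?thesis
  proof (rule bfunI)
    fix x
    have "0 \<le> C" using C(1)[of x] by simp
    then show "\<bar>f x * g x\<bar> \<le> C * D" unfolding abs_mult using C by (intro mult_mono) auto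
  qed
qed

lemma bfun_diff: "bfun f \<Longrightarrow> bfun g \<Longrightarrow> bfun (\<lambda>x. f x - g x)"
  using bfun_add[of f "\<lambda>x. -1 * g x"] bfun_mult[OF bfun_const, of g "-1"] by simp

lemma bfun_power: "bfun f \<Longrightarrow> bfun (\<lambda>x. f x ^ n)"
  by (induction n) (auto intro: bfun_const bfun_mult)

lemma bfun_tanh: "bfun (\<lambda>x. tanh (h x))"
  by (rule bfunI[of _ 1]) (simp add: abs_le_iff less_imp_le tanh_real_lt_1 minus_le_iff less_imp_le[OF tanh_real_gt_neg1])

lemmas bfun_intros = bfun_const bfun_add bfun_mult bfun_diff bfun_power bfun_tanh

section \<open>Smooth truncation by the hyperbolic tangent\<close>

lemma tanh_deriv: "(tanh has_real_derivative 1 - tanh x ^ 2) (at (x :: real))"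
  by (auto intro!: derivative_eq_intros)

lemma abs_tanh_le: "\<bar>tanh x\<bar> \<le> \<bar>x :: real\<bar>"
proof -
  have "\<bar>tanh x - tanh 0\<bar> \<le> 1 * \<bar>x - 0 :: real\<bar>"
  proof (rule derivative_bound_Lipschitz[where f' = "\<lambda>x. 1 - tanh x ^ 2"])
    show "(tanh has_real_derivative 1 - tanh z ^ 2) (at z)" for z :: real by (rule tanh_deriv)
    show "\<bar>1 - tanh z ^ 2\<bar> \<le> 1" for z :: real
    proof -
      have "\<bar>tanh z\<bar> \<le> 1" by (simp add: abs_le_iff less_imp_le tanh_real_lt_1 minus_le_iff less_imp_le[OF tanh_real_gt_neg1])
      then have "tanh z ^ 2 \<le> 1" by (simp add: abs_square_le_1)
      then show ?thesis by (simp add: abs_le_iff)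
    qed
  qed
  then show ?thesis by simp
qed

lemma tanh_square_le_1: "tanh x ^ 2 \<le> (1 :: real)"
  using bfun_tanh by (simp add: abs_square_le_1 abs_le_iff less_imp_le tanh_real_lt_1 minus_le_iff less_imp_le[OF tanh_real_gt_neg1])

text \<open>A bounded smooth substitute for the identity: it keeps the sign, never exceeds
  \<open>\<bar>y\<bar>\<close>, and has slope in \<open>{0..1}\<close>. Smoothness is what admits it
  into test functions.\<close>

definition trunc :: "real \<Rightarrow> real \<Rightarrow> real" where
  "trunc R y = R * tanh (y / R)"

lemma trunc_props:
  assumes "0 < R"
  shows "\<bar>trunc R y\<bar> \<le> \<bar>y\<bar>" "0 \<le> y * trunc R y" "(trunc R has_real_derivative 1 - tanh (y / R) ^ 2) (at y)"
proof -
  show "\<bar>trunc R y\<bar> \<le> \<bar>y\<bar>"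
    using abs_tanh_le[of "y / R"] assms by (simp add: trunc_def abs_mult field_simps)
  show "0 \<le> y * trunc R y"
    using assms by (cases "0 \<le> y") (auto simp: trunc_def zero_le_mult_iff mult_le_0_iff divide_nonpos_pos)
  show "(trunc R has_real_derivative 1 - tanh (y / R) ^ 2) (at y)"
    unfolding trunc_def[abs_def] using assms by (auto intro!: derivative_eq_intros simp: field_simps)
qed

text \<open>For \<open>y\<close> other than 0 this is the difference quotient of \<open>tanh\<close>
  at 0, multiplied by \<open>y\<close>.\<close>

lemma trunc_tendsto: "(\<lambda>n. trunc (real (Suc n)) y) \<longlonglongrightarrow> y"
proof (cases "y = 0")
  case False
  have "((\<lambda>h. (tanh (0 + h) - tanh 0) / h) \<longlongrightarrow> 1) (at (0 :: real))"
    using tanh_deriv[of 0] by (simp add: DERIV_def)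
  moreover have "filterlim (\<lambda>n. y / real (Suc n)) (at 0) sequentially"
    unfolding filterlim_at using False LIMSEQ_Suc[OF lim_const_over_n[of y]] by auto
  ultimately have "(\<lambda>n. (tanh (0 + y / real (Suc n)) - tanh 0) / (y / real (Suc n))) \<longlonglongrightarrow> 1"
    by (rule filterlim_compose)
  from tendsto_mult[OF this tendsto_const[of y]]
  have "(\<lambda>n. (tanh (0 + y / real (Suc n)) - tanh 0) / (y / real (Suc n)) * y) \<longlonglongrightarrow> y" by simp
  moreover have "(tanh (0 + y / real (Suc n)) - tanh 0) / (y / real (Suc n)) * y = trunc (real (Suc n)) y" for n
    using False by (simp add: trunc_def del: of_nat_Suc)
  ultimately show ?thesis by simp
qed (simp add: trunc_def)

context cell_problem
begin

lemma cell_constants: "0 < S1" "0 \<le> CH" "0 \<le> CG" "0 < q y" "0 \<le> P"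
proof -
  show "0 < q y" using s0(1) s0(2)[of y] by linarith
  then show "0 < S1" using S1[of y] by linarith
  show "0 \<le> CH" "0 \<le> CG" "0 \<le> P" using H_bound[of 0] G_bound[of 0] dp_bound[of 0] by linarith+
qed

lemma q_deriv: "(q has_real_derivative q y * dp y / \<sigma>) (at y)"
  unfolding q_eq[abs_def] using sigma by (auto intro!: derivative_eq_intros p_deriv)

lemma q_bfun: "bfun (\<lambda>x. q (h x))" and dp_bfun: "bfun (\<lambda>x. dp (h x))" and ddp_bfun: "bfun (\<lambda>x. ddp (h x))"
proof -
  have "\<bar>q y\<bar> \<le> S1" for y using S1[of y] cell_constants(4)[of y] by simp
  then show "bfun (\<lambda>x. q (h x))" by (rule bfunI)
  show "bfun (\<lambda>x. dp (h x))" "bfun (\<lambda>x. ddp (h x))" by (rule bfunI, rule dp_bound ddp_bound)+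
qed

section \<open>The singular drift and the corrected coordinate\<close>

definition drift :: "real \<Rightarrow> real \<Rightarrow> real" where
  "drift \<epsilon> x = - \<alpha> * dV x - (1 / \<epsilon>) * dp (x / \<epsilon>)"

definition coord :: "real \<Rightarrow> real \<Rightarrow> real" where
  "coord \<epsilon> x = x + \<epsilon> * H (x / \<epsilon>)"

lemma comp_scale_deriv:
  assumes "\<And>x. (f has_real_derivative f' x) (at x)" "0 < \<epsilon>"
  shows "((\<lambda>x. f (x / \<epsilon>)) has_real_derivative f' (x / \<epsilon>) / \<epsilon>) (at x)"
proof -
  have "((\<lambda>x. x / \<epsilon>) has_real_derivative 1 / \<epsilon>) (at x)" by (rule DERIV_cdivide) simp
  from DERIV_chain2[OF assms(1) this] show ?thesis by simp
qed

lemma coord_deriv: "0 < \<epsilon> \<Longrightarrow> (coord \<epsilon> has_real_derivative q (x / \<epsilon>)) (at x)"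
  unfolding coord_def[abs_def]
  by (rule derivative_eq_intros comp_scale_deriv[OF H_deriv] | simp)+

text \<open>Test functions are specified by \<open>g\<close>, where
  \<open>f' = q (x / \<epsilon>) * g\<close>. The witness for the three derivative bounds depends on
  \<epsilon>, which is harmless, since only the bound on \<open>f'\<close> survives in the
  martingale estimates.\<close>

lemma test_fn_conjugate:
  assumes \<epsilon>: "0 < \<epsilon>"
    and f: "\<And>x. (f has_real_derivative q (x / \<epsilon>) * g x) (at x)"
    and g: "\<And>x. (g has_real_derivative g1 x) (at x)" "\<And>x. (g1 has_real_derivative g2 x) (at x)"
    and bf: "bfun g" "bfun g1" "bfun g2"
  shows "test_fn f (\<lambda>x. q (x / \<epsilon>) * g x) (\<lambda>x. q (x / \<epsilon>) * (dp (x / \<epsilon>) / (\<sigma> * \<epsilon>) * g x + g1 x))"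
proof -
  note dq = comp_scale_deriv[OF q_deriv \<epsilon>] and ddp = comp_scale_deriv[OF dp_deriv \<epsilon>]
  let ?f1 = "\<lambda>x. q (x / \<epsilon>) * g x" and ?f2 = "\<lambda>x. q (x / \<epsilon>) * (dp (x / \<epsilon>) / (\<sigma> * \<epsilon>) * g x + g1 x)"
  let ?f3 = "\<lambda>x. q (x / \<epsilon>) * (1 / (\<sigma> * \<epsilon>)) * dp (x / \<epsilon>) * (dp (x / \<epsilon>) * (1 / (\<sigma> * \<epsilon>)) * g x + g1 x)
    + q (x / \<epsilon>) * (ddp (x / \<epsilon>) * (1 / (\<sigma> * \<epsilon>\<^sup>2)) * g x + dp (x / \<epsilon>) * (1 / (\<sigma> * \<epsilon>)) * g1 x + g2 x)"
  have "bfun ?f1" "bfun ?f3" by (intro bfun_intros bf q_bfun dp_bfun ddp_bfun)+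
  moreover have "bfun (\<lambda>x. q (x / \<epsilon>) * (dp (x / \<epsilon>) * (1 / (\<sigma> * \<epsilon>)) * g x + g1 x))"
    by (intro bfun_intros bf q_bfun dp_bfun ddp_bfun)
  then have "bfun ?f2" by simp
  ultimately obtain B1 B2 B3 where B: "\<And>x. \<bar>?f1 x\<bar> \<le> B1" "\<And>x. \<bar>?f2 x\<bar> \<le> B2" "\<And>x. \<bar>?f3 x\<bar> \<le> B3"
    unfolding bfun_def by blast
  have d1: "(?f1 has_real_derivative ?f2 x) (at x)" for x
    by (rule DERIV_cong[OF DERIV_mult[OF dq g(1)]]) (use \<epsilon> sigma in \<open>simp add: field_simps\<close>)
  have d2: "(?f2 has_real_derivative ?f3 x) (at x)" for x
    by (rule DERIV_cong[OF DERIV_mult[OF dq DERIV_add[OF DERIV_mult[OF DERIV_cdivide[OF ddp] g(1)] g(2)]]])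
      (use \<epsilon> sigma in \<open>simp add: field_simps power2_eq_square\<close>)
  show ?thesis unfolding test_fn_def
  proof (intro exI[of _ ?f3] exI[of _ "max 1 (max B1 (max B2 B3))"] conjI allI)
    fix x
    show "\<bar>?f1 x\<bar> \<le> max 1 (max B1 (max B2 B3))" using B(1)[of x] by linarith
    show "\<bar>?f2 x\<bar> \<le> max 1 (max B1 (max B2 B3))" using B(2)[of x] by linarith
    show "\<bar>?f3 x\<bar> \<le> max 1 (max B1 (max B2 B3))" using B(3)[of x] by linarith
  qed (use f d1 d2 in auto)
qed

definition v0 :: real where "v0 = \<bar>dV 0\<bar> + Kv * CH"

text \<open>The price of stating dissipativity in \<open>coord \<epsilon> x\<close> in place of
  \<open>x\<close>. The four terms are the original constant, the two parts of \<open>dV x\<close>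
  times the shift after Young's inequality, and the square of the shift.\<close>

definition e1 :: real where
  "e1 = a + \<bar>dV 0\<bar> * CH + (Kv * CH)\<^sup>2 / (2 * d) + d / 2 * CH\<^sup>2"

text \<open>\<open>A2\<close> and \<open>A4\<close> are the first two values of the moment recursion
  for the corrected coordinate, with exponents 0 and 2 as input. They do not contain
  \<epsilon>.\<close>

definition A2 :: real where "A2 = 4 * (\<sigma> * S1\<^sup>2 + \<alpha> * S1 * e1) / (\<alpha> * s0 * d)"
definition A4 :: real where "A4 = 4 * (3 * \<sigma> * S1\<^sup>2 + \<alpha> * S1 * e1) / (\<alpha> * s0 * d) * A2"

lemma e1_nonneg: "0 \<le> e1" using a d cell_constants by (simp add: e1_def)

lemma coord_dist: assumes "0 < \<epsilon>" "\<epsilon> \<le> 1" shows "\<bar>coord \<epsilon> x - x\<bar> \<le> \<epsilon> * CH" "\<bar>coord \<epsilon> x - x\<bar> \<le> CH"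
proof -
  show le: "\<bar>coord \<epsilon> x - x\<bar> \<le> \<epsilon> * CH"
    unfolding coord_def using assms H_bound[of "x / \<epsilon>"] by (simp add: abs_mult)
  have "\<epsilon> * CH \<le> 1 * CH" using assms cell_constants(2) by (intro mult_right_mono) auto
  then show "\<bar>coord \<epsilon> x - x\<bar> \<le> CH" using le by simp
qed

lemma dV_bound: "\<bar>dV x\<bar> \<le> \<bar>dV 0\<bar> + Kv * \<bar>x\<bar>"
  using dV_Lipschitz[of x 0] by simp

text \<open>The coordinate differs from \<open>x\<close> by at most \<open>CH\<close>. Young's
  inequality spends half of \<open>d * x^2\<close> on \<open>dV x\<close> times this shift; the
  rest, \<open>d / 2 * x^2\<close>, dominates \<open>d / 4\<close> times the squared coordinate up
  to a constant.\<close>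

lemma dV_coord:
  assumes "0 < \<epsilon>" "\<epsilon> \<le> 1"
  shows "d / 4 * (coord \<epsilon> x)\<^sup>2 - e1 \<le> dV x * coord \<epsilon> x" "\<bar>dV x\<bar> \<le> v0 + Kv * \<bar>coord \<epsilon> x\<bar>"
proof -
  define r where "r = coord \<epsilon> x - x"
  have r: "\<bar>r\<bar> \<le> CH" using coord_dist(2)[OF assms] by (simp add: r_def)
  have S: "coord \<epsilon> x = x + r" by (simp add: r_def)
  have "\<bar>dV x * r\<bar> \<le> (\<bar>dV 0\<bar> + Kv * \<bar>x\<bar>) * CH"
    unfolding abs_mult using dV_bound[of x] r by (intro mult_mono) auto
  also have "\<dots> = \<bar>dV 0\<bar> * CH + \<bar>x\<bar> * (Kv * CH)" by (simp add: algebra_simps)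
  also have "\<bar>x\<bar> * (Kv * CH) \<le> d / 2 * x\<^sup>2 + (Kv * CH)\<^sup>2 / (2 * d)"
    using abs_mult_le_weighted_squares[OF d, of "\<bar>x\<bar>" "Kv * CH"] Kv cell_constants(2) by (simp add: abs_mult field_simps)
  finally have 1: "\<bar>dV x * r\<bar> \<le> \<bar>dV 0\<bar> * CH + (d / 2 * x\<^sup>2 + (Kv * CH)\<^sup>2 / (2 * d))" by simp
  have "r\<^sup>2 \<le> CH\<^sup>2" using r cell_constants(2) by (metis abs_le_square_iff abs_of_nonneg)
  moreover have "(x + r)\<^sup>2 \<le> 2 * x\<^sup>2 + 2 * r\<^sup>2" using zero_le_power2[of "x - r"] by (simp add: power2_diff power2_sum)
  ultimately have "(x + r)\<^sup>2 \<le> 2 * x\<^sup>2 + 2 * CH\<^sup>2" by simp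
  from mult_left_mono[OF this, of "d / 4"] have 2: "d / 4 * (x + r)\<^sup>2 \<le> d / 2 * x\<^sup>2 + d / 2 * CH\<^sup>2"
    using d by (simp add: algebra_simps)
  have 3: "d * x\<^sup>2 - a \<le> dV x * x" by (rule dissipative)
  have arith: "dS - (a + c1 + c2 + c3) \<le> vx + vr"
    if "\<bar>vr\<bar> \<le> c1 + (w + c2)" "dS \<le> w + c3" "2 * w - a \<le> vx" for dS c1 c2 c3 vx vr w :: real
    using that by (simp add: abs_le_iff)
  show "d / 4 * (coord \<epsilon> x)\<^sup>2 - e1 \<le> dV x * coord \<epsilon> x"
    unfolding S e1_def distrib_left by (rule arith[OF 1 2]) (use 3 in simp)
  have "Kv * \<bar>x\<bar> \<le> Kv * (\<bar>coord \<epsilon> x\<bar> + CH)" using r Kv by (intro mult_left_mono) (auto simp: S)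
  then show "\<bar>dV x\<bar> \<le> v0 + Kv * \<bar>coord \<epsilon> x\<bar>"
    using dV_bound[of x] by (simp add: v0_def algebra_simps)
qed

lemma drift_Lipschitz:
  assumes "0 < \<epsilon>" shows "\<bar>drift \<epsilon> x - drift \<epsilon> y\<bar> \<le> (\<alpha> * Kv + P / \<epsilon>\<^sup>2) * \<bar>x - y\<bar>"
proof -
  have "\<bar>dp (x / \<epsilon>) - dp (y / \<epsilon>)\<bar> \<le> P * \<bar>x / \<epsilon> - y / \<epsilon>\<bar>"
    by (rule derivative_bound_Lipschitz[OF dp_deriv ddp_bound])
  then have 1: "\<bar>(1 / \<epsilon>) * (dp (x / \<epsilon>) - dp (y / \<epsilon>))\<bar> \<le> P / \<epsilon>\<^sup>2 * \<bar>x - y\<bar>"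
    using assms by (simp add: abs_mult field_simps power2_eq_square flip: diff_divide_distrib)
  have 2: "\<bar>\<alpha> * (dV x - dV y)\<bar> \<le> \<alpha> * Kv * \<bar>x - y\<bar>"
    using dV_Lipschitz[of x y] alpha by (simp add: abs_mult mult.assoc)
  have "drift \<epsilon> x - drift \<epsilon> y = - (\<alpha> * (dV x - dV y)) - (1 / \<epsilon>) * (dp (x / \<epsilon>) - dp (y / \<epsilon>))"
    by (simp add: drift_def algebra_simps)
  then have "\<bar>drift \<epsilon> x - drift \<epsilon> y\<bar> \<le> \<bar>\<alpha> * (dV x - dV y)\<bar> + \<bar>(1 / \<epsilon>) * (dp (x / \<epsilon>) - dp (y / \<epsilon>))\<bar>"
    by (simp only: abs_le_iff) linarith
  then show ?thesis unfolding distrib_right by (rule order_trans[OF _ add_mono[OF 2 1]])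
qed

text \<open>Here \<open>A\<close> blows up as \<epsilon> tends to 0, because the singular drift is
  estimated by \<open>P / \<epsilon>\<close>. This suffices for finiteness of the second moment at
  fixed \<epsilon>; uniform moments come from the corrected coordinate.\<close>

lemma drift_dissipative:
  assumes "0 < \<epsilon>"
  obtains A where "\<And>x. drift \<epsilon> x * x \<le> A - \<alpha> * d / 2 * x\<^sup>2"
proof -
  define A where "A = \<alpha> * a + (P / \<epsilon>)\<^sup>2 / (2 * (\<alpha> * d))"
  have "drift \<epsilon> x * x \<le> A - \<alpha> * d / 2 * x\<^sup>2" for x
  proof -
    have ad: "0 < \<alpha> * d" using alpha d by simp
    have "\<bar>x * (dp (x / \<epsilon>) / \<epsilon>)\<bar> \<le> \<bar>x * (P / \<epsilon>)\<bar>"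
      unfolding abs_mult using assms dp_bound[of "x / \<epsilon>"] cell_constants(5)
      by (intro mult_left_mono) (auto simp: divide_right_mono)
    also have "\<dots> \<le> (\<alpha> * d * x\<^sup>2 + (P / \<epsilon>)\<^sup>2 / (\<alpha> * d)) / 2"
      by (rule abs_mult_le_weighted_squares[OF ad])
    also have "\<dots> = \<alpha> * d / 2 * x\<^sup>2 + (P / \<epsilon>)\<^sup>2 / (2 * (\<alpha> * d))" by (simp add: add_divide_distrib mult.commute)
    finally have 1: "- (x * (dp (x / \<epsilon>) / \<epsilon>)) \<le> \<alpha> * d / 2 * x\<^sup>2 + (P / \<epsilon>)\<^sup>2 / (2 * (\<alpha> * d))"
      by (rule abs_le_D2)
    have 2: "\<alpha> * (d * x\<^sup>2 - a) \<le> \<alpha> * (dV x * x)" using dissipative[of x] alpha by (intro mult_left_mono) auto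
    have "drift \<epsilon> x * x = - (\<alpha> * (dV x * x)) + - (x * (dp (x / \<epsilon>) / \<epsilon>))" by (simp add: drift_def algebra_simps)
    then show ?thesis using 1 2 unfolding A_def by (simp add: algebra_simps)
  qed
  then show ?thesis using that by blast
qed

end

section \<open>Uniform moments in the multiscale equation\<close>

context cell_problem
begin

text \<open>Square roots of moment bounds that do not contain \<epsilon>: for \<open>V'\<close> and
  its square under the stationary law, and for the state itself (\<open>X2\<close>). The added 1
  keeps them positive for Cauchy-Schwarz.\<close>

definition V2 :: real where "V2 = sqrt (2 * v0\<^sup>2 + 2 * Kv\<^sup>2 * A2 + 1)"
definition V4 :: real where "V4 = sqrt (8 * v0 ^ 4 + 8 * Kv ^ 4 * A4 + 1)"
definition X2 :: real where "X2 = sqrt (2 * A2 + 2 * CH\<^sup>2 + 1)"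

lemma A_nonneg: "0 \<le> A2" "0 \<le> A4"
  using alpha sigma d s0(1) cell_constants(1) e1_nonneg by (simp_all add: A2_def A4_def)

lemma V_pos: "0 < V2" "0 < V4" "0 < X2"
  using A_nonneg by (simp_all add: V2_def V4_def X2_def add_nonneg_pos)

end

locale multiscale_sde =
  cell_problem \<alpha> \<sigma> a d Kv P \<kappa>0 s0 S1 CH CG Kh dV p dp ddp q H G +
  square_integrable_sde M F X B "cell_problem.drift \<alpha> dV dp \<epsilon>" "sqrt (2 * \<sigma>)" "\<alpha> * Kv + P / \<epsilon>\<^sup>2"
  for \<alpha> \<sigma> a d Kv P \<kappa>0 s0 S1 CH CG Kh dV p dp ddp q H G \<epsilon> and M :: "'a measure" and F X B +
  assumes eps: "0 < \<epsilon>" "\<epsilon> \<le> 1"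
begin

abbreviation cc :: real where "cc \<equiv> sqrt (2 * \<sigma>)"

abbreviation "fd1 g \<equiv> (\<lambda>x. q (x / \<epsilon>) * g x)"
abbreviation "fd2 g g1 \<equiv> (\<lambda>x. q (x / \<epsilon>) * (dp (x / \<epsilon>) / (\<sigma> * \<epsilon>) * g x + g1 x))"
abbreviation "S \<equiv> coord \<epsilon>"

text \<open>Since \<open>q' = q * dp / \<sigma>\<close>, the second-order part contains
  \<open>(1 / \<epsilon>) * dp * q * g\<close>, exactly the opposite of what the singular drift
  contributes.\<close>

lemma gen_conjugate: "gen (fd1 g) (fd2 g g1) x = q (x / \<epsilon>) * (\<sigma> * g1 x - \<alpha> * dV x * g x)"
  using sigma eps unfolding gen_def drift_def by (simp add: field_simps)

lemma conjugate_antiderivative: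
  assumes "\<And>x. (g has_real_derivative g1 x) (at x)"
  obtains f where "\<And>x. (f has_real_derivative q (x / \<epsilon>) * g x) (at x)"
proof -
  have "continuous_on UNIV (\<lambda>x. q (x / \<epsilon>) * g x)"
    using comp_scale_deriv[OF q_deriv eps(1)] assms
    by (intro continuous_on_mult) (auto intro!: DERIV_isCont continuous_at_imp_continuous_on)
  then show ?thesis using antiderivative_exists that by blast
qed

lemma S_measurable [measurable]: "S \<in> borel_measurable borel"
proof -
  have "continuous_on UNIV S"
    using coord_deriv[OF eps(1)] by (auto intro!: DERIV_isCont continuous_at_imp_continuous_on)
  then show ?thesis by (rule borel_measurable_continuous_onI)
qed

lemma dV_continuous: "continuous_on UNIV dV" and dV_measurable [measurable]: "dV \<in> borel_measurable borel"
proof -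
  show "continuous_on UNIV dV" by (rule Lipschitz_imp_continuous[OF dV_Lipschitz less_imp_le[OF Kv]])
  then show "dV \<in> borel_measurable borel" by (rule borel_measurable_continuous_onI)
qed

lemma q_scale_continuous: "continuous_on UNIV (\<lambda>x. q (x / \<epsilon>))"
  using comp_scale_deriv[OF q_deriv eps(1)] by (auto intro!: DERIV_isCont continuous_at_imp_continuous_on)

text \<open>As \<open>S' = q (x / \<epsilon>)\<close>, the function \<open>f\<close> is a truncated
  version of \<open>S ^ (m + 2) / (m + 2)\<close>. The truncation acts on \<open>g\<close>, that is
  on the derivative, which must be bounded.\<close>

lemma trunc_test_fn:
  fixes m :: nat
  assumes R: "0 < R"
  defines "g \<equiv> \<lambda>x. trunc R (S x) ^ Suc m"
    and "g1 \<equiv> \<lambda>x. real (Suc m) * trunc R (S x) ^ m * (1 - tanh (S x / R) ^ 2) * q (x / \<epsilon>)"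
  obtains f where "test_fn f (fd1 g) (fd2 g g1)"
proof -
  define t where "t x = tanh (S x / R)" for x
  define T where "T x = trunc R (S x)" for x
  have dt: "(t has_real_derivative (1 - t x ^ 2) * (q (x / \<epsilon>) / R)) (at x)" for x
    unfolding t_def[abs_def] by (rule DERIV_chain2[OF tanh_deriv DERIV_cdivide[OF coord_deriv[OF eps(1)]]])
  have dT: "(T has_real_derivative (1 - t x ^ 2) * q (x / \<epsilon>)) (at x)" for x
    unfolding T_def[abs_def] t_def by (rule DERIV_chain2[OF trunc_props(3)[OF R] coord_deriv[OF eps(1)]])
  define dq where "dq x = q (x / \<epsilon>) * dp (x / \<epsilon>) / \<sigma> / \<epsilon>" for x
  have dq: "((\<lambda>x. q (x / \<epsilon>)) has_real_derivative dq x) (at x)" for x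
    unfolding dq_def by (rule comp_scale_deriv[OF q_deriv eps(1)])
  define g2 where "g2 x = real (Suc m) * ((real m * T x ^ (m - 1) * ((1 - t x ^ 2) * q (x / \<epsilon>))) * ((1 - t x ^ 2) * q (x / \<epsilon>))
     + T x ^ m * ((0 - 2 * t x * ((1 - t x ^ 2) * (q (x / \<epsilon>) * (1 / R)))) * q (x / \<epsilon>)
     + (1 - t x ^ 2) * (q (x / \<epsilon>) * dp (x / \<epsilon>) * (1 / \<sigma>) * (1 / \<epsilon>))))" for x
  have Tb: "bfun T" "bfun t" unfolding T_def trunc_def t_def by (intro bfun_intros)+
  have g: "g = (\<lambda>x. T x ^ Suc m)" "g1 = (\<lambda>x. real (Suc m) * T x ^ m * (1 - t x ^ 2) * q (x / \<epsilon>))"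
    by (simp_all add: g_def g1_def T_def t_def)
  have b: "bfun g" "bfun g1" "bfun g2"
    unfolding g g2_def by (intro bfun_intros Tb q_bfun dp_bfun)+
  have d1: "(g has_real_derivative g1 x) (at x)" for x
    unfolding g by (rule DERIV_cong[OF DERIV_power[OF dT]]) (simp add: algebra_simps)
  have d2: "(g1 has_real_derivative g2 x) (at x)" for x
  proof -
    have "((\<lambda>x. real (Suc m) * (T x ^ m * ((1 - t x ^ 2) * q (x / \<epsilon>)))) has_real_derivative g2 x) (at x)"
      by (rule DERIV_cong[OF DERIV_cmult[OF DERIV_mult[OF DERIV_power[OF dT] DERIV_mult[OF DERIV_diff[OF DERIV_const DERIV_power[OF dt]] dq]]]])
        (simp add: g2_def dq_def algebra_simps power2_eq_square)
    then show ?thesis unfolding g by (simp only: mult.assoc)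
  qed
  obtain f where f: "\<And>x. (f has_real_derivative q (x / \<epsilon>) * g x) (at x)" using conjugate_antiderivative[OF d1] by blast
  show ?thesis by (rule that[OF test_fn_conjugate[OF eps(1) f d1 d2 b]])
qed

text \<open>The generator of the truncated power has mean zero under the stationary law. Its
  dissipative part controls \<open>S * trunc R S ^ (m + 1)\<close>, while what remains is at most a
  constant times \<open>S ^ m\<close>. Letting \<open>R\<close> tend to infinity raises the exponent
  of the moment by 2, with constants free of \<epsilon>.\<close>

lemma moment_step:
  assumes m: "even m" and A: "L1_bound M (\<lambda>\<omega>. S (X 0 \<omega>) ^ m) A"
  shows "L1_bound M (\<lambda>\<omega>. S (X 0 \<omega>) ^ (m + 2))
    (4 * (real (Suc m) * \<sigma> * S1\<^sup>2 + \<alpha> * S1 * e1) / (\<alpha> * s0 * d) * A)"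
proof (rule L1_bound_Fatou)
  define k where "k = \<alpha> * s0 * (d / 4)"
  define C where "C = real (Suc m) * \<sigma> * S1\<^sup>2 + \<alpha> * S1 * e1"
  have k: "0 < k" using alpha s0(1) d by (simp add: k_def)
  have X0 [measurable]: "X 0 \<in> borel_measurable M" by (rule X_measurable) simp
  show "L1_bound M (\<lambda>\<omega>. S (X 0 \<omega>) * trunc (real (Suc n)) (S (X 0 \<omega>)) ^ Suc m)
    (4 * (real (Suc m) * \<sigma> * S1\<^sup>2 + \<alpha> * S1 * e1) / (\<alpha> * s0 * d) * A)" for n
  proof -
    define R where "R = real (Suc n)"
    have R: "0 < R" by (simp add: R_def)
    define g where "g x = trunc R (S x) ^ Suc m" for x
    define g1 where "g1 x = real (Suc m) * trunc R (S x) ^ m * (1 - tanh (S x / R) ^ 2) * q (x / \<epsilon>)" for x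
    obtain f where f: "test_fn f (fd1 g) (fd2 g g1)"
      using trunc_test_fn[OF R, of m] unfolding g_def[symmetric] g1_def[symmetric] by blast
    note gs = generator_stationary[OF f]
    \<comment> \<open>The lower bound \<open>s0\<close> of \<open>q\<close> is used for the
      dissipative term and the upper bound \<open>S1\<close> for the others; evenness of
      \<open>m\<close> gives all powers a sign.\<close>
    have pt: "k * (S x * g x) \<le> - gen (fd1 g) (fd2 g g1) x + C * S x ^ m" for x
    proof -
      define T where "T = trunc R (S x)"
      define Q where "Q = q (x / \<epsilon>)"
      define w where "w = 1 - tanh (S x / R) ^ 2"
      have Q: "0 < Q" "s0 \<le> Q" "Q \<le> S1" using cell_constants(4) s0(2) S1 by (auto simp: Q_def)
      have w: "0 \<le> w" "w \<le> 1" using tanh_square_le_1[of "S x / R"] by (auto simp: w_def)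
      have T: "\<bar>T\<bar> \<le> \<bar>S x\<bar>" "0 \<le> S x * T" using trunc_props[OF R] by (auto simp: T_def)
      have Tm: "0 \<le> T ^ m" "T ^ m \<le> S x ^ m"
        using m power_mono[OF T(1), of m] by (auto simp: zero_le_even_power power_even_abs)
      have vT: "d / 4 * (S x * T) - e1 \<le> dV x * T"
      proof (cases "S x = 0")
        case True then show ?thesis using T(1) e1_nonneg by simp
      next
        case False
        \<comment> \<open>Dissipativity is available for the factor \<open>S x\<close>, but the
          generator contains the truncated \<open>T\<close>. It is a fraction of \<open>S x\<close>
          between 0 and 1, so the inequality can be scaled while \<open>e1\<close> only
          decreases.\<close>
        define \<rho> where "\<rho> = T / S x"
        have \<rho>: "0 \<le> \<rho>" "\<rho> \<le> 1" "T = \<rho> * S x"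
        proof -
          show "T = \<rho> * S x" using False by (simp add: \<rho>_def)
          have "\<rho> = S x * T / (S x)\<^sup>2" using False by (simp add: \<rho>_def power2_eq_square)
          then show "0 \<le> \<rho>" using T(2) by simp
          have "\<bar>\<rho>\<bar> \<le> 1" using T(1) False by (simp add: \<rho>_def)
          then show "\<rho> \<le> 1" by simp
        qed
        have "\<rho> * (d / 4 * (S x)\<^sup>2 - e1) \<le> \<rho> * (dV x * S x)"
          using dV_coord(1)[OF eps, of x] \<rho>(1) by (rule mult_left_mono)
        moreover have "\<rho> * e1 \<le> 1 * e1" using \<rho> e1_nonneg by (intro mult_right_mono)
        ultimately show ?thesis unfolding \<rho>(3) by (simp add: algebra_simps power2_eq_square)
      qed
      have 1: "\<alpha> * Q * T ^ m * (d / 4 * (S x * T)) \<le> \<alpha> * Q * T ^ m * (dV x * T + e1)"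
        by (rule mult_left_mono) (use vT alpha Q Tm in auto)
      have 2: "k * (S x * g x) \<le> \<alpha> * Q * T ^ m * (d / 4 * (S x * T))"
      proof -
        have "s0 * (\<alpha> * (d / 4) * (T ^ m * (S x * T))) \<le> Q * (\<alpha> * (d / 4) * (T ^ m * (S x * T)))"
          by (rule mult_right_mono[OF Q(2)]) (use alpha d Tm T in auto)
        then show ?thesis by (simp add: k_def g_def T_def[symmetric] mult_ac)
      qed
      have gen: "gen (fd1 g) (fd2 g g1) x = Q * (\<sigma> * (real (Suc m) * T ^ m * w * Q) - \<alpha> * dV x * (T * T ^ m))"
        unfolding gen_conjugate by (simp only: g_def g1_def T_def[symmetric] Q_def[symmetric] w_def[symmetric] power_Suc)
      have 3: "Q * (\<sigma> * (real (Suc m) * T ^ m * w * Q)) \<le> real (Suc m) * \<sigma> * S1\<^sup>2 * S x ^ m"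
      proof -
        have "(T ^ m * w) * (Q * Q) \<le> (S x ^ m * 1) * (S1 * S1)"
          by (intro mult_mono) (use Tm w Q cell_constants(1) m in \<open>auto simp: zero_le_even_power\<close>)
        from mult_left_mono[OF this, of "real (Suc m) * \<sigma>"] show ?thesis
          using sigma by (simp add: power2_eq_square mult_ac del: of_nat_Suc)
      qed
      have 4: "\<alpha> * Q * T ^ m * e1 \<le> \<alpha> * S1 * e1 * S x ^ m"
      proof -
        have "Q * T ^ m \<le> S1 * S x ^ m" by (intro mult_mono) (use Tm Q cell_constants(1) in auto)
        from mult_left_mono[OF this, of "\<alpha> * e1"] show ?thesis using alpha e1_nonneg by (simp add: mult_ac)
      qed
      have "\<alpha> * Q * T ^ m * (dV x * T + e1) = - gen (fd1 g) (fd2 g g1) x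
          + Q * (\<sigma> * (real (Suc m) * T ^ m * w * Q)) + \<alpha> * Q * T ^ m * e1"
        unfolding gen by (simp add: algebra_simps)
      then show ?thesis using 1 2 3 4 unfolding C_def distrib_right by simp
    qed
    have Sm: "integrable M (\<lambda>\<omega>. S (X 0 \<omega>) ^ m)" "(\<integral>\<omega>. S (X 0 \<omega>) ^ m \<partial>M) \<le> A"
    proof -
      have "(\<lambda>\<omega>. S (X 0 \<omega>) ^ m) \<in> borel_measurable M" by measurable
      from L1_bound_imp_integrable[OF A this] show "integrable M (\<lambda>\<omega>. S (X 0 \<omega>) ^ m)" "(\<integral>\<omega>. S (X 0 \<omega>) ^ m \<partial>M) \<le> A" by auto
    qed
    define W where "W \<omega> = - gen (fd1 g) (fd2 g g1) (X 0 \<omega>) + C * S (X 0 \<omega>) ^ m" for \<omega>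
    have Sg: "0 \<le> S x * g x" for x
      using trunc_props(2)[OF R, of "S x"] m unfolding g_def power_Suc mult.assoc[symmetric]
      by (simp add: zero_le_even_power)
    have W: "0 \<le> W \<omega>" for \<omega> using pt[of "X 0 \<omega>"] k mult_nonneg_nonneg[OF less_imp_le[OF k] Sg[of "X 0 \<omega>"]] by (simp add: W_def)
    have C0: "0 \<le> C" using sigma alpha cell_constants(1) e1_nonneg by (simp add: C_def)
    have "L1_bound M W (C * A)"
    proof (rule L1_bound_integrable)
      show int: "integrable M W" unfolding W_def using gs(1) Sm(1) by auto
      have "(\<integral>\<omega>. W \<omega> \<partial>M) = C * (\<integral>\<omega>. S (X 0 \<omega>) ^ m \<partial>M)"
        unfolding W_def using gs Sm(1) by simp
      also have "\<dots> \<le> C * A" using Sm(2) C0 by (rule mult_left_mono)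
      finally show "(\<integral>\<omega>. \<bar>W \<omega>\<bar> \<partial>M) \<le> C * A" using W by simp
    qed
    from L1_bound_cmult[OF this, of "1 / k"]
    have "L1_bound M (\<lambda>\<omega>. 1 / k * W \<omega>) (1 / k * (C * A))" using k by simp
    moreover have "1 / k * (C * A) = 4 * (real (Suc m) * \<sigma> * S1\<^sup>2 + \<alpha> * S1 * e1) / (\<alpha> * s0 * d) * A"
      by (simp add: k_def C_def)
    ultimately have L: "L1_bound M (\<lambda>\<omega>. 1 / k * W \<omega>) (4 * (real (Suc m) * \<sigma> * S1\<^sup>2 + \<alpha> * S1 * e1) / (\<alpha> * s0 * d) * A)"
      by simp
    show ?thesis
    proof (rule L1_bound_mono[OF L _ order_refl], rule AE_I2)
      fix \<omega>
      have "S (X 0 \<omega>) * g (X 0 \<omega>) \<le> 1 / k * W \<omega>"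
        using pt[of "X 0 \<omega>"] k by (simp add: W_def field_simps)
      then show "\<bar>S (X 0 \<omega>) * trunc (real (Suc n)) (S (X 0 \<omega>)) ^ Suc m\<bar> \<le> \<bar>1 / k * W \<omega>\<bar>"
        using Sg[of "X 0 \<omega>"] unfolding g_def R_def by (simp only: abs_of_nonneg)
    qed
  qed
  show "AE \<omega> in M. (\<lambda>n. S (X 0 \<omega>) * trunc (real (Suc n)) (S (X 0 \<omega>)) ^ Suc m) \<longlonglongrightarrow> S (X 0 \<omega>) ^ (m + 2)"
  proof (rule AE_I2)
    fix \<omega>
    have "(\<lambda>n. S (X 0 \<omega>) * trunc (real (Suc n)) (S (X 0 \<omega>)) ^ Suc m) \<longlonglongrightarrow> S (X 0 \<omega>) * S (X 0 \<omega>) ^ Suc m"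
      by (intro tendsto_intros trunc_tendsto)
    then show "(\<lambda>n. S (X 0 \<omega>) * trunc (real (Suc n)) (S (X 0 \<omega>)) ^ Suc m) \<longlonglongrightarrow> S (X 0 \<omega>) ^ (m + 2)" by simp
  qed
qed auto

lemma L1_bound_S2: "L1_bound M (\<lambda>\<omega>. (S (X 0 \<omega>))\<^sup>2) A2"
proof -
  have "L1_bound M (\<lambda>\<omega>. S (X 0 \<omega>) ^ 0) 1" using L1_bound_const[of 1] by simp
  then have "L1_bound M (\<lambda>\<omega>. S (X 0 \<omega>) ^ (0 + 2)) (4 * (real (Suc 0) * \<sigma> * S1\<^sup>2 + \<alpha> * S1 * e1) / (\<alpha> * s0 * d) * 1)"
    by (intro moment_step) simp_all
  then show ?thesis unfolding A2_def by (simp only: add_0 add_0_right of_nat_Suc of_nat_0 mult_1 mult_1_right)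
qed

lemma L1_bound_S4: "L1_bound M (\<lambda>\<omega>. (S (X 0 \<omega>)) ^ 4) A4"
proof -
  have "L1_bound M (\<lambda>\<omega>. S (X 0 \<omega>) ^ (2 + 2)) (4 * (real (Suc 2) * \<sigma> * S1\<^sup>2 + \<alpha> * S1 * e1) / (\<alpha> * s0 * d) * A2)"
    by (rule moment_step[OF _ L1_bound_S2]) simp
  then show ?thesis by (simp add: A4_def)
qed

lemma L1_bound_X2: assumes "0 \<le> t" shows "L1_bound M (\<lambda>\<omega>. (X t \<omega>)\<^sup>2) (X2\<^sup>2)"
proof (rule L1_bound_stationary[OF assms, where g = "\<lambda>x. x\<^sup>2"])
  have "L1_bound M (\<lambda>\<omega>. (S (X 0 \<omega>) + (X 0 \<omega> - S (X 0 \<omega>)))\<^sup>2) (2 * A2 + 2 * CH\<^sup>2)"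
  proof (rule L1_bound_sum_squares[OF L1_bound_S2])
    show "L1_bound M (\<lambda>\<omega>. (X 0 \<omega> - S (X 0 \<omega>))\<^sup>2) (CH\<^sup>2)"
    proof (rule L1_bound_mono[OF L1_bound_const[of "CH\<^sup>2"]])
      show "AE \<omega> in M. \<bar>(X 0 \<omega> - S (X 0 \<omega>))\<^sup>2\<bar> \<le> \<bar>CH\<^sup>2\<bar>"
        using coord_dist(2)[OF eps] cell_constants(2) by (intro AE_I2) (simp add: abs_le_square_iff[symmetric] abs_minus_commute)
    qed simp
  qed
  then show "L1_bound M (\<lambda>\<omega>. (X 0 \<omega>)\<^sup>2) (X2\<^sup>2)"
    using A_nonneg by (simp add: X2_def L1_bound_weaken)
qed simp

lemma dV_powers: "(dV x)\<^sup>2 \<le> 2 * v0\<^sup>2 + 2 * Kv\<^sup>2 * (S x)\<^sup>2" "((dV x)\<^sup>2)\<^sup>2 \<le> 8 * v0 ^ 4 + 8 * Kv ^ 4 * S x ^ 4"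
proof -
  have v0: "0 \<le> v0" using cell_constants(2) Kv by (simp add: v0_def)
  have sq: "(r + s)\<^sup>2 \<le> 2 * r\<^sup>2 + 2 * s\<^sup>2" for r s :: real
    using zero_le_power2[of "r - s"] by (simp add: power2_diff power2_sum)
  have "(dV x)\<^sup>2 \<le> (v0 + Kv * \<bar>S x\<bar>)\<^sup>2"
    using dV_coord(2)[OF eps, of x] by (metis abs_ge_zero power2_abs power_mono)
  also have "\<dots> \<le> 2 * v0\<^sup>2 + 2 * (Kv * \<bar>S x\<bar>)\<^sup>2" by (rule sq)
  finally show 1: "(dV x)\<^sup>2 \<le> 2 * v0\<^sup>2 + 2 * Kv\<^sup>2 * (S x)\<^sup>2" by (simp add: power_mult_distrib)
  have "((dV x)\<^sup>2)\<^sup>2 \<le> (2 * v0\<^sup>2 + 2 * Kv\<^sup>2 * (S x)\<^sup>2)\<^sup>2" using 1 by (intro power_mono) auto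
  also have "\<dots> \<le> 2 * (2 * v0\<^sup>2)\<^sup>2 + 2 * (2 * Kv\<^sup>2 * (S x)\<^sup>2)\<^sup>2" by (rule sq)
  also have "\<dots> = 8 * v0 ^ 4 + 8 * Kv ^ 4 * S x ^ 4" by (simp add: power_mult_distrib flip: power_mult)
  finally show "((dV x)\<^sup>2)\<^sup>2 \<le> 8 * v0 ^ 4 + 8 * Kv ^ 4 * S x ^ 4" .
qed

lemma L1_bound_dV2: assumes "0 \<le> t" shows "L1_bound M (\<lambda>\<omega>. (dV (X t \<omega>))\<^sup>2) (V2\<^sup>2)"
proof (rule L1_bound_stationary[OF assms, where g = "\<lambda>x. (dV x)\<^sup>2"])
  have "L1_bound M (\<lambda>\<omega>. 2 * v0\<^sup>2 + 2 * Kv\<^sup>2 * (S (X 0 \<omega>))\<^sup>2) (2 * v0\<^sup>2 + \<bar>2 * Kv\<^sup>2\<bar> * A2)"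
    by (intro L1_bound_add L1_bound_cmult L1_bound_S2 L1_bound_const_le) simp
  then show "L1_bound M (\<lambda>\<omega>. (dV (X 0 \<omega>))\<^sup>2) (V2\<^sup>2)"
  proof (rule L1_bound_mono)
    show "AE \<omega> in M. \<bar>(dV (X 0 \<omega>))\<^sup>2\<bar> \<le> \<bar>2 * v0\<^sup>2 + 2 * Kv\<^sup>2 * (S (X 0 \<omega>))\<^sup>2\<bar>"
      using dV_powers(1) by (intro AE_I2) (simp add: order_trans[OF _ abs_ge_self])
  qed (use A_nonneg in \<open>simp add: V2_def\<close>)
qed measurable

lemma L1_bound_dV4: assumes "0 \<le> t" shows "L1_bound M (\<lambda>\<omega>. ((dV (X t \<omega>))\<^sup>2)\<^sup>2) (V4\<^sup>2)"
proof (rule L1_bound_stationary[OF assms, where g = "\<lambda>x. ((dV x)\<^sup>2)\<^sup>2"])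
  have "L1_bound M (\<lambda>\<omega>. 8 * v0 ^ 4 + 8 * Kv ^ 4 * (S (X 0 \<omega>)) ^ 4) (8 * v0 ^ 4 + \<bar>8 * Kv ^ 4\<bar> * A4)"
    by (intro L1_bound_add L1_bound_cmult L1_bound_S4 L1_bound_const_le) simp
  then show "L1_bound M (\<lambda>\<omega>. ((dV (X 0 \<omega>))\<^sup>2)\<^sup>2) (V4\<^sup>2)"
  proof (rule L1_bound_mono)
    show "AE \<omega> in M. \<bar>((dV (X 0 \<omega>))\<^sup>2)\<^sup>2\<bar> \<le> \<bar>8 * v0 ^ 4 + 8 * Kv ^ 4 * (S (X 0 \<omega>)) ^ 4\<bar>"
      using dV_powers(2) by (intro AE_I2) (simp add: order_trans[OF _ abs_ge_self])
  qed (use A_nonneg in \<open>simp add: V4_def\<close>)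
qed measurable

end

section \<open>Averaging over the fast scale\<close>

context cell_problem
begin

text \<open>Size of an increment over time \<open>h\<close> in the corrected coordinate: the
  corrector at both ends, the noise, and the drift that has lost its \<open>1 / \<epsilon>\<close>
  part.\<close>

definition incr_rate :: "real \<Rightarrow> real \<Rightarrow> real" where
  "incr_rate \<epsilon> h = 2 * (\<epsilon> * CH) + sqrt (2 * \<sigma>) * S1 * sqrt (2 * h) + h * (\<alpha> * S1 * V2)"

text \<open>A lower bound for \<open>\<sigma> * q^2 * (1 - tanh S ^ 2)\<close> where
  \<open>\<bar>x\<bar>\<close> is at most \<open>max 1 ((1 + a) / d)\<close>. Beyond this radius
  \<open>\<bar>V'\<bar>\<close> is at least 1; the summand \<open>CH\<close> passes from
  \<open>x\<close> to \<open>S\<close>.\<close>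

definition c1 :: real where "c1 = \<sigma> * s0\<^sup>2 * (1 - tanh (max 1 ((1 + a) / d) + CH) ^ 2)"
definition Ca :: real where "Ca = \<alpha> * S1 + c1"
text \<open>The constant for which Young's inequality gives
  \<open>Ca * v \<le> c1 / 2 + Cq * v^2\<close>, keeping half of \<open>c1\<close>.\<close>

definition Cq :: real where "Cq = Ca\<^sup>2 / (2 * c1)"
definition \<gamma>G :: real where "\<gamma>G = CG / (\<sigma> * \<kappa>0)"
text \<open>Cost of the second corrector in units of \<epsilon>: its values at the two ends, its
  martingale part over a time of at most 1, and the slow drift acting on it.\<close>

definition C\<chi> :: real where
  "C\<chi> = S1 * \<gamma>G * (2 * (V4 * X2)) + sqrt (2 * \<sigma>) * (S1 * \<gamma>G) * (sqrt 2 * V4) + \<alpha> * (S1 * \<gamma>G * (V4 * V2))"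

lemma c1_pos: "0 < c1"
proof -
  have "tanh y ^ 2 < 1" for y :: real
    by (simp add: abs_square_less_1 abs_less_iff tanh_real_lt_1 minus_less_iff tanh_real_gt_neg1)
  then show ?thesis using sigma s0(1) by (simp add: c1_def)
qed

lemma C_pos: "0 < Ca" "0 < Cq" "0 \<le> \<gamma>G" "0 \<le> C\<chi>"
proof -
  show "0 < Ca" unfolding Ca_def using alpha cell_constants(1) c1_pos by (simp add: add_pos_pos)
  then show "0 < Cq" using c1_pos by (simp add: Cq_def)
  show "0 \<le> \<gamma>G" using cell_constants(3) sigma kappa0 by (simp add: \<gamma>G_def)
  then show "0 \<le> C\<chi>" using alpha cell_constants(1) sigma V_pos by (simp add: C\<chi>_def)
qed

lemma incr_rate_mono: "0 \<le> h \<Longrightarrow> h \<le> k \<Longrightarrow> incr_rate \<epsilon> h \<le> incr_rate \<epsilon> k"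
proof -
  assume h: "0 \<le> h" "h \<le> k"
  have "sqrt (2 * \<sigma>) * S1 * sqrt (2 * h) \<le> sqrt (2 * \<sigma>) * S1 * sqrt (2 * k)"
    using h cell_constants(1) sigma by (intro mult_left_mono) auto
  moreover have "h * (\<alpha> * S1 * V2) \<le> k * (\<alpha> * S1 * V2)"
    using h alpha cell_constants(1) V_pos(1) by (intro mult_right_mono) auto
  ultimately show ?thesis by (simp add: incr_rate_def)
qed

lemma dV_ge_1:
  assumes "max 1 ((1 + a) / d) < \<bar>x\<bar>" shows "1 \<le> \<bar>dV x\<bar>"
proof -
  have x: "1 < \<bar>x\<bar>" "1 + a < d * \<bar>x\<bar>" using assms d by (auto simp: field_simps)
  have "d * x\<^sup>2 - a \<le> \<bar>dV x\<bar> * \<bar>x\<bar>" using dissipative[of x] by (metis abs_ge_self abs_mult order_trans)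
  moreover have "d * x\<^sup>2 = (d * \<bar>x\<bar>) * \<bar>x\<bar>" by (simp add: power2_eq_square)
  moreover have "(1 + a) * \<bar>x\<bar> \<le> (d * \<bar>x\<bar>) * \<bar>x\<bar>" using x by (intro mult_right_mono) auto
  moreover have "a * 1 \<le> a * \<bar>x\<bar>" using a x by (intro mult_left_mono) auto
  ultimately have "1 * \<bar>x\<bar> \<le> \<bar>dV x\<bar> * \<bar>x\<bar>" by (simp add: algebra_simps)
  then show ?thesis by (rule mult_right_le_imp_le) (use x in simp)
qed

end

context multiscale_sde
begin

section \<open>Increments and averaging in the corrected coordinate\<close>

lemma q_abs: "\<bar>q y\<bar> \<le> S1"
  using S1[of y] cell_constants(4)[of y] by simp

lemma S_test_fn: "test_fn S (fd1 (\<lambda>_. 1)) (fd2 (\<lambda>_. 1) (\<lambda>_. 0))"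
  by (rule test_fn_conjugate[OF eps(1), where ?g2.0 = "\<lambda>_. 0"])
    (use coord_deriv[OF eps(1)] in \<open>auto intro: bfun_const\<close>)

lemma gen_S: "gen (fd1 (\<lambda>_. 1)) (fd2 (\<lambda>_. 1) (\<lambda>_. 0)) x = - \<alpha> * (q (x / \<epsilon>) * dV x)"
  unfolding gen_conjugate by simp

abbreviation "dynS \<equiv> dynkin S (fd1 (\<lambda>_. 1)) (fd2 (\<lambda>_. 1) (\<lambda>_. 0))"

lemma dynS_weighted:
  assumes "0 \<le> s" "s \<le> t" "g \<in> borel_measurable (F s)" "L1_bound M (\<lambda>\<omega>. (g \<omega>)\<^sup>2) (v\<^sup>2)" "0 < v"
  shows "L1_bound M (\<lambda>\<omega>. g \<omega> * dynS s t \<omega>) (v * (cc * S1 * sqrt (2 * (t - s))))"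
proof -
  have "L1_bound M (\<lambda>\<omega>. g \<omega> * dynS s t \<omega>) (cc * S1 * sqrt (2 * (t - s) * v\<^sup>2))"
    by (rule L1_bound_dynkin[OF S_test_fn _ assms(1-4)]) (simp add: q_abs)
  then show ?thesis using assms(5) by (simp add: real_sqrt_mult mult_ac)
qed

lemma L1_bound_weighted_integral:
  assumes "0 \<le> s" "s \<le> t" and k: "continuous_on UNIV k" and kb: "\<And>x. \<bar>k x\<bar> \<le> C * \<bar>dV x\<bar>" and C: "0 \<le> C"
    and g: "L1_bound M (\<lambda>\<omega>. (g \<omega>)\<^sup>2) (v\<^sup>2)" "0 < v"
  shows "L1_bound M (\<lambda>\<omega>. g \<omega> * integral {s..t} (\<lambda>r. k (X r \<omega>))) ((t - s) * (C * (v * V2)))"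
proof -
  have "L1_bound M (\<lambda>\<omega>. integral {s..t} (\<lambda>r. g \<omega> * k (X r \<omega>))) ((t - s) * (C * (v * V2)))"
  proof (rule L1_bound_integral[OF assms(2)])
    show "AE \<omega> in M. continuous_on {s..t} (\<lambda>r. g \<omega> * k (X r \<omega>))"
      using continuous_path_comp[OF k assms(1)] by eventually_elim (intro continuous_intros)
    fix r assume r: "r \<in> {s..t}"
    then have "0 \<le> r" using assms(1) by simp
    from L1_bound_cmult[OF L1_bound_mult[OF g(1) L1_bound_dV2[OF this] g(2) V_pos(1)], of C]
    have 1: "L1_bound M (\<lambda>\<omega>. C * (g \<omega> * dV (X r \<omega>))) (\<bar>C\<bar> * (v * V2))" .
    show "L1_bound M (\<lambda>\<omega>. g \<omega> * k (X r \<omega>)) (C * (v * V2))"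
    proof (rule L1_bound_mono[OF 1], rule AE_I2)
      fix \<omega>
      show "\<bar>g \<omega> * k (X r \<omega>)\<bar> \<le> \<bar>C * (g \<omega> * dV (X r \<omega>))\<bar>"
        using mult_left_mono[OF kb[of "X r \<omega>"], of "\<bar>g \<omega>\<bar>"] C by (simp add: abs_mult mult_ac)
    qed (use C in simp)
  qed
  then show ?thesis by simp
qed

lemma S_dist_increment: "\<bar>(S y - y) - (S x - x)\<bar> \<le> 2 * (\<epsilon> * CH)"
  using coord_dist(1)[OF eps, of x] coord_dist(1)[OF eps, of y] by linarith

text \<open>A direct estimate would pay \<open>h / \<epsilon>\<close> for the singular drift.
  Writing \<open>X\<close> as \<open>S\<close> minus a corrector of size
  \<open>\<epsilon> * CH\<close> replaces this by the bounded cost \<open>incr_rate\<close>. The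
  weight is known at time \<open>s\<close>, which keeps the martingale part orthogonal.\<close>

lemma L1_bound_weighted_increment:
  assumes "0 \<le> s" "s \<le> t" and g: "g \<in> borel_measurable (F s)" "L1_bound M (\<lambda>\<omega>. (g \<omega>)\<^sup>2) (v\<^sup>2)" "0 < v"
  shows "L1_bound M (\<lambda>\<omega>. g \<omega> * (X t \<omega> - X s \<omega>)) (v * incr_rate \<epsilon> (t - s))"
proof -
  have C0: "0 \<le> \<alpha> * S1" using alpha cell_constants(1) by simp
  have k: "continuous_on UNIV (\<lambda>x. - \<alpha> * (q (x / \<epsilon>) * dV x))"
    by (intro continuous_intros q_scale_continuous dV_continuous)
  have kb: "\<bar>- \<alpha> * (q (x / \<epsilon>) * dV x)\<bar> \<le> (\<alpha> * S1) * \<bar>dV x\<bar>" for x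
    using mult_right_mono[OF q_abs[of "x / \<epsilon>"], of "\<alpha> * \<bar>dV x\<bar>"] alpha by (simp add: abs_mult mult_ac)
  have e: "L1_bound M (\<lambda>\<omega>. g \<omega> * ((S (X t \<omega>) - X t \<omega>) - (S (X s \<omega>) - X s \<omega>))) (\<bar>2 * (\<epsilon> * CH)\<bar> * v)"
  proof (rule L1_bound_mono[OF L1_bound_cmult[OF L1_bound_of_square[OF g(2,3)]] _ order_refl], rule AE_I2)
    fix \<omega>
    have "0 \<le> 2 * (\<epsilon> * CH)" using eps cell_constants(2) by simp
    then show "\<bar>g \<omega> * ((S (X t \<omega>) - X t \<omega>) - (S (X s \<omega>) - X s \<omega>))\<bar> \<le> \<bar>2 * (\<epsilon> * CH) * g \<omega>\<bar>"
      using mult_left_mono[OF S_dist_increment[of "X t \<omega>" "X s \<omega>"], of "\<bar>g \<omega>\<bar>"]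
      by (simp only: abs_mult[of "g \<omega>"] abs_mult[of _ "g \<omega>"] abs_of_nonneg mult.commute)
  qed
  note L = L1_bound_diff[OF L1_bound_add[OF dynS_weighted[OF assms]
      L1_bound_weighted_integral[OF assms(1,2) k kb C0 g(2,3)]] e]
  show ?thesis
  proof (rule L1_bound_mono[OF L], rule AE_I2)
    fix \<omega>
    have "g \<omega> * (X t \<omega> - X s \<omega>) = g \<omega> * dynS s t \<omega> + g \<omega> * integral {s..t} (\<lambda>r. - \<alpha> * (q (X r \<omega> / \<epsilon>) * dV (X r \<omega>)))
      - g \<omega> * ((S (X t \<omega>) - X t \<omega>) - (S (X s \<omega>) - X s \<omega>))"
      unfolding dynkin_def gen_S by (simp only: right_diff_distrib)
    then show "\<bar>g \<omega> * (X t \<omega> - X s \<omega>)\<bar> \<le> \<bar>g \<omega> * dynS s t \<omega> + g \<omega> * integral {s..t} (\<lambda>r. - \<alpha> * (q (X r \<omega> / \<epsilon>) * dV (X r \<omega>)))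
      - g \<omega> * ((S (X t \<omega>) - X t \<omega>) - (S (X s \<omega>) - X s \<omega>))\<bar>" by simp
  qed (use eps cell_constants(2) in \<open>simp add: incr_rate_def algebra_simps\<close>)
qed

lemma dV_X_adapted: "0 \<le> t \<Longrightarrow> (\<lambda>\<omega>. dV (X t \<omega>)) \<in> borel_measurable (F t)"
  using X_adapted[of t] by measurable

text \<open>Solve \<open>\<sigma> * q * g' = q - Kh\<close> by a function \<open>g\<close> of order
  \<epsilon>. The generator of the associated \<open>f\<close> is \<open>q - Kh\<close> up to
  \<open>\<alpha> * q * g * dV\<close>, so the integral of \<open>q - Kh\<close> is an increment of
  \<open>f\<close>, a martingale part and a slow drift term, all of order \<epsilon>. The increment
  is controlled by the Lipschitz constant of \<open>f\<close>, also of order \<epsilon>, and second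
  moments of \<open>X\<close>. The weight \<open>dV^2\<close> is what makes fourth moments of
  \<open>dV\<close> enter.\<close>

lemma L1_bound_corrector:
  assumes "0 \<le> s" "s \<le> t" "t \<le> s + 1"
  shows "L1_bound M (\<lambda>\<omega>. (dV (X s \<omega>))\<^sup>2 * integral {s..t} (\<lambda>r. q (X r \<omega> / \<epsilon>) - Kh)) (\<epsilon> * C\<chi>)"
proof -
  define g where "g x = \<epsilon> * (1 / (\<sigma> * \<kappa>0)) * G (x / \<epsilon>)" for x
  define g1 where "g1 x = (1 / \<sigma>) * (1 - Kh * inverse (q (x / \<epsilon>)))" for x
  define g2 where "g2 x = (1 / \<sigma>) * (Kh * (q (x / \<epsilon>) * dp (x / \<epsilon>) * (1 / \<sigma>) * (1 / \<epsilon>) * (inverse (q (x / \<epsilon>)))\<^sup>2))" for x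
  \<comment> \<open>The density \<open>exp (- p / \<sigma>)\<close> is \<open>\<kappa>0 / q\<close>,
    so the derivative of \<open>G\<close> is \<open>\<kappa>0 * (1 - Kh / q)\<close>. Division by
    \<open>\<sigma> * \<kappa>0\<close> gives \<open>g1\<close>, and multiplication by
    \<open>\<sigma> * q\<close> returns \<open>q - Kh\<close>.\<close>
  have Gd: "(q y - Kh) * exp (- p y / \<sigma>) = \<kappa>0 * (1 - Kh * inverse (q y))" for y
  proof -
    have "exp (- p y / \<sigma>) = \<kappa>0 * inverse (q y)" using kappa0 by (simp add: q_eq exp_minus)
    then show ?thesis using cell_constants(4)[of y] by (simp add: field_simps)
  qed
  have d1: "(g has_real_derivative g1 x) (at x)" for x
    unfolding g_def[abs_def]
    by (rule DERIV_cong[OF DERIV_cmult[OF comp_scale_deriv[OF G_deriv eps(1)]]])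
      (unfold Gd g1_def, use eps kappa0 in simp)
  have d2: "(g1 has_real_derivative g2 x) (at x)" for x
  proof -
    have "q (x / \<epsilon>) \<noteq> 0" using cell_constants(4)[of "x / \<epsilon>"] by simp
    from DERIV_cmult[OF DERIV_diff[OF DERIV_const DERIV_cmult[OF DERIV_inverse_fun[OF comp_scale_deriv[OF q_deriv eps(1)] this]]]]
    show ?thesis unfolding g1_def[abs_def]
      by (rule DERIV_cong) (simp add: g2_def field_simps power2_eq_square)
  qed
  have inv: "bfun (\<lambda>x. inverse (q (x / \<epsilon>)))"
  proof (rule bfunI)
    show "\<bar>inverse (q (x / \<epsilon>))\<bar> \<le> inverse s0" for x
      using cell_constants(4)[of "x / \<epsilon>"] s0 by (simp add: le_imp_inverse_le)
  qed
  have Gb: "bfun (\<lambda>x. G (x / \<epsilon>))" by (rule bfunI, rule G_bound)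
  have b: "bfun g" "bfun g1" "bfun g2"
    unfolding g_def g1_def g2_def by (intro bfun_intros inv Gb q_bfun dp_bfun)+
  obtain f where f: "\<And>x. (f has_real_derivative q (x / \<epsilon>) * g x) (at x)" using conjugate_antiderivative[OF d1] by blast
  have T: "test_fn f (fd1 g) (fd2 g g1)" by (rule test_fn_conjugate[OF eps(1) f d1 d2 b])
  have gb: "\<bar>g x\<bar> \<le> \<epsilon> * \<gamma>G" for x
    using eps sigma kappa0 G_bound[of "x / \<epsilon>"]
    by (simp add: g_def \<gamma>G_def abs_mult divide_right_mono)
  have fb: "\<bar>q (x / \<epsilon>) * g x\<bar> \<le> S1 * (\<epsilon> * \<gamma>G)" for x
    unfolding abs_mult using q_abs gb cell_constants(1) by (intro mult_mono) auto
  define C where "C = S1 * (\<epsilon> * \<gamma>G)"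
  have C: "0 \<le> C" using cell_constants(1) eps C_pos by (simp add: C_def)
  have f_lip: "\<bar>f y - f x\<bar> \<le> C * \<bar>y - x\<bar>" for x y
    unfolding C_def by (rule derivative_bound_Lipschitz[OF f fb])
  have gen: "gen (fd1 g) (fd2 g g1) x = (q (x / \<epsilon>) - Kh) - \<alpha> * (q (x / \<epsilon>) * g x * dV x)" for x
    unfolding gen_conjugate g1_def using sigma cell_constants(4)[of "x / \<epsilon>"] by (simp add: field_simps)
  define w where "w \<omega> = (dV (X s \<omega>))\<^sup>2" for \<omega>
  have wF: "w \<in> borel_measurable (F s)" unfolding w_def using dV_X_adapted[OF assms(1)] by measurable
  have w2: "L1_bound M (\<lambda>\<omega>. (w \<omega>)\<^sup>2) (V4\<^sup>2)" unfolding w_def by (rule L1_bound_dV4[OF assms(1)])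
  have t0: "0 \<le> t" using assms by simp
  have gc: "continuous_on UNIV g" using d1 by (auto intro!: DERIV_isCont continuous_at_imp_continuous_on)
  have k: "continuous_on UNIV (\<lambda>x. q (x / \<epsilon>) * g x * dV x)"
    by (intro continuous_intros q_scale_continuous dV_continuous gc)
  have kb: "\<bar>q (x / \<epsilon>) * g x * dV x\<bar> \<le> C * \<bar>dV x\<bar>" for x
    using mult_right_mono[OF fb[of x], of "\<bar>dV x\<bar>"] by (simp add: abs_mult C_def)
  have L1: "L1_bound M (\<lambda>\<omega>. w \<omega> * (f (X t \<omega>) - f (X s \<omega>))) (\<bar>C\<bar> * (V4 * X2 + V4 * X2))"
  proof (rule L1_bound_mono[OF L1_bound_cmult[OF L1_bound_add[OF
          L1_bound_abs_iff[THEN iffD2, OF L1_bound_mult[OF w2 L1_bound_X2[OF t0] V_pos(2,3)]]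
          L1_bound_abs_iff[THEN iffD2, OF L1_bound_mult[OF w2 L1_bound_X2[OF assms(1)] V_pos(2,3)]]]] _ order_refl], rule AE_I2)
    fix \<omega>
    have "\<bar>f (X t \<omega>) - f (X s \<omega>)\<bar> \<le> C * (\<bar>X t \<omega>\<bar> + \<bar>X s \<omega>\<bar>)"
      by (rule order_trans[OF f_lip mult_left_mono[OF abs_triangle_ineq4 C]])
    from mult_left_mono[OF this, of "\<bar>w \<omega>\<bar>"]
    have "\<bar>w \<omega> * (f (X t \<omega>) - f (X s \<omega>))\<bar> \<le> C * (\<bar>w \<omega> * X t \<omega>\<bar> + \<bar>w \<omega> * X s \<omega>\<bar>)"
      by (simp only: abs_mult distrib_left mult.left_commute)
    also have "\<dots> \<le> \<bar>C * (\<bar>w \<omega> * X t \<omega>\<bar> + \<bar>w \<omega> * X s \<omega>\<bar>)\<bar>" by (rule abs_ge_self)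
    finally show "\<bar>w \<omega> * (f (X t \<omega>) - f (X s \<omega>))\<bar> \<le> \<bar>C * (\<bar>w \<omega> * X t \<omega>\<bar> + \<bar>w \<omega> * X s \<omega>\<bar>)\<bar>" .
  qed
  have L2: "L1_bound M (\<lambda>\<omega>. w \<omega> * dynkin f (fd1 g) (fd2 g g1) s t \<omega>) (cc * C * sqrt (2 * (t - s) * V4\<^sup>2))"
    by (rule L1_bound_dynkin[OF T _ assms(1,2) wF w2]) (use fb in \<open>simp add: C_def\<close>)
  have L3: "L1_bound M (\<lambda>\<omega>. \<alpha> * (w \<omega> * integral {s..t} (\<lambda>r. q (X r \<omega> / \<epsilon>) * g (X r \<omega>) * dV (X r \<omega>)))) (\<bar>\<alpha>\<bar> * ((t - s) * (C * (V4 * V2))))"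
    by (rule L1_bound_cmult[OF L1_bound_weighted_integral[OF assms(1,2) k kb C w2 V_pos(2)]])
  show ?thesis
  proof (rule L1_bound_mono[OF L1_bound_add[OF L1_bound_diff[OF L1 L2] L3]])
    show "AE \<omega> in M. \<bar>(dV (X s \<omega>))\<^sup>2 * integral {s..t} (\<lambda>r. q (X r \<omega> / \<epsilon>) - Kh)\<bar> \<le>
      \<bar>w \<omega> * (f (X t \<omega>) - f (X s \<omega>)) - w \<omega> * dynkin f (fd1 g) (fd2 g g1) s t \<omega> +
        \<alpha> * (w \<omega> * integral {s..t} (\<lambda>r. q (X r \<omega> / \<epsilon>) * g (X r \<omega>) * dV (X r \<omega>)))\<bar>"
      using continuous_path_comp[OF q_scale_continuous assms(1), of t] continuous_path_comp[OF k assms(1), of t]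
    proof eventually_elim
      case (elim \<omega>)
      have i1: "(\<lambda>r. q (X r \<omega> / \<epsilon>) - Kh) integrable_on {s..t}"
        by (rule integrable_continuous_real) (intro continuous_intros elim(1))
      have i2: "(\<lambda>r. \<alpha> * (q (X r \<omega> / \<epsilon>) * g (X r \<omega>) * dV (X r \<omega>))) integrable_on {s..t}"
        by (rule integrable_continuous_real) (intro continuous_on_mult continuous_on_const elim(2))
      have "integral {s..t} (\<lambda>r. gen (fd1 g) (fd2 g g1) (X r \<omega>)) = integral {s..t} (\<lambda>r. q (X r \<omega> / \<epsilon>) - Kh)
        - integral {s..t} (\<lambda>r. \<alpha> * (q (X r \<omega> / \<epsilon>) * g (X r \<omega>) * dV (X r \<omega>)))"
        unfolding gen by (rule Henstock_Kurzweil_Integration.integral_diff[OF i1 i2])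
      then have I: "integral {s..t} (\<lambda>r. q (X r \<omega> / \<epsilon>) - Kh) = f (X t \<omega>) - f (X s \<omega>) - dynkin f (fd1 g) (fd2 g g1) s t \<omega>
        + \<alpha> * integral {s..t} (\<lambda>r. q (X r \<omega> / \<epsilon>) * g (X r \<omega>) * dV (X r \<omega>))"
        unfolding dynkin_def by simp
      have "(dV (X s \<omega>))\<^sup>2 * integral {s..t} (\<lambda>r. q (X r \<omega> / \<epsilon>) - Kh) =
        w \<omega> * (f (X t \<omega>) - f (X s \<omega>)) - w \<omega> * dynkin f (fd1 g) (fd2 g g1) s t \<omega> +
        \<alpha> * (w \<omega> * integral {s..t} (\<lambda>r. q (X r \<omega> / \<epsilon>) * g (X r \<omega>) * dV (X r \<omega>)))"
        unfolding I w_def by (simp only: distrib_left right_diff_distrib mult.left_commute)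
      then show ?case by simp
    qed
    have "cc * C * sqrt (2 * (t - s) * V4\<^sup>2) \<le> cc * C * (sqrt 2 * V4)"
    proof (rule mult_left_mono)
      have "sqrt (2 * (t - s) * V4\<^sup>2) = sqrt (2 * (t - s)) * V4" using V_pos(2) by (simp add: real_sqrt_mult)
      also have "\<dots> \<le> sqrt 2 * V4" using assms V_pos(2) by (intro mult_right_mono) auto
      finally show "sqrt (2 * (t - s) * V4\<^sup>2) \<le> sqrt 2 * V4" .
    qed (use C sigma in simp)
    moreover have "(t - s) * (C * (V4 * V2)) \<le> 1 * (C * (V4 * V2))"
      using assms C V_pos by (intro mult_right_mono) auto
    then have "\<bar>\<alpha>\<bar> * ((t - s) * (C * (V4 * V2))) \<le> \<alpha> * (C * (V4 * V2))" using alpha by simp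
    ultimately show "\<bar>C\<bar> * (V4 * X2 + V4 * X2) + cc * C * sqrt (2 * (t - s) * V4\<^sup>2) + \<bar>\<alpha>\<bar> * ((t - s) * (C * (V4 * V2))) \<le> \<epsilon> * C\<chi>"
      using C unfolding C\<chi>_def C_def by (simp add: algebra_simps)
  qed
qed

end

section \<open>Numerator and denominator of the estimator\<close>

context multiscale_sde
begin

text \<open>Denominator and, in \<open>Pn\<close>, numerator of the estimator, both divided by the
  observation time \<open>N * \<delta>\<close>; the quotient is unchanged.\<close>

definition Qn :: "nat \<Rightarrow> real \<Rightarrow> 'a \<Rightarrow> real" where
  "Qn N \<delta> \<omega> = (\<Sum>n<N. (dV (X (real n * \<delta>) \<omega>))\<^sup>2) / real N"

definition Pn :: "nat \<Rightarrow> real \<Rightarrow> 'a \<Rightarrow> real" where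
  "Pn N \<delta> \<omega> = - (\<Sum>n<N. dV (X (real n * \<delta>) \<omega>) * (X (real (Suc n) * \<delta>) \<omega> - X (real n * \<delta>) \<omega>)) / (real N * \<delta>)"

text \<open>The instance \<open>R = 1\<close>, \<open>m = 0\<close> of the truncated powers, so
  \<open>g = tanh S\<close>. Its second-order part is at least \<open>c1\<close> on a bounded set.
  Off this set it is nonnegative and \<open>1 \<le> \<bar>dV x\<bar>\<close>, so subtracting
  \<open>c1 * \<bar>dV x\<bar>\<close> makes the bound hold everywhere.\<close>

lemma gen_lower_bound:
  fixes x :: real
  defines "g \<equiv> \<lambda>x. trunc 1 (S x) ^ Suc 0"
    and "g1 \<equiv> \<lambda>x. real (Suc 0) * trunc 1 (S x) ^ 0 * (1 - tanh (S x / 1) ^ 2) * q (x / \<epsilon>)"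
  shows "c1 - Ca * \<bar>dV x\<bar> \<le> gen (fd1 g) (fd2 g g1) x"
proof -
  define w where "w = 1 - tanh (S x) ^ 2"
  define Q where "Q = q (x / \<epsilon>)"
  have Q: "0 < Q" "s0 \<le> Q" "Q \<le> S1" using cell_constants(4) s0(2) S1 by (auto simp: Q_def)
  have w: "0 \<le> w" using tanh_square_le_1[of "S x"] by (simp add: w_def)
  have gen: "gen (fd1 g) (fd2 g g1) x = \<sigma> * (Q * Q) * w - \<alpha> * (Q * (dV x * tanh (S x)))"
    unfolding gen_conjugate by (simp add: g_def g1_def trunc_def w_def Q_def algebra_simps)
  have "\<bar>tanh (S x)\<bar> \<le> 1" using tanh_square_le_1[of "S x"] by (simp add: abs_square_le_1)
  then have "\<bar>dV x\<bar> * \<bar>tanh (S x)\<bar> \<le> \<bar>dV x\<bar> * 1" by (rule mult_left_mono) simp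
  then have "\<bar>Q * (dV x * tanh (S x))\<bar> \<le> S1 * \<bar>dV x\<bar>"
    unfolding abs_mult using Q by (intro mult_mono) auto
  then have 1: "\<alpha> * (Q * (dV x * tanh (S x))) \<le> \<alpha> * S1 * \<bar>dV x\<bar>"
    using alpha by (simp add: mult.assoc abs_le_iff)
  have QQ: "s0\<^sup>2 \<le> Q * Q" unfolding power2_eq_square using Q s0(1) by (intro mult_mono) auto
  have "c1 - c1 * \<bar>dV x\<bar> \<le> \<sigma> * (Q * Q) * w"
  proof (cases "\<bar>x\<bar> \<le> max 1 ((1 + a) / d)")
    case True
    define r where "r = max 1 ((1 + a) / d) + CH"
    have "\<bar>S x\<bar> \<le> r" using coord_dist(2)[OF eps, of x] True unfolding r_def by linarith
    then have "\<bar>tanh (S x)\<bar> \<le> tanh r"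
      by (metis abs_le_iff minus_le_iff tanh_minus tanh_real_le_iff)
    then have "tanh (S x) ^ 2 \<le> tanh r ^ 2" by (metis abs_ge_zero power2_abs power_mono)
    then have "1 - tanh r ^ 2 \<le> w" by (simp add: w_def)
    moreover have "0 \<le> 1 - tanh r ^ 2" using tanh_square_le_1[of r] by simp
    ultimately have "\<sigma> * s0\<^sup>2 * (1 - tanh r ^ 2) \<le> \<sigma> * (Q * Q) * w"
      using QQ sigma Q by (intro mult_mono mult_left_mono) auto
    moreover have "0 \<le> c1 * \<bar>dV x\<bar>" using c1_pos by simp
    ultimately show ?thesis unfolding c1_def r_def[symmetric] by simp
  next
    case False
    then have "1 \<le> \<bar>dV x\<bar>" by (intro dV_ge_1) (simp only: not_le)
    then have "c1 * 1 \<le> c1 * \<bar>dV x\<bar>" using c1_pos by (intro mult_left_mono) auto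
    moreover have "0 \<le> \<sigma> * (Q * Q) * w" using sigma w by simp
    ultimately show ?thesis by simp
  qed
  then show ?thesis using 1 unfolding gen Ca_def distrib_right by simp
qed

lemma L1_bound_block_increment:
  assumes s: "0 \<le> s" "0 < \<delta>" and g: "g \<in> borel_measurable (F s)" "L1_bound M (\<lambda>\<omega>. (g \<omega>)\<^sup>2) (v\<^sup>2)" "0 < v"
  shows "L1_bound M (\<lambda>\<omega>. integral {s..s + \<delta>} (\<lambda>r. \<bar>g \<omega> * (X r \<omega> - X s \<omega>)\<bar>)) (\<delta> * (v * incr_rate \<epsilon> \<delta>))"
proof -
  have "L1_bound M (\<lambda>\<omega>. integral {s..s + \<delta>} (\<lambda>r. \<bar>g \<omega> * (X r \<omega> - X s \<omega>)\<bar>)) ((s + \<delta> - s) * (v * incr_rate \<epsilon> \<delta>))"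
  proof (rule L1_bound_integral)
    show "s \<le> s + \<delta>" using s by simp
    have "AE \<omega> in M. continuous_on {s..s + \<delta>} (\<lambda>r. X r \<omega>)"
      by (rule continuous_path_comp[where g = "\<lambda>x. x"]) (use s in \<open>auto intro: continuous_intros\<close>)
    then show "AE \<omega> in M. continuous_on {s..s + \<delta>} (\<lambda>r. \<bar>g \<omega> * (X r \<omega> - X s \<omega>)\<bar>)"
      by eventually_elim (intro continuous_intros)
    fix r assume r: "r \<in> {s..s + \<delta>}"
    have "L1_bound M (\<lambda>\<omega>. g \<omega> * (X r \<omega> - X s \<omega>)) (v * incr_rate \<epsilon> (r - s))"
      by (rule L1_bound_weighted_increment[OF s(1) _ g]) (use r in simp)
    then show "L1_bound M (\<lambda>\<omega>. \<bar>g \<omega> * (X r \<omega> - X s \<omega>)\<bar>) (v * incr_rate \<epsilon> \<delta>)"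
      unfolding L1_bound_abs_iff
      by (rule L1_bound_weaken) (use r g(3) incr_rate_mono[of "r - s" \<delta>] in auto)
  qed
  then show ?thesis by simp
qed

text \<open>The time integral of a generator over \<open>{0..T}\<close> is an increment of
  \<open>f\<close> minus a martingale part, of size \<open>O(1 + sqrt T)\<close>. Its integrand is
  at least \<open>c1 - Ca * \<bar>dV\<bar>\<close>, hence the time average of
  \<open>\<bar>dV\<bar>\<close> cannot be small. Young's inequality turns this into a statement
  about \<open>dV^2\<close>, and moving from the time average to the samples costs increments. Only
  a deficit of \<open>Qn\<close> is harmful, hence the positive part.\<close>

lemma denominator_lower_bound:
  assumes N: "0 < N" and \<delta>: "0 < \<delta>"
  shows "L1_bound M (\<lambda>\<omega>. max 0 (c1 / 2 - Cq * Qn N \<delta> \<omega>))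
    ((S1 * (2 * X2) + cc * S1 * sqrt (2 * (real N * \<delta>))) / (real N * \<delta>) + Ca * Kv * incr_rate \<epsilon> \<delta>)"
proof -
  define T where "T = real N * \<delta>"
  have T: "0 < T" using N \<delta> by (simp add: T_def)
  define g where "g = (\<lambda>x. trunc 1 (S x) ^ Suc 0)"
  define g1 where "g1 = (\<lambda>x. real (Suc 0) * trunc 1 (S x) ^ 0 * (1 - tanh (S x / 1) ^ 2) * q (x / \<epsilon>))"
  obtain f where f: "test_fn f (fd1 g) (fd2 g g1)"
    using trunc_test_fn[of 1 0] unfolding g_def g1_def by auto
  have f1b: "\<bar>q (x / \<epsilon>) * g x\<bar> \<le> S1" for x
  proof -
    have "\<bar>tanh (S x)\<bar> \<le> 1" using tanh_square_le_1[of "S x"] by (simp add: abs_square_le_1)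
    then have "\<bar>q (x / \<epsilon>)\<bar> * \<bar>g x\<bar> \<le> S1 * 1" using q_abs cell_constants(1) by (intro mult_mono) (auto simp: g_def trunc_def)
    then show ?thesis by (simp add: abs_mult)
  qed
  have fL: "\<bar>f y - f x\<bar> \<le> S1 * \<bar>y - x\<bar>" for x y
    using f f1b by (intro derivative_bound_Lipschitz[where f' = "fd1 g"]) (auto simp: test_fn_def)
  have fc: "continuous_on UNIV (fd1 g)" "continuous_on UNIV (fd2 g g1)"
    by (rule test_fnE[OF f], assumption)+
  define U1 where "U1 \<omega> = f (X T \<omega>) - f (X 0 \<omega>)" for \<omega>
  define U2 where "U2 \<omega> = dynkin f (fd1 g) (fd2 g g1) 0 T \<omega>" for \<omega>
  define U3 where "U3 \<omega> = (\<Sum>n<N. integral {real n * \<delta>..real n * \<delta> + \<delta>} (\<lambda>r. \<bar>1 * (X r \<omega> - X (real n * \<delta>) \<omega>)\<bar>))" for \<omega>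
  have L1: "L1_bound M U1 (S1 * (2 * X2))"
  proof (rule L1_bound_mono[OF L1_bound_cmult[OF L1_bound_add[OF
        L1_bound_abs_iff[THEN iffD2, OF L1_bound_of_square[OF L1_bound_X2[OF less_imp_le[OF T]] V_pos(3)]]
        L1_bound_abs_iff[THEN iffD2, OF L1_bound_of_square[OF L1_bound_X2[OF order_refl] V_pos(3)]]], of S1]], rule AE_I2)
    fix \<omega>
    have "\<bar>U1 \<omega>\<bar> \<le> S1 * (\<bar>X T \<omega>\<bar> + \<bar>X 0 \<omega>\<bar>)"
      unfolding U1_def by (rule order_trans[OF fL mult_left_mono[OF abs_triangle_ineq4]]) (use cell_constants(1) in simp)
    then show "\<bar>U1 \<omega>\<bar> \<le> \<bar>S1 * (\<bar>X T \<omega>\<bar> + \<bar>X 0 \<omega>\<bar>)\<bar>" by (rule order_trans[OF _ abs_ge_self])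
  qed (use cell_constants(1) in simp)
  have one: "L1_bound M (\<lambda>\<omega>. (1::real)\<^sup>2) (1\<^sup>2)" by (rule L1_bound_const_le) simp
  have "L1_bound M (\<lambda>\<omega>. 1 * dynkin f (fd1 g) (fd2 g g1) 0 T \<omega>) (cc * S1 * sqrt (2 * (T - 0) * 1\<^sup>2))"
    by (rule L1_bound_dynkin[OF f f1b order_refl less_imp_le[OF T] _ one]) simp
  then have L2: "L1_bound M U2 (cc * S1 * sqrt (2 * T))"
    by (simp only: U2_def[abs_def] mult_1 power_one mult_1_right diff_zero)
  have "L1_bound M U3 (\<Sum>n<N. \<delta> * (1 * incr_rate \<epsilon> \<delta>))"
    unfolding U3_def
    by (intro L1_bound_sum L1_bound_block_increment \<delta> one) (use \<delta> in auto)
  then have L3: "L1_bound M U3 (T * incr_rate \<epsilon> \<delta>)" by (simp add: T_def mult.assoc)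
  have bd: "(1 / T) * (S1 * (2 * X2)) + (1 / T) * (cc * S1 * sqrt (2 * T)) + (Ca * Kv / T) * (T * incr_rate \<epsilon> \<delta>)
    = (S1 * (2 * X2) + cc * S1 * sqrt (2 * T)) / T + Ca * Kv * incr_rate \<epsilon> \<delta>"
    using T by (simp add: add_divide_distrib)
  have L: "L1_bound M (\<lambda>\<omega>. (1 / T) * \<bar>U1 \<omega>\<bar> + (1 / T) * \<bar>U2 \<omega>\<bar> + (Ca * Kv / T) * \<bar>U3 \<omega>\<bar>)
    (\<bar>1 / T\<bar> * (S1 * (2 * X2)) + \<bar>1 / T\<bar> * (cc * S1 * sqrt (2 * T)) + \<bar>Ca * Kv / T\<bar> * (T * incr_rate \<epsilon> \<delta>))"
    by (intro L1_bound_add L1_bound_cmult L1_bound_abs_iff[THEN iffD2] L1 L2 L3)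
  show ?thesis unfolding T_def[symmetric] bd[symmetric]
  proof (rule L1_bound_mono[OF L])
    show "AE \<omega> in M. \<bar>max 0 (c1 / 2 - Cq * Qn N \<delta> \<omega>)\<bar> \<le> \<bar>(1 / T) * \<bar>U1 \<omega>\<bar> + (1 / T) * \<bar>U2 \<omega>\<bar> + (Ca * Kv / T) * \<bar>U3 \<omega>\<bar>\<bar>"
      using continuous_path_comp[OF continuous_on_id order_refl, of T]
    proof eventually_elim
      case (elim \<omega>)
      have cX: "continuous_on {0..T} (\<lambda>r. X r \<omega>)" using elim by simp
      define u where "u r = gen (fd1 g) (fd2 g g1) (X r \<omega>)" for r
      define v where "v r = c1 - Ca * \<bar>dV (X r \<omega>)\<bar>" for r
      have cu: "continuous_on {0..T} u"
        unfolding u_def by (rule continuous_on_compose2[OF gen_continuous[OF fc] cX]) auto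
      have cd: "continuous_on {0..T} (\<lambda>r. dV (X r \<omega>))"
        by (rule continuous_on_compose2[OF dV_continuous cX]) auto
      have cv: "continuous_on {0..T} v" unfolding v_def by (intro continuous_intros cd)
      have "integral {0..T} v \<le> integral {0..T} u"
        by (rule integral_le) (use gen_lower_bound cu cv in \<open>auto simp: u_def v_def g_def g1_def intro: integrable_continuous_real\<close>)
      moreover have "integral {0..T} u = U1 \<omega> - U2 \<omega>"
        by (simp add: U1_def U2_def dynkin_def u_def[abs_def])
      moreover have "integral {0..T} v = (\<Sum>n<N. integral {0 + real n * \<delta>..0 + real (Suc n) * \<delta>} v)"
        using integral_grid[of \<delta> 0 N v] cv \<delta> by (simp add: T_def)
      \<comment> \<open>On each sampling interval \<open>dV\<close> is frozen at the left endpoint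
        before Young's inequality is applied; the Lipschitz bound pays for the freezing.\<close>
      moreover have "(\<Sum>n<N. \<delta> * (c1 / 2 - Cq * (dV (X (real n * \<delta>) \<omega>))\<^sup>2) -
          Ca * Kv * integral {real n * \<delta>..real n * \<delta> + \<delta>} (\<lambda>r. \<bar>1 * (X r \<omega> - X (real n * \<delta>) \<omega>)\<bar>))
        \<le> (\<Sum>n<N. integral {0 + real n * \<delta>..0 + real (Suc n) * \<delta>} v)"
      proof (rule sum_mono)
        fix n assume n: "n \<in> {..<N}"
        define s where "s = real n * \<delta>"
        have s0: "0 \<le> s" using \<delta> by (simp add: s_def)
        have sT: "s + \<delta> \<le> T"
        proof -
          have "real (Suc n) * \<delta> \<le> real N * \<delta>" using n \<delta> by (intro mult_right_mono) auto
          then show ?thesis by (simp add: s_def T_def algebra_simps)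
        qed
        have sub: "{s..s + \<delta>} \<subseteq> {0..T}" using s0 sT by auto
        have cx: "continuous_on {s..s + \<delta>} (\<lambda>r. \<bar>1 * (X r \<omega> - X s \<omega>)\<bar>)"
          by (intro continuous_intros continuous_on_subset[OF cX sub])
        have i1: "(\<lambda>r. c1 - Ca * \<bar>dV (X s \<omega>)\<bar>) integrable_on {s..s + \<delta>}"
          by (rule integrable_continuous_real) (intro continuous_intros)
        have i2: "(\<lambda>r. Ca * Kv * \<bar>1 * (X r \<omega> - X s \<omega>)\<bar>) integrable_on {s..s + \<delta>}"
          by (rule integrable_continuous_real) (intro continuous_on_mult continuous_on_const cx)
        have "Ca * \<bar>dV (X s \<omega>)\<bar> \<le> c1 / 2 + Cq * (dV (X s \<omega>))\<^sup>2"
        proof -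
          have "\<bar>1 * (Ca * \<bar>dV (X s \<omega>)\<bar>)\<bar> \<le> (c1 * 1\<^sup>2 + (Ca * \<bar>dV (X s \<omega>)\<bar>)\<^sup>2 / c1) / 2"
            by (rule abs_mult_le_weighted_squares[OF c1_pos])
          then have "\<bar>Ca * \<bar>dV (X s \<omega>)\<bar>\<bar> \<le> c1 / 2 + Cq * (dV (X s \<omega>))\<^sup>2"
            by (simp add: Cq_def power_mult_distrib add_divide_distrib mult.commute)
          then show ?thesis by (rule order_trans[OF abs_ge_self])
        qed
        from mult_left_mono[OF this, of \<delta>]
        have "\<delta> * (c1 / 2 - Cq * (dV (X s \<omega>))\<^sup>2) \<le> \<delta> * (c1 - Ca * \<bar>dV (X s \<omega>)\<bar>)"
          using \<delta> by (simp add: algebra_simps)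
        also have "\<dots> = integral {s..s + \<delta>} (\<lambda>r. c1 - Ca * \<bar>dV (X s \<omega>)\<bar>)"
          using \<delta> by simp
        finally have "\<delta> * (c1 / 2 - Cq * (dV (X s \<omega>))\<^sup>2) - Ca * Kv * integral {s..s + \<delta>} (\<lambda>r. \<bar>1 * (X r \<omega> - X s \<omega>)\<bar>)
          \<le> integral {s..s + \<delta>} (\<lambda>r. c1 - Ca * \<bar>dV (X s \<omega>)\<bar>) - integral {s..s + \<delta>} (\<lambda>r. Ca * Kv * \<bar>1 * (X r \<omega> - X s \<omega>)\<bar>)"
          by (simp only: integral_mult_right)
        also have "\<dots> = integral {s..s + \<delta>} (\<lambda>r. (c1 - Ca * \<bar>dV (X s \<omega>)\<bar>) - Ca * Kv * \<bar>1 * (X r \<omega> - X s \<omega>)\<bar>)"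
          by (rule Henstock_Kurzweil_Integration.integral_diff[symmetric, OF i1 i2])
        also have "\<dots> \<le> integral {s..s + \<delta>} v"
        proof (rule integral_le)
          show "(\<lambda>r. (c1 - Ca * \<bar>dV (X s \<omega>)\<bar>) - Ca * Kv * \<bar>1 * (X r \<omega> - X s \<omega>)\<bar>) integrable_on {s..s + \<delta>}"
            by (rule integrable_diff[OF i1 i2])
          show "v integrable_on {s..s + \<delta>}"
            by (rule integrable_continuous_real[OF continuous_on_subset[OF cv sub]])
          fix r
          have "\<bar>dV (X r \<omega>)\<bar> \<le> \<bar>dV (X s \<omega>)\<bar> + Kv * \<bar>X r \<omega> - X s \<omega>\<bar>"
            using dV_Lipschitz[of "X r \<omega>" "X s \<omega>"] by linarith
          from mult_left_mono[OF this, of Ca]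
          show "(c1 - Ca * \<bar>dV (X s \<omega>)\<bar>) - Ca * Kv * \<bar>1 * (X r \<omega> - X s \<omega>)\<bar> \<le> v r"
            using C_pos(1) by (simp add: v_def distrib_left)
        qed
        finally show "\<delta> * (c1 / 2 - Cq * (dV (X (real n * \<delta>) \<omega>))\<^sup>2) -
          Ca * Kv * integral {real n * \<delta>..real n * \<delta> + \<delta>} (\<lambda>r. \<bar>1 * (X r \<omega> - X (real n * \<delta>) \<omega>)\<bar>)
          \<le> integral {0 + real n * \<delta>..0 + real (Suc n) * \<delta>} v"
          unfolding s_def by (simp add: algebra_simps)
      qed
      moreover have "(\<Sum>n<N. \<delta> * (c1 / 2 - Cq * (dV (X (real n * \<delta>) \<omega>))\<^sup>2) -
          Ca * Kv * integral {real n * \<delta>..real n * \<delta> + \<delta>} (\<lambda>r. \<bar>1 * (X r \<omega> - X (real n * \<delta>) \<omega>)\<bar>))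
          = T * (c1 / 2 - Cq * Qn N \<delta> \<omega>) - Ca * Kv * U3 \<omega>"
      proof -
        have "(\<Sum>n<N. \<delta> * (c1 / 2 - Cq * (dV (X (real n * \<delta>) \<omega>))\<^sup>2)) = \<delta> * (real N * (c1 / 2) - Cq * (\<Sum>n<N. (dV (X (real n * \<delta>) \<omega>))\<^sup>2))"
          by (simp add: sum_subtractf flip: sum_distrib_left)
        also have "\<dots> = T * (c1 / 2 - Cq * Qn N \<delta> \<omega>)"
          using N by (simp add: T_def Qn_def field_simps)
        finally show ?thesis by (simp add: sum_subtractf U3_def flip: sum_distrib_left)
      qed
      ultimately have "T * (c1 / 2 - Cq * Qn N \<delta> \<omega>) \<le> U1 \<omega> - U2 \<omega> + Ca * Kv * U3 \<omega>" by linarith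
      also have "\<dots> \<le> \<bar>U1 \<omega>\<bar> + \<bar>U2 \<omega>\<bar> + Ca * Kv * \<bar>U3 \<omega>\<bar>"
      proof -
        have "Ca * Kv * U3 \<omega> \<le> Ca * Kv * \<bar>U3 \<omega>\<bar>" using C_pos(1) Kv by (intro mult_left_mono) auto
        then show ?thesis using abs_ge_self[of "U1 \<omega>"] abs_ge_minus_self[of "U2 \<omega>"] by linarith
      qed
      finally have "(c1 / 2 - Cq * Qn N \<delta> \<omega>) * T \<le> \<bar>U1 \<omega>\<bar> + \<bar>U2 \<omega>\<bar> + Ca * Kv * \<bar>U3 \<omega>\<bar>"
        by (simp only: mult.commute)
      then have "c1 / 2 - Cq * Qn N \<delta> \<omega> \<le> (\<bar>U1 \<omega>\<bar> + \<bar>U2 \<omega>\<bar> + Ca * Kv * \<bar>U3 \<omega>\<bar>) / T"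
        by (simp only: pos_le_divide_eq[OF T])
      then have le: "c1 / 2 - Cq * Qn N \<delta> \<omega> \<le> (1 / T) * \<bar>U1 \<omega>\<bar> + (1 / T) * \<bar>U2 \<omega>\<bar> + (Ca * Kv / T) * \<bar>U3 \<omega>\<bar>"
        by (simp add: add_divide_distrib)
      have "0 \<le> (1 / T) * \<bar>U1 \<omega>\<bar> + (1 / T) * \<bar>U2 \<omega>\<bar> + (Ca * Kv / T) * \<bar>U3 \<omega>\<bar>"
        using T C_pos(1) Kv by simp
      then show ?case using le by simp
    qed
  qed (use T C_pos(1) Kv in simp)
qed

lemma numerator_error:
  assumes N: "0 < N" and \<delta>: "0 < \<delta>" "\<delta> \<le> 1"
  shows "L1_bound M (\<lambda>\<omega>. Pn N \<delta> \<omega> - \<alpha> * Kh * Qn N \<delta> \<omega>)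
    (cc * S1 * sqrt (2 * (real N * \<delta>)) * V2 / (real N * \<delta>) + \<alpha> * S1 * Kv * V2 * incr_rate \<epsilon> \<delta>
      + (\<epsilon> / \<delta>) * (\<alpha> * C\<chi> + 2 * CH * V2))"
proof -
  define T where "T = real N * \<delta>"
  have T: "0 < T" using N \<delta> by (simp add: T_def)
  define s where "s n = real n * \<delta>" for n
  have s0: "0 \<le> s n" for n using \<delta> by (simp add: s_def)
  have sS: "s (Suc n) = s n + \<delta>" for n by (simp add: s_def algebra_simps)
  define v where "v n \<omega> = dV (X (s n) \<omega>)" for n \<omega>
  have vF: "v n \<in> borel_measurable (F (s n))" for n unfolding v_def by (rule dV_X_adapted[OF s0])
  have v2: "L1_bound M (\<lambda>\<omega>. (v n \<omega>)\<^sup>2) (V2\<^sup>2)" for n unfolding v_def by (rule L1_bound_dV2[OF s0])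
  define E1 where "E1 \<omega> = (\<Sum>n<N. v n \<omega> * dynS (s n) (s (Suc n)) \<omega>)" for \<omega>
  define E2 where "E2 \<omega> = (\<Sum>n<N. integral {s n..s n + \<delta>} (\<lambda>r. \<bar>v n \<omega> * (X r \<omega> - X (s n) \<omega>)\<bar>))" for \<omega>
  define E3 where "E3 \<omega> = (\<Sum>n<N. (v n \<omega>)\<^sup>2 * integral {s n..s n + \<delta>} (\<lambda>r. q (X r \<omega> / \<epsilon>) - Kh))" for \<omega>
  define E4 where "E4 \<omega> = (\<Sum>n<N. \<bar>v n \<omega>\<bar>)" for \<omega>
  have L1: "L1_bound M E1 (cc * S1 * sqrt (2 * T) * V2)"
  proof -
    have "L1_bound M (\<lambda>\<omega>. \<Sum>n<N. v n \<omega> * dynS (0 + real n * \<delta>) (0 + real (Suc n) * \<delta>) \<omega>)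
      (cc * S1 * sqrt (2 * real N * \<delta> * V2\<^sup>2))"
      by (rule L1_bound_dynkin_sum[OF S_test_fn]) (use q_abs \<delta> vF v2 in \<open>simp_all add: s_def\<close>)
    moreover have "sqrt (2 * real N * \<delta> * V2\<^sup>2) = sqrt (2 * T) * V2"
      using V_pos(1) by (simp add: T_def real_sqrt_mult)
    ultimately show ?thesis unfolding E1_def s_def by (simp add: mult.assoc)
  qed
  have "L1_bound M E2 (\<Sum>n<N. \<delta> * (V2 * incr_rate \<epsilon> \<delta>))"
    unfolding E2_def by (intro L1_bound_sum L1_bound_block_increment s0 \<delta> vF v2 V_pos)
  then have L2: "L1_bound M E2 (T * (V2 * incr_rate \<epsilon> \<delta>))" by (simp add: T_def mult.assoc)
  have "L1_bound M E3 (\<Sum>n<N. \<epsilon> * C\<chi>)"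
    unfolding E3_def v_def by (intro L1_bound_sum L1_bound_corrector s0) (use \<delta> in auto)
  then have L3: "L1_bound M E3 (real N * (\<epsilon> * C\<chi>))" by simp
  have "L1_bound M E4 (\<Sum>n<N. V2)"
    unfolding E4_def
    by (intro L1_bound_sum L1_bound_abs_iff[THEN iffD2] L1_bound_of_square[OF v2 V_pos(1)])
  then have L4: "L1_bound M E4 (real N * V2)" by simp
  have L: "L1_bound M (\<lambda>\<omega>. (1 / T) * \<bar>E1 \<omega>\<bar> + (\<alpha> * S1 * Kv / T) * \<bar>E2 \<omega>\<bar> + (\<alpha> / T) * \<bar>E3 \<omega>\<bar> + (2 * (\<epsilon> * CH) / T) * \<bar>E4 \<omega>\<bar>)
    (\<bar>1 / T\<bar> * (cc * S1 * sqrt (2 * T) * V2) + \<bar>\<alpha> * S1 * Kv / T\<bar> * (T * (V2 * incr_rate \<epsilon> \<delta>))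
      + \<bar>\<alpha> / T\<bar> * (real N * (\<epsilon> * C\<chi>)) + \<bar>2 * (\<epsilon> * CH) / T\<bar> * (real N * V2))"
    by (intro L1_bound_add L1_bound_cmult L1_bound_abs_iff[THEN iffD2] L1 L2 L3 L4)
  have coef: "0 \<le> 1 / T" "0 \<le> \<alpha> * S1 * Kv / T" "0 \<le> \<alpha> / T" "0 \<le> 2 * (\<epsilon> * CH) / T"
    using T alpha cell_constants Kv eps by auto
  have NT: "real N / T = 1 / \<delta>" using N by (simp add: T_def)
  have bd: "\<bar>1 / T\<bar> * (cc * S1 * sqrt (2 * T) * V2) + \<bar>\<alpha> * S1 * Kv / T\<bar> * (T * (V2 * incr_rate \<epsilon> \<delta>))
      + \<bar>\<alpha> / T\<bar> * (real N * (\<epsilon> * C\<chi>)) + \<bar>2 * (\<epsilon> * CH) / T\<bar> * (real N * V2)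
    = cc * S1 * sqrt (2 * T) * V2 / T + \<alpha> * S1 * Kv * V2 * incr_rate \<epsilon> \<delta> + (\<epsilon> / \<delta>) * (\<alpha> * C\<chi> + 2 * CH * V2)"
  proof -
    have "\<alpha> / T * (real N * (\<epsilon> * C\<chi>)) = (real N / T) * (\<epsilon> * (\<alpha> * C\<chi>))"
      "2 * (\<epsilon> * CH) / T * (real N * V2) = (real N / T) * (\<epsilon> * (2 * CH * V2))" by (simp_all add: mult_ac)
    then show ?thesis unfolding abs_of_nonneg[OF coef(1)] abs_of_nonneg[OF coef(2)] abs_of_nonneg[OF coef(3)] abs_of_nonneg[OF coef(4)] NT
      using T by (simp add: distrib_left mult_ac)
  qed
  show ?thesis unfolding T_def[symmetric] bd[symmetric]
  proof (rule L1_bound_mono[OF L _ order_refl])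
    show "AE \<omega> in M. \<bar>Pn N \<delta> \<omega> - \<alpha> * Kh * Qn N \<delta> \<omega>\<bar> \<le>
      \<bar>(1 / T) * \<bar>E1 \<omega>\<bar> + (\<alpha> * S1 * Kv / T) * \<bar>E2 \<omega>\<bar> + (\<alpha> / T) * \<bar>E3 \<omega>\<bar> + (2 * (\<epsilon> * CH) / T) * \<bar>E4 \<omega>\<bar>\<bar>"
      using continuous_path_comp[OF continuous_on_id order_refl, of T]
    proof eventually_elim
      case (elim \<omega>)
      have cX: "continuous_on {0..T} (\<lambda>r. X r \<omega>)" using elim by simp
      define D where "D n = integral {s n..s n + \<delta>} (\<lambda>r. v n \<omega> * (q (X r \<omega> / \<epsilon>) * (dV (X r \<omega>) - v n \<omega>)))" for n
      \<comment> \<open>The corrector at a sample. Its differences carry the weights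
        \<open>v n\<close>, so the sum does not telescope and each sample pays
        \<open>2 * (\<epsilon> * CH)\<close>.\<close>
      define e where "e n = S (X (s n) \<omega>) - X (s n) \<omega>" for n
      have block: "- (v n \<omega> * (X (s (Suc n)) \<omega> - X (s n) \<omega>)) - \<alpha> * Kh * (\<delta> * (v n \<omega>)\<^sup>2) =
          - (v n \<omega> * dynS (s n) (s (Suc n)) \<omega>) + \<alpha> * D n
          + \<alpha> * ((v n \<omega>)\<^sup>2 * integral {s n..s n + \<delta>} (\<lambda>r. q (X r \<omega> / \<epsilon>) - Kh))
          + v n \<omega> * (e (Suc n) - e n)"
        and D: "\<bar>D n\<bar> \<le> S1 * Kv * integral {s n..s n + \<delta>} (\<lambda>r. \<bar>v n \<omega> * (X r \<omega> - X (s n) \<omega>)\<bar>)" if n: "n < N" for n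
      proof -
        have sT: "s n + \<delta> \<le> T"
        proof -
          have "real (Suc n) * \<delta> \<le> real N * \<delta>" using n \<delta> by (intro mult_right_mono) auto
          then show ?thesis by (simp add: s_def T_def algebra_simps)
        qed
        have sub: "{s n..s n + \<delta>} \<subseteq> {0..T}" using s0[of n] sT by auto
        note cX' = continuous_on_subset[OF cX sub]
        have cd: "continuous_on {s n..s n + \<delta>} (\<lambda>r. dV (X r \<omega>))"
          by (rule continuous_on_compose2[OF dV_continuous cX']) auto
        have cq: "continuous_on {s n..s n + \<delta>} (\<lambda>r. q (X r \<omega> / \<epsilon>))"
          by (rule continuous_on_compose2[OF q_scale_continuous cX']) auto
        have i1: "(\<lambda>r. v n \<omega> * (q (X r \<omega> / \<epsilon>) * (dV (X r \<omega>) - v n \<omega>))) integrable_on {s n..s n + \<delta>}"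
          "(\<lambda>r. (v n \<omega>)\<^sup>2 * (q (X r \<omega> / \<epsilon>) - Kh)) integrable_on {s n..s n + \<delta>}"
          "(\<lambda>r. (v n \<omega>)\<^sup>2 * Kh) integrable_on {s n..s n + \<delta>}"
          by (rule integrable_continuous_real, intro continuous_intros cd cq)+
        have "v n \<omega> * integral {s n..s n + \<delta>} (\<lambda>r. q (X r \<omega> / \<epsilon>) * dV (X r \<omega>))
          = integral {s n..s n + \<delta>} (\<lambda>r. v n \<omega> * (q (X r \<omega> / \<epsilon>) * (dV (X r \<omega>) - v n \<omega>)) + (v n \<omega>)\<^sup>2 * (q (X r \<omega> / \<epsilon>) - Kh) + (v n \<omega>)\<^sup>2 * Kh)"
          unfolding integral_mult_right[symmetric]
          by (rule Henstock_Kurzweil_Integration.integral_cong) (simp add: algebra_simps power2_eq_square)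
        also have "\<dots> = integral {s n..s n + \<delta>} (\<lambda>r. v n \<omega> * (q (X r \<omega> / \<epsilon>) * (dV (X r \<omega>) - v n \<omega>)) + (v n \<omega>)\<^sup>2 * (q (X r \<omega> / \<epsilon>) - Kh))
          + integral {s n..s n + \<delta>} (\<lambda>r. (v n \<omega>)\<^sup>2 * Kh)"
          by (rule Henstock_Kurzweil_Integration.integral_add[OF integrable_add[OF i1(1,2)] i1(3)])
        also have "\<dots> = D n + (v n \<omega>)\<^sup>2 * integral {s n..s n + \<delta>} (\<lambda>r. q (X r \<omega> / \<epsilon>) - Kh) + \<delta> * ((v n \<omega>)\<^sup>2 * Kh)"
          unfolding D_def Henstock_Kurzweil_Integration.integral_add[OF i1(1,2)] integral_mult_right using \<delta> by simp
        finally have A: "v n \<omega> * integral {s n..s n + \<delta>} (\<lambda>r. q (X r \<omega> / \<epsilon>) * dV (X r \<omega>)) =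
          D n + (v n \<omega>)\<^sup>2 * integral {s n..s n + \<delta>} (\<lambda>r. q (X r \<omega> / \<epsilon>) - Kh) + \<delta> * ((v n \<omega>)\<^sup>2 * Kh)" .
        have "X (s (Suc n)) \<omega> - X (s n) \<omega> = dynS (s n) (s (Suc n)) \<omega>
          + - \<alpha> * integral {s n..s n + \<delta>} (\<lambda>r. q (X r \<omega> / \<epsilon>) * dV (X r \<omega>)) - (e (Suc n) - e n)"
          unfolding dynkin_def gen_S sS[symmetric] integral_mult_right by (simp add: e_def)
        moreover have "- (vv * (dd + - \<alpha> * ii - ee)) = - (vv * dd) + \<alpha> * (vv * ii) + vv * ee" for vv dd ii ee :: real
          by (simp add: algebra_simps)
        ultimately have "- (v n \<omega> * (X (s (Suc n)) \<omega> - X (s n) \<omega>)) = - (v n \<omega> * dynS (s n) (s (Suc n)) \<omega>)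
          + \<alpha> * (v n \<omega> * integral {s n..s n + \<delta>} (\<lambda>r. q (X r \<omega> / \<epsilon>) * dV (X r \<omega>))) + v n \<omega> * (e (Suc n) - e n)"
          by (simp only:)
        then show "- (v n \<omega> * (X (s (Suc n)) \<omega> - X (s n) \<omega>)) - \<alpha> * Kh * (\<delta> * (v n \<omega>)\<^sup>2) =
          - (v n \<omega> * dynS (s n) (s (Suc n)) \<omega>) + \<alpha> * D n
          + \<alpha> * ((v n \<omega>)\<^sup>2 * integral {s n..s n + \<delta>} (\<lambda>r. q (X r \<omega> / \<epsilon>) - Kh))
          + v n \<omega> * (e (Suc n) - e n)" unfolding A by (simp add: algebra_simps)
        have "norm (D n) \<le> integral {s n..s n + \<delta>} (\<lambda>r. S1 * Kv * \<bar>v n \<omega> * (X r \<omega> - X (s n) \<omega>)\<bar>)"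
          unfolding D_def
        proof (rule integral_norm_bound_integral[OF i1(1)])
          show "(\<lambda>r. S1 * Kv * \<bar>v n \<omega> * (X r \<omega> - X (s n) \<omega>)\<bar>) integrable_on {s n..s n + \<delta>}"
            by (rule integrable_continuous_real) (intro continuous_intros cX')
          fix r
          have "\<bar>q (X r \<omega> / \<epsilon>)\<bar> * \<bar>dV (X r \<omega>) - v n \<omega>\<bar> \<le> S1 * (Kv * \<bar>X r \<omega> - X (s n) \<omega>\<bar>)"
            unfolding v_def using q_abs dV_Lipschitz cell_constants(1) by (intro mult_mono) auto
          from mult_left_mono[OF this, of "\<bar>v n \<omega>\<bar>"]
          show "norm (v n \<omega> * (q (X r \<omega> / \<epsilon>) * (dV (X r \<omega>) - v n \<omega>))) \<le> S1 * Kv * \<bar>v n \<omega> * (X r \<omega> - X (s n) \<omega>)\<bar>"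
            by (simp add: abs_mult mult_ac)
        qed
        then show "\<bar>D n\<bar> \<le> S1 * Kv * integral {s n..s n + \<delta>} (\<lambda>r. \<bar>v n \<omega> * (X r \<omega> - X (s n) \<omega>)\<bar>)"
          unfolding integral_mult_right by simp
      qed
      define SD where "SD = (\<Sum>n<N. D n)"
      define SE where "SE = (\<Sum>n<N. v n \<omega> * (e (Suc n) - e n))"
      have "Pn N \<delta> \<omega> - \<alpha> * Kh * Qn N \<delta> \<omega> = (1 / T) * (\<Sum>n<N. - (v n \<omega> * (X (s (Suc n)) \<omega> - X (s n) \<omega>)) - \<alpha> * Kh * (\<delta> * (v n \<omega>)\<^sup>2))"
      proof -
        have "\<alpha> * Kh * Qn N \<delta> \<omega> = (1 / T) * (\<Sum>n<N. \<alpha> * Kh * (\<delta> * (v n \<omega>)\<^sup>2))"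
          using \<delta> N unfolding Qn_def T_def v_def s_def by (simp flip: sum_distrib_left)
        moreover have "Pn N \<delta> \<omega> = (1 / T) * (\<Sum>n<N. - (v n \<omega> * (X (s (Suc n)) \<omega> - X (s n) \<omega>)))"
          unfolding Pn_def T_def v_def s_def by (simp add: sum_negf)
        ultimately show ?thesis by (simp only: sum_subtractf right_diff_distrib)
      qed
      also have "(\<Sum>n<N. - (v n \<omega> * (X (s (Suc n)) \<omega> - X (s n) \<omega>)) - \<alpha> * Kh * (\<delta> * (v n \<omega>)\<^sup>2))
        = (\<Sum>n<N. - (v n \<omega> * dynS (s n) (s (Suc n)) \<omega>) + \<alpha> * D n
          + \<alpha> * ((v n \<omega>)\<^sup>2 * integral {s n..s n + \<delta>} (\<lambda>r. q (X r \<omega> / \<epsilon>) - Kh))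
          + v n \<omega> * (e (Suc n) - e n))"
        by (rule sum.cong[OF refl]) (use block in simp)
      also have "\<dots> = - E1 \<omega> + \<alpha> * SD + \<alpha> * E3 \<omega> + SE"
        unfolding E1_def E3_def SD_def SE_def sum.distrib sum_negf sum_distrib_left ..
      finally have eq: "Pn N \<delta> \<omega> - \<alpha> * Kh * Qn N \<delta> \<omega> = (1 / T) * (- E1 \<omega> + \<alpha> * SD + \<alpha> * E3 \<omega> + SE)" .
      have bSD: "\<bar>SD\<bar> \<le> S1 * Kv * \<bar>E2 \<omega>\<bar>"
      proof -
        have "\<bar>SD\<bar> \<le> (\<Sum>n<N. S1 * Kv * integral {s n..s n + \<delta>} (\<lambda>r. \<bar>v n \<omega> * (X r \<omega> - X (s n) \<omega>)\<bar>))"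
          unfolding SD_def by (rule order_trans[OF sum_abs sum_mono]) (use D in simp)
        also have "\<dots> = S1 * Kv * E2 \<omega>" by (simp add: E2_def sum_distrib_left)
        also have "\<dots> \<le> S1 * Kv * \<bar>E2 \<omega>\<bar>" using cell_constants(1) Kv by (intro mult_left_mono) auto
        finally show ?thesis .
      qed
      have bSE: "\<bar>SE\<bar> \<le> 2 * (\<epsilon> * CH) * \<bar>E4 \<omega>\<bar>"
      proof -
        have "\<bar>SE\<bar> \<le> (\<Sum>n<N. 2 * (\<epsilon> * CH) * \<bar>v n \<omega>\<bar>)"
          unfolding SE_def
        proof (rule order_trans[OF sum_abs sum_mono])
          fix n
          show "\<bar>v n \<omega> * (e (Suc n) - e n)\<bar> \<le> 2 * (\<epsilon> * CH) * \<bar>v n \<omega>\<bar>"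
            using mult_left_mono[OF S_dist_increment[of "X (s (Suc n)) \<omega>" "X (s n) \<omega>"], of "\<bar>v n \<omega>\<bar>"]
            unfolding abs_mult e_def by (simp only: abs_ge_zero mult.commute)
        qed
        also have "\<dots> = 2 * (\<epsilon> * CH) * E4 \<omega>" by (simp add: E4_def sum_distrib_left)
        also have "\<dots> \<le> 2 * (\<epsilon> * CH) * \<bar>E4 \<omega>\<bar>" using eps cell_constants(2) by (intro mult_left_mono) auto
        finally show ?thesis .
      qed
      have "\<bar>- E1 \<omega> + \<alpha> * SD + \<alpha> * E3 \<omega> + SE\<bar> \<le> \<bar>E1 \<omega>\<bar> + \<alpha> * (S1 * Kv * \<bar>E2 \<omega>\<bar>) + \<alpha> * \<bar>E3 \<omega>\<bar> + 2 * (\<epsilon> * CH) * \<bar>E4 \<omega>\<bar>"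
      proof (rule abs_sum4_le)
        show "\<bar>\<alpha> * SD\<bar> \<le> \<alpha> * (S1 * Kv * \<bar>E2 \<omega>\<bar>)" using mult_left_mono[OF bSD, of \<alpha>] alpha by (simp add: abs_mult)
        show "\<bar>\<alpha> * E3 \<omega>\<bar> \<le> \<alpha> * \<bar>E3 \<omega>\<bar>" using alpha by (simp add: abs_mult)
        show "\<bar>SE\<bar> \<le> 2 * (\<epsilon> * CH) * \<bar>E4 \<omega>\<bar>" by (rule bSE)
      qed simp
      from mult_left_mono[OF this coef(1)]
      have "\<bar>Pn N \<delta> \<omega> - \<alpha> * Kh * Qn N \<delta> \<omega>\<bar> \<le> (1 / T) * \<bar>E1 \<omega>\<bar> + (\<alpha> * S1 * Kv / T) * \<bar>E2 \<omega>\<bar> + (\<alpha> / T) * \<bar>E3 \<omega>\<bar> + (2 * (\<epsilon> * CH) / T) * \<bar>E4 \<omega>\<bar>"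
        unfolding eq abs_mult abs_of_nonneg[OF coef(1)] by (simp add: distrib_left mult.assoc add_divide_distrib)
      then show "\<bar>Pn N \<delta> \<omega> - \<alpha> * Kh * Qn N \<delta> \<omega>\<bar> \<le>
        \<bar>(1 / T) * \<bar>E1 \<omega>\<bar> + (\<alpha> * S1 * Kv / T) * \<bar>E2 \<omega>\<bar> + (\<alpha> / T) * \<bar>E3 \<omega>\<bar> + (2 * (\<epsilon> * CH) / T) * \<bar>E4 \<omega>\<bar>\<bar>"
        by (rule order_trans[OF _ abs_ge_self])
    qed
  qed
qed

end

section \<open>Convergence of the estimator\<close>

text \<open>The limit is a point mass, so convergence in probability suffices: near \<open>A\<close>
  continuity of the test function controls it, and elsewhere its bound times a vanishing
  probability. The probability space may change with the index.\<close>

lemma converges_in_law_const: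
  fixes A :: real
  assumes prob: "eventually (\<lambda>i. prob_space (M i)) F"
    and meas: "eventually (\<lambda>i. U i \<in> borel_measurable (M i)) F"
    and lim: "\<And>\<eta>. 0 < \<eta> \<Longrightarrow> ((\<lambda>i. measure (M i) {\<omega>\<in>space (M i). \<eta> < \<bar>U i \<omega> - A\<bar>}) \<longlongrightarrow> 0) F"
  shows "converges_in_law (\<lambda>i. distr (M i) borel (U i)) (return borel A) F"
  unfolding converges_in_law_def
proof (intro allI impI)
  fix f :: "real \<Rightarrow> real" assume f: "continuous_on UNIV f \<and> bounded (range f)"
  then have fm [measurable]: "f \<in> borel_measurable borel" by (auto intro: borel_measurable_continuous_onI)
  obtain C where C: "0 < C" "\<And>x. \<bar>f x\<bar> \<le> C" using f by (auto simp: bounded_pos)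
  have ret: "integral\<^sup>L (return borel A) f = f A" by (rule integral_return) auto
  show "((\<lambda>i. integral\<^sup>L (distr (M i) borel (U i)) f) \<longlongrightarrow> integral\<^sup>L (return borel A) f) F"
    unfolding ret
  proof (rule tendstoI)
    fix e :: real assume e: "0 < e"
    have "isCont f A" using f by (simp add: continuous_on_eq_continuous_at)
    then obtain \<eta>' where \<eta>': "0 < \<eta>'" "\<And>y. dist y A < \<eta>' \<Longrightarrow> dist (f y) (f A) < e / 2"
      unfolding continuous_at_eps_delta using e by (metis half_gt_zero)
    define \<eta> where "\<eta> = \<eta>' / 2"
    have \<eta>: "0 < \<eta>" "\<And>y. \<bar>y - A\<bar> \<le> \<eta> \<Longrightarrow> \<bar>f y - f A\<bar> \<le> e / 2"
      using \<eta>' by (auto simp: \<eta>_def dist_real_def intro!: less_imp_le)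
    have "eventually (\<lambda>i. measure (M i) {\<omega>\<in>space (M i). \<eta> < \<bar>U i \<omega> - A\<bar>} < e / (4 * C)) F"
      using lim[OF \<eta>(1)] e C(1) by (intro order_tendstoD) auto
    with prob meas show "eventually (\<lambda>i. dist (integral\<^sup>L (distr (M i) borel (U i)) f) (f A) < e) F"
    proof eventually_elim
      case (elim i)
      interpret prob_space "M i" by (rule elim(1))
      have [measurable]: "U i \<in> borel_measurable (M i)" by (rule elim(2))
      define B where "B = {\<omega>\<in>space (M i). \<eta> < \<bar>U i \<omega> - A\<bar>}"
      have B [measurable]: "B \<in> sets (M i)" unfolding B_def by measurable
      have i1: "integrable (M i) (\<lambda>\<omega>. f (U i \<omega>))"
        by (rule integrable_const_bound[where B = C]) (use C(2) in auto)
      have i2: "integrable (M i) (\<lambda>\<omega>. e / 2 + 2 * C * indicator B \<omega>)"         by (intro Bochner_Integration.integrable_add integrable_const Bochner_Integration.integrable_mult_right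
            integrable_real_indicator B) (simp add: emeasure_eq_measure)
      have "integral\<^sup>L (distr (M i) borel (U i)) f - f A = (\<integral>\<omega>. f (U i \<omega>) - f A \<partial>M i)"
        using i1 by (simp add: integral_distr prob_space)
      also have "\<bar>\<dots>\<bar> \<le> (\<integral>\<omega>. \<bar>f (U i \<omega>) - f A\<bar> \<partial>M i)" by (rule integral_abs_bound)
      also have "\<dots> \<le> (\<integral>\<omega>. e / 2 + 2 * C * indicator B \<omega> \<partial>M i)"
      proof (rule integral_mono[OF _ i2])
        show "integrable (M i) (\<lambda>\<omega>. \<bar>f (U i \<omega>) - f A\<bar>)" using i1 by auto
        fix \<omega> assume "\<omega> \<in> space (M i)"
        show "\<bar>f (U i \<omega>) - f A\<bar> \<le> e / 2 + 2 * C * indicator B \<omega>"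
        proof (cases "\<omega> \<in> B")
          case True
          have "\<bar>f (U i \<omega>) - f A\<bar> \<le> \<bar>f (U i \<omega>)\<bar> + \<bar>f A\<bar>" by (rule abs_triangle_ineq4)
          then show ?thesis using True C(2)[of "U i \<omega>"] C(2)[of A] e by simp
        next
          case False
          then have "\<bar>U i \<omega> - A\<bar> \<le> \<eta>" using \<open>\<omega> \<in> space (M i)\<close> by (auto simp: B_def)
          then show ?thesis using \<eta>(2) False by simp
        qed
      qed
      also have "\<dots> = e / 2 + 2 * C * measure (M i) B"
        by (subst Bochner_Integration.integral_add) (auto simp: prob_space emeasure_eq_measure)
      also have "\<dots> < e"
      proof -
        have "2 * C * measure (M i) B < 2 * C * (e / (4 * C))"
          using elim(3) C(1) unfolding B_def by (intro mult_strict_left_mono) auto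
        also have "\<dots> = e / 2" using C(1) by simp
        finally show ?thesis by simp
      qed
      finally show ?case by (simp add: dist_real_def)
    qed
  qed
qed

context cell_problem
begin

text \<open>\<open>\<tau>\<close> stands for the reciprocal observation time
  \<open>1 / (N * \<delta>)\<close>, so that the whole rate visibly tends to 0 with
  \<open>\<epsilon>\<close>, \<open>\<delta>\<close>, \<open>\<tau>\<close> and
  \<open>\<epsilon> / \<delta>\<close>.\<close>

definition num_rate :: "real \<Rightarrow> real \<Rightarrow> real \<Rightarrow> real" where
  "num_rate \<epsilon> \<delta> \<tau> = sqrt (2 * \<sigma>) * S1 * V2 * sqrt (2 * \<tau>) + \<alpha> * S1 * Kv * V2 * incr_rate \<epsilon> \<delta>
      + (\<epsilon> / \<delta>) * (\<alpha> * C\<chi> + 2 * CH * V2)"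

definition den_rate :: "real \<Rightarrow> real \<Rightarrow> real \<Rightarrow> real" where
  "den_rate \<epsilon> \<delta> \<tau> = S1 * (2 * X2) * \<tau> + sqrt (2 * \<sigma>) * S1 * sqrt (2 * \<tau>) + Ca * Kv * incr_rate \<epsilon> \<delta>"

lemma rates_tendsto_0:
  assumes "(\<epsilon> \<longlongrightarrow> 0) F" "(\<delta> \<longlongrightarrow> 0) F" "(\<tau> \<longlongrightarrow> 0) F" "((\<lambda>i. \<epsilon> i / \<delta> i) \<longlongrightarrow> 0) F"
  shows "((\<lambda>i. num_rate (\<epsilon> i) (\<delta> i) (\<tau> i)) \<longlongrightarrow> 0) F" "((\<lambda>i. den_rate (\<epsilon> i) (\<delta> i) (\<tau> i)) \<longlongrightarrow> 0) F"
proof -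
  have "((\<lambda>i. incr_rate (\<epsilon> i) (\<delta> i)) \<longlongrightarrow> 2 * (0 * CH) + sqrt (2 * \<sigma>) * S1 * sqrt (2 * 0) + 0 * (\<alpha> * S1 * V2)) F"
    unfolding incr_rate_def by (intro tendsto_intros assms)
  then have inc: "((\<lambda>i. incr_rate (\<epsilon> i) (\<delta> i)) \<longlongrightarrow> 0) F" by simp
  have "((\<lambda>i. num_rate (\<epsilon> i) (\<delta> i) (\<tau> i)) \<longlongrightarrow> sqrt (2 * \<sigma>) * S1 * V2 * sqrt (2 * 0) + \<alpha> * S1 * Kv * V2 * 0
      + 0 * (\<alpha> * C\<chi> + 2 * CH * V2)) F"
    unfolding num_rate_def by (intro tendsto_intros assms inc)
  then show "((\<lambda>i. num_rate (\<epsilon> i) (\<delta> i) (\<tau> i)) \<longlongrightarrow> 0) F" by simp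
  have "((\<lambda>i. den_rate (\<epsilon> i) (\<delta> i) (\<tau> i)) \<longlongrightarrow> S1 * (2 * X2) * 0 + sqrt (2 * \<sigma>) * S1 * sqrt (2 * 0) + Ca * Kv * 0) F"
    unfolding den_rate_def by (intro tendsto_intros assms inc)
  then show "((\<lambda>i. den_rate (\<epsilon> i) (\<delta> i) (\<tau> i)) \<longlongrightarrow> 0) F" by simp
qed

end

context multiscale_sde
begin

lemma drift_estimator_eq:
  assumes "0 < N" "0 < \<delta>" "\<And>t. 0 \<le> t \<Longrightarrow> x t = X t \<omega>"
  shows "drift_estimator dV \<delta> N x = Pn N \<delta> \<omega> / Qn N \<delta> \<omega>"
proof -
  have x: "x (real n * \<delta>) = X (real n * \<delta>) \<omega>" for n using assms by simp
  have "(\<Sum>n<N. (dV (X (real n * \<delta>) \<omega>))\<^sup>2 * \<delta>) = \<delta> * (\<Sum>n<N. (dV (X (real n * \<delta>) \<omega>))\<^sup>2)"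
    by (subst mult.commute[of \<delta>]) (rule sum_distrib_right[symmetric])
  then show ?thesis unfolding drift_estimator_def x Pn_def Qn_def using assms(1,2) by simp
qed

text \<open>If the denominator exceeds \<open>c1 / (4 * Cq)\<close>, a deviation of the quotient by
  \<open>\<eta>\<close> forces a numerator error of at least \<open>\<eta>\<close> times this
  threshold. The exceptional set is thus covered by two events, each bounded by Markov's
  inequality.\<close>

lemma estimator_deviation:
  assumes N: "0 < N" and \<delta>: "0 < \<delta>" "\<delta> \<le> 1" and \<eta>: "0 < \<eta>"
  shows "prob {\<omega>\<in>space M. \<eta> < \<bar>Pn N \<delta> \<omega> / Qn N \<delta> \<omega> - \<alpha> * Kh\<bar>}
    \<le> den_rate \<epsilon> \<delta> (1 / (real N * \<delta>)) / (c1 / 4) + num_rate \<epsilon> \<delta> (1 / (real N * \<delta>)) / (\<eta> * (c1 / (4 * Cq)))"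
proof -
  define T where "T = real N * \<delta>"
  have T: "0 < T" using N \<delta> by (simp add: T_def)
  have sq: "sqrt (2 * T) / T = sqrt (2 * (1 / T))"
  proof -
    have "sqrt (2 * T) / T = sqrt (2 * T) / sqrt (T\<^sup>2)" using T by simp
    also have "\<dots> = sqrt ((2 * T) / T\<^sup>2)" by (rule real_sqrt_divide[symmetric])
    also have "(2 * T) / T\<^sup>2 = 2 * (1 / T)" using T by (simp add: power2_eq_square)
    finally show ?thesis .
  qed
  have den: "L1_bound M (\<lambda>\<omega>. max 0 (c1 / 2 - Cq * Qn N \<delta> \<omega>)) (den_rate \<epsilon> \<delta> (1 / T))"
    using denominator_lower_bound[OF N \<delta>(1)] unfolding T_def[symmetric] den_rate_def sq[symmetric]
    by (simp add: add_divide_distrib)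
  have num: "L1_bound M (\<lambda>\<omega>. Pn N \<delta> \<omega> - \<alpha> * Kh * Qn N \<delta> \<omega>) (num_rate \<epsilon> \<delta> (1 / T))"
    using numerator_error[OF N \<delta>] unfolding T_def[symmetric] num_rate_def sq[symmetric]
    by (simp add: mult_ac)
  have mX [measurable]: "X (real n * \<delta>) \<in> borel_measurable M" "X (real (Suc n) * \<delta>) \<in> borel_measurable M" for n
    using \<delta> by (auto intro!: X_measurable mult_nonneg_nonneg simp del: of_nat_Suc)
  have [measurable]: "Qn N \<delta> \<in> borel_measurable M" "Pn N \<delta> \<in> borel_measurable M"
    unfolding Qn_def[abs_def] Pn_def[abs_def] by measurable
  define E1 where "E1 = {\<omega>\<in>space M. c1 / 4 \<le> c1 / 2 - Cq * Qn N \<delta> \<omega>}"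
  define E2 where "E2 = {\<omega>\<in>space M. \<eta> * (c1 / (4 * Cq)) \<le> \<bar>Pn N \<delta> \<omega> - \<alpha> * Kh * Qn N \<delta> \<omega>\<bar>}"
  have [measurable]: "E1 \<in> sets M" "E2 \<in> sets M" unfolding E1_def E2_def by measurable
  have p1: "prob E1 \<le> den_rate \<epsilon> \<delta> (1 / T) / (c1 / 4)"
    by (rule L1_bound_Markov[OF den]) (use c1_pos in \<open>auto simp: E1_def\<close>)
  have p2: "prob E2 \<le> num_rate \<epsilon> \<delta> (1 / T) / (\<eta> * (c1 / (4 * Cq)))"
    by (rule L1_bound_Markov[OF num]) (use c1_pos C_pos \<eta> in \<open>auto simp: E2_def\<close>)
  have sub: "{\<omega>\<in>space M. \<eta> < \<bar>Pn N \<delta> \<omega> / Qn N \<delta> \<omega> - \<alpha> * Kh\<bar>} \<subseteq> E1 \<union> E2"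
  proof
    fix \<omega> assume w: "\<omega> \<in> {\<omega>\<in>space M. \<eta> < \<bar>Pn N \<delta> \<omega> / Qn N \<delta> \<omega> - \<alpha> * Kh\<bar>}"
    show "\<omega> \<in> E1 \<union> E2"
    proof (cases "c1 / 4 \<le> c1 / 2 - Cq * Qn N \<delta> \<omega>")
      case True then show ?thesis using w by (simp add: E1_def)
    next
      case False
      then have "c1 / 4 < Qn N \<delta> \<omega> * Cq" by (simp add: mult.commute)
      then have "c1 / 4 / Cq < Qn N \<delta> \<omega>" using C_pos(2) by (simp only: pos_divide_less_eq)
      then have Q: "c1 / (4 * Cq) < Qn N \<delta> \<omega>" by simp
      moreover have "0 < c1 / (4 * Cq)" using c1_pos C_pos(2) by simp
      ultimately have Q0: "0 < Qn N \<delta> \<omega>" by linarith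
      have "\<eta> * (c1 / (4 * Cq)) \<le> \<bar>Pn N \<delta> \<omega> / Qn N \<delta> \<omega> - \<alpha> * Kh\<bar> * Qn N \<delta> \<omega>"
        by (intro mult_mono) (use w Q \<eta> c1_pos C_pos(2) in auto)
      also have "\<dots> = \<bar>(Pn N \<delta> \<omega> / Qn N \<delta> \<omega> - \<alpha> * Kh) * Qn N \<delta> \<omega>\<bar>" using Q0 by (simp add: abs_mult)
      also have "(Pn N \<delta> \<omega> / Qn N \<delta> \<omega> - \<alpha> * Kh) * Qn N \<delta> \<omega> = Pn N \<delta> \<omega> - \<alpha> * Kh * Qn N \<delta> \<omega>"
        using Q0 by (simp add: left_diff_distrib)
      finally show ?thesis using w by (simp add: E2_def)
    qed
  qed
  have "prob {\<omega>\<in>space M. \<eta> < \<bar>Pn N \<delta> \<omega> / Qn N \<delta> \<omega> - \<alpha> * Kh\<bar>} \<le> prob (E1 \<union> E2)"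
    by (rule finite_measure_mono[OF sub]) measurable
  also have "\<dots> \<le> prob E1 + prob E2" by (rule measure_subadditive) (auto simp: emeasure_eq_measure)
  finally show ?thesis using p1 p2 unfolding T_def by linarith
qed

end

section \<open>Sampling scales and the final assembly\<close>

lemma smooth_real_derivatives:
  assumes "smooth_real f"
  obtains f2 where "\<And>x. (f has_real_derivative deriv f x) (at x)"
    "\<And>x. (deriv f has_real_derivative f2 x) (at x)" "continuous_on UNIV f2"
proof -
  obtain D where D: "D 0 = f" "\<And>n x. (D n has_real_derivative D (Suc n) x) (at x)"
    using assms unfolding smooth_real_def by blast
  have "deriv f = D 1" using D(2)[of 0] D(1) DERIV_imp_deriv by fastforce
  moreover have "continuous_on UNIV (D 2)"
    using D(2)[of 2] by (auto intro!: DERIV_isCont continuous_at_imp_continuous_on)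
  ultimately show ?thesis using D(2)[of 0] D(2)[of 1] D(1) by (intro that[of "D 2"]) (auto simp: numeral_2_eq_2)
qed

text \<open>The integer part loses at most 1, and \<open>\<epsilon> powr \<kappa>\<close> is at most
  1. So \<open>N * \<delta>\<close> is at least
  \<open>\<epsilon> powr - (\<gamma> - \<kappa>)\<close> minus 1, which tends to infinity.\<close>

lemma sampling_time_tendsto:
  assumes kappa: "0 < \<kappa>" and gamma: "\<kappa> < \<gamma>"
  shows "((\<lambda>\<epsilon>. 1 / (real (nat \<lfloor>\<epsilon> powr (- \<gamma>)\<rfloor>) * \<epsilon> powr \<kappa>)) \<longlongrightarrow> 0) (at_right (0 :: real))"
proof -
  have pow: "((\<lambda>\<epsilon>::real. \<epsilon> powr k) \<longlongrightarrow> 0) (at_right 0)" if "0 < k" for k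
    by (rule tendsto_zero_powrI[OF tendsto_ident_at tendsto_const _ that])
      (use eventually_at_right_less[of "0::real"] in \<open>auto elim!: eventually_mono\<close>)
  have inf: "filterlim (\<lambda>\<epsilon>::real. inverse (\<epsilon> powr (\<gamma> - \<kappa>))) at_top (at_right 0)"
  proof (rule filterlim_inverse_at_top[OF pow])
    show "eventually (\<lambda>\<epsilon>. 0 < \<epsilon> powr (\<gamma> - \<kappa>)) (at_right (0::real))"
      using eventually_at_right_less[of "0::real"] by eventually_elim simp
  qed (use gamma in simp)
  have "filterlim (\<lambda>\<epsilon>::real. - 1 + inverse (\<epsilon> powr (\<gamma> - \<kappa>))) at_top (at_right 0)"
    by (rule filterlim_tendsto_add_at_top[OF tendsto_const inf])
  then have "filterlim (\<lambda>\<epsilon>. real (nat \<lfloor>\<epsilon> powr (- \<gamma>)\<rfloor>) * \<epsilon> powr \<kappa>) at_top (at_right (0 :: real))"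
  proof (rule filterlim_at_top_mono)
    have "eventually (\<lambda>\<epsilon>::real. 0 < \<epsilon> \<and> \<epsilon> < 1) (at_right 0)"
      using eventually_at_right_real[of 0 1] by (simp add: greaterThanLessThan_iff)
    then show "eventually (\<lambda>\<epsilon>::real. - 1 + inverse (\<epsilon> powr (\<gamma> - \<kappa>)) \<le> real (nat \<lfloor>\<epsilon> powr (- \<gamma>)\<rfloor>) * \<epsilon> powr \<kappa>) (at_right 0)"
    proof eventually_elim
      case (elim \<epsilon>)
      have "\<epsilon> powr (- \<gamma>) - 1 \<le> real (nat \<lfloor>\<epsilon> powr (- \<gamma>)\<rfloor>)" by linarith
      from mult_right_mono[OF this, of "\<epsilon> powr \<kappa>"]
      have "\<epsilon> powr (- \<gamma>) * \<epsilon> powr \<kappa> - \<epsilon> powr \<kappa> \<le> real (nat \<lfloor>\<epsilon> powr (- \<gamma>)\<rfloor>) * \<epsilon> powr \<kappa>"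
        by (simp add: left_diff_distrib)
      moreover have "\<epsilon> powr (- \<gamma>) * \<epsilon> powr \<kappa> = inverse (\<epsilon> powr (\<gamma> - \<kappa>))"
        by (simp add: powr_add[symmetric] powr_minus[symmetric])
      moreover have "\<epsilon> powr \<kappa> \<le> 1" using elim kappa by (simp add: powr_le1)
      ultimately show ?case by linarith
    qed
  qed
  then show ?thesis by (intro tendsto_divide_0[OF tendsto_const] filterlim_at_top_imp_at_infinity)
qed

theorem theorem4p2:
  fixes \<alpha> \<sigma> L \<kappa> \<gamma> :: real
    and V p :: "real \<Rightarrow> real"
    and M :: "real \<Rightarrow> 'a measure"
    and X B :: "real \<Rightarrow> 'a \<Rightarrow> real \<Rightarrow> real"
  assumes alpha_pos: "\<alpha> > 0" and sigma_pos: "\<sigma> > 0"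
    and L_pos: "L > 0"
    and p_smooth: "smooth_real p" and p_periodic: "\<forall>x. p (x + L) = p x"
    and V_smooth: "smooth_real V"
    and V'_lipschitz: "\<exists>K. \<forall>x y. \<bar>deriv V x - deriv V y\<bar> \<le> K * \<bar>x - y\<bar>"
    and V_dissipative: "\<exists>a b. a > 0 \<and> b > 0 \<and> (\<forall>x. - deriv V x * x \<le> a - b * x\<^sup>2)"
    and V_integrable: "integrable lborel (\<lambda>x. exp (- (\<alpha> / \<sigma>) * V x))"
    and kappa: "0 < \<kappa>" "\<kappa> < 1" and gamma: "\<gamma> > \<kappa>"
    and prob: "\<forall>\<epsilon>>0. prob_space (M \<epsilon>)"
    and BM: "\<forall>\<epsilon>>0. brownian_motion_indep (M \<epsilon>) (\<lambda>\<omega>. X \<epsilon> \<omega> 0) (B \<epsilon>)"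
    and sol: "\<forall>\<epsilon>>0. AE \<omega> in M \<epsilon>. continuous_on {0..} (X \<epsilon> \<omega>) \<and>
               (\<forall>t\<ge>0. X \<epsilon> \<omega> t = X \<epsilon> \<omega> 0
                  + integral {0..t} (\<lambda>s. - \<alpha> * deriv V (X \<epsilon> \<omega> s)
                                        - (1 / \<epsilon>) * deriv p (X \<epsilon> \<omega> s / \<epsilon>))
                  + sqrt (2 * \<sigma>) * B \<epsilon> \<omega> t)"
    and invariant: "\<forall>\<epsilon>>0. \<forall>t\<ge>0. (\<lambda>\<omega>. X \<epsilon> \<omega> t) \<in> borel_measurable (M \<epsilon>) \<and>
               distr (M \<epsilon>) borel (\<lambda>\<omega>. X \<epsilon> \<omega> t) = distr (M \<epsilon>) borel (\<lambda>\<omega>. X \<epsilon> \<omega> 0)"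
  shows "converges_in_law
           (\<lambda>\<epsilon>. distr (M \<epsilon>) borel
              (\<lambda>\<omega>. drift_estimator (deriv V) (\<epsilon> powr \<kappa>) (nat \<lfloor>\<epsilon> powr (- \<gamma>)\<rfloor>) (X \<epsilon> \<omega>)))
           (return borel (\<alpha> * L\<^sup>2 /
              ((integral {0..L} (\<lambda>y. exp (- p y / \<sigma>))) * (integral {0..L} (\<lambda>y. exp (p y / \<sigma>))))))
           (at_right 0)"
proof -
  define Kh where "Kh = L\<^sup>2 / (integral {0..L} (\<lambda>y. exp (- p y / \<sigma>)) * integral {0..L} (\<lambda>y. exp (p y / \<sigma>)))"
  obtain ddp where dp: "\<And>x. (p has_real_derivative deriv p x) (at x)"
    "\<And>x. (deriv p has_real_derivative ddp x) (at x)" "continuous_on UNIV ddp"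
    using smooth_real_derivatives[OF p_smooth] by blast
  obtain K where K: "\<And>x y. \<bar>deriv V x - deriv V y\<bar> \<le> K * \<bar>x - y\<bar>" using V'_lipschitz by blast
  \<comment> \<open>The cell problem works with a positive Lipschitz constant, which this choice
    guarantees.\<close>
  define Kv where "Kv = \<bar>K\<bar> + 1"
  have Kv: "0 < Kv" "\<bar>deriv V x - deriv V y\<bar> \<le> Kv * \<bar>x - y\<bar>" for x y
  proof -
    show "0 < Kv" by (simp add: Kv_def)
    have "K * \<bar>x - y\<bar> \<le> Kv * \<bar>x - y\<bar>" unfolding Kv_def by (intro mult_right_mono) auto
    then show "\<bar>deriv V x - deriv V y\<bar> \<le> Kv * \<bar>x - y\<bar>" using K[of x y] by simp
  qed
  obtain a d where ad: "0 < a" "0 < d" "\<And>x. - deriv V x * x \<le> a - d * x\<^sup>2" using V_dissipative by blast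
  have diss: "d * x\<^sup>2 - a \<le> deriv V x * x" for x using ad(3)[of x] by simp
  obtain P \<kappa>0 s0 S1 CH CG q H G where
    cell: "cell_problem \<alpha> \<sigma> a d Kv P \<kappa>0 s0 S1 CH CG Kh (deriv V) p (deriv p) ddp q H G"
    unfolding Kh_def
    using periodic_cell_problem[OF alpha_pos sigma_pos L_pos Kv(2,1) diss ad(2,1) p_periodic[rule_format] dp] by blast
  interpret cell_problem \<alpha> \<sigma> a d Kv P \<kappa>0 s0 S1 CH CG Kh "deriv V" p "deriv p" ddp q H G by (rule cell)
  define \<delta> where "\<delta> \<epsilon> = \<epsilon> powr \<kappa>" for \<epsilon> :: real
  define N where "N \<epsilon> = nat \<lfloor>\<epsilon> powr (- \<gamma>)\<rfloor>" for \<epsilon> :: real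
  define \<tau> where "\<tau> \<epsilon> = 1 / (real (N \<epsilon>) * \<delta> \<epsilon>)" for \<epsilon>
  define U where "U \<epsilon> \<omega> = drift_estimator (deriv V) (\<delta> \<epsilon>) (N \<epsilon>) (X \<epsilon> \<omega>)" for \<epsilon> \<omega>
  have Vm [measurable]: "deriv V \<in> borel_measurable borel"
    by (rule borel_measurable_continuous_onI[OF Lipschitz_imp_continuous[OF dV_Lipschitz less_imp_le[OF Kv]]])
  have Um: "U \<epsilon> \<in> borel_measurable (M \<epsilon>)" if "0 < \<epsilon>" for \<epsilon>
  proof -
    have [measurable]: "(\<lambda>\<omega>. X \<epsilon> \<omega> (real n * \<delta> \<epsilon>)) \<in> borel_measurable (M \<epsilon>)"
      "(\<lambda>\<omega>. X \<epsilon> \<omega> (real (Suc n) * \<delta> \<epsilon>)) \<in> borel_measurable (M \<epsilon>)" for n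
      using invariant that by (auto simp: \<delta>_def simp del: of_nat_Suc)
    show ?thesis unfolding U_def drift_estimator_def by measurable
  qed
  have small: "eventually (\<lambda>\<epsilon>::real. 0 < \<epsilon> \<and> \<epsilon> < 1) (at_right 0)"
    using eventually_at_right_real[of 0 1] by (simp add: greaterThanLessThan_iff)
  have bound: "measure (M \<epsilon>) {\<omega>\<in>space (M \<epsilon>). \<eta> < \<bar>U \<epsilon> \<omega> - \<alpha> * Kh\<bar>}
      \<le> den_rate \<epsilon> (\<delta> \<epsilon>) (\<tau> \<epsilon>) / (c1 / 4) + num_rate \<epsilon> (\<delta> \<epsilon>) (\<tau> \<epsilon>) / (\<eta> * (c1 / (4 * Cq)))"
    if \<eta>: "0 < \<eta>" and \<epsilon>: "0 < \<epsilon> \<and> \<epsilon> < 1" for \<eta> \<epsilon>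
  proof -
    have e: "0 < \<epsilon>" "\<epsilon> \<le> 1" using \<epsilon> by auto
    interpret prob_space "M \<epsilon>" using prob e by blast
    interpret brownian "M \<epsilon>" "\<lambda>\<omega>. X \<epsilon> \<omega> 0" "B \<epsilon>" by unfold_locales (use BM e in blast)
    have c: "0 < sqrt (2 * \<sigma>)" and K0: "0 \<le> \<alpha> * Kv + P / \<epsilon>\<^sup>2"
      using sigma_pos alpha_pos Kv(1) cell_constants(5) by auto
    have sol': "AE \<omega> in M \<epsilon>. continuous_on {0..} (X \<epsilon> \<omega>) \<and>
      (\<forall>t\<ge>0. X \<epsilon> \<omega> t = X \<epsilon> \<omega> 0 + integral {0..t} (\<lambda>s. drift \<epsilon> (X \<epsilon> \<omega> s)) + sqrt (2 * \<sigma>) * B \<epsilon> \<omega> t)"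
      using sol e(1) unfolding drift_def by blast
    have meas: "(\<lambda>\<omega>. X \<epsilon> \<omega> t) \<in> borel_measurable (M \<epsilon>)"
      and inv: "distr (M \<epsilon>) borel (\<lambda>\<omega>. X \<epsilon> \<omega> t) = distr (M \<epsilon>) borel (\<lambda>\<omega>. X \<epsilon> \<omega> 0)" if "0 \<le> t" for t
      using invariant e(1) that by blast+
    note ss = adapted_sde_solution[where X = "X \<epsilon>", OF refl drift_Lipschitz[OF e(1)] K0 c sol' meas inv]
    \<comment> \<open>From here on the adapted version takes the place of the given process; the
      estimator is transferred back through their almost sure equality.\<close>
    define Y where "Y = solution (drift \<epsilon>) (sqrt (2 * \<sigma>))"
    interpret A: adapted_sde "M \<epsilon>" hist Y "\<lambda>t \<omega>. B \<epsilon> \<omega> t" "drift \<epsilon>" "sqrt (2 * \<sigma>)" "\<alpha> * Kv + P / \<epsilon>\<^sup>2"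
      unfolding Y_def by (rule ss(2))
    obtain A where A: "\<And>x. drift \<epsilon> x * x \<le> A - \<alpha> * d / 2 * x\<^sup>2" using drift_dissipative[OF e(1)] by blast
    have sq: "integrable (M \<epsilon>) (\<lambda>\<omega>. (Y 0 \<omega>)\<^sup>2)"
      by (rule A.square_integrable_of_dissipative[OF A]) (use alpha_pos ad in simp)
    interpret S: multiscale_sde \<alpha> \<sigma> a d Kv P \<kappa>0 s0 S1 CH CG Kh "deriv V" p "deriv p" ddp q H G \<epsilon> "M \<epsilon>" hist Y "\<lambda>t \<omega>. B \<epsilon> \<omega> t"
      by unfold_locales (use sq e in auto)
    have \<delta>: "0 < \<delta> \<epsilon>" "\<delta> \<epsilon> \<le> 1" using e kappa(1) by (auto simp: \<delta>_def powr_le1)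
    have N: "0 < N \<epsilon>"
    proof -
      have "1 \<le> \<epsilon> powr (- \<gamma>)" using e kappa gamma by (simp add: powr_minus powr_le1 one_le_inverse)
      then show ?thesis unfolding N_def by simp
    qed
    have YX: "AE \<omega> in M \<epsilon>. \<forall>t\<ge>0. Y t \<omega> = X \<epsilon> \<omega> t" unfolding Y_def by (rule ss(1))
    have "AE \<omega> in M \<epsilon>. U \<epsilon> \<omega> = S.Pn (N \<epsilon>) (\<delta> \<epsilon>) \<omega> / S.Qn (N \<epsilon>) (\<delta> \<epsilon>) \<omega>"
      using YX
    proof eventually_elim
      case (elim \<omega>)
      show ?case unfolding U_def by (rule S.drift_estimator_eq[OF N \<delta>(1)]) (use elim in simp)
    qed
    note PQ = this
    have mX [measurable]: "Y (real n * \<delta> \<epsilon>) \<in> borel_measurable (M \<epsilon>)" "Y (real (Suc n) * \<delta> \<epsilon>) \<in> borel_measurable (M \<epsilon>)" for n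
      using \<delta> by (auto intro!: A.X_measurable mult_nonneg_nonneg simp del: of_nat_Suc)
    have [measurable]: "S.Qn (N \<epsilon>) (\<delta> \<epsilon>) \<in> borel_measurable (M \<epsilon>)" "S.Pn (N \<epsilon>) (\<delta> \<epsilon>) \<in> borel_measurable (M \<epsilon>)"
      unfolding S.Qn_def[abs_def] S.Pn_def[abs_def] by measurable
    have [measurable]: "U \<epsilon> \<in> borel_measurable (M \<epsilon>)" by (rule Um[OF e(1)])
    have "measure (M \<epsilon>) {\<omega>\<in>space (M \<epsilon>). \<eta> < \<bar>U \<epsilon> \<omega> - \<alpha> * Kh\<bar>} =
      measure (M \<epsilon>) {\<omega>\<in>space (M \<epsilon>). \<eta> < \<bar>S.Pn (N \<epsilon>) (\<delta> \<epsilon>) \<omega> / S.Qn (N \<epsilon>) (\<delta> \<epsilon>) \<omega> - \<alpha> * Kh\<bar>}"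
      by (rule measure_eq_AE) (use PQ in \<open>auto elim!: eventually_mono\<close>)
    then show ?thesis using S.estimator_deviation[OF N \<delta> \<eta>] by (simp add: \<tau>_def)
  qed
  have id: "((\<lambda>\<epsilon>::real. \<epsilon>) \<longlongrightarrow> 0) (at_right 0)" by (rule tendsto_ident_at)
  have pow: "((\<lambda>\<epsilon>::real. \<epsilon> powr k) \<longlongrightarrow> 0) (at_right 0)" if "0 < k" for k
    by (rule tendsto_zero_powrI[OF id tendsto_const _ that])
      (use small in \<open>auto elim!: eventually_mono\<close>)
  \<comment> \<open>Here \<kappa> < 1 enters: the ratio is
    \<open>\<epsilon> powr (1 - \<kappa>)\<close>.\<close>
  have ratio: "((\<lambda>\<epsilon>. \<epsilon> / \<delta> \<epsilon>) \<longlongrightarrow> 0) (at_right 0)"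
  proof (rule tendsto_cong[THEN iffD1, OF _ pow[of "1 - \<kappa>"]])
    show "eventually (\<lambda>\<epsilon>. \<epsilon> powr (1 - \<kappa>) = \<epsilon> / \<delta> \<epsilon>) (at_right 0)"
      using small by eventually_elim (simp add: \<delta>_def powr_diff)
  qed (use kappa in simp)
  have \<tau>0: "(\<tau> \<longlongrightarrow> 0) (at_right 0)"
    unfolding \<tau>_def[abs_def] \<delta>_def N_def by (rule sampling_time_tendsto[OF kappa(1) gamma])
  have \<delta>0: "(\<delta> \<longlongrightarrow> 0) (at_right 0)" unfolding \<delta>_def[abs_def] by (rule pow[OF kappa(1)])
  note rates = rates_tendsto_0[OF id \<delta>0 \<tau>0 ratio]
  have "converges_in_law (\<lambda>\<epsilon>. distr (M \<epsilon>) borel (U \<epsilon>)) (return borel (\<alpha> * Kh)) (at_right 0)"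
  proof (rule converges_in_law_const)
    show "eventually (\<lambda>\<epsilon>. prob_space (M \<epsilon>)) (at_right 0)"
      using small by eventually_elim (use prob in blast)
    show "eventually (\<lambda>\<epsilon>. U \<epsilon> \<in> borel_measurable (M \<epsilon>)) (at_right 0)"
      using small by eventually_elim (use Um in blast)
    fix \<eta> :: real assume \<eta>: "0 < \<eta>"
    show "((\<lambda>\<epsilon>. measure (M \<epsilon>) {\<omega>\<in>space (M \<epsilon>). \<eta> < \<bar>U \<epsilon> \<omega> - \<alpha> * Kh\<bar>}) \<longlongrightarrow> 0) (at_right 0)"
    proof (rule tendsto_sandwich[OF _ _ tendsto_const])
      show "eventually (\<lambda>\<epsilon>. 0 \<le> measure (M \<epsilon>) {\<omega>\<in>space (M \<epsilon>). \<eta> < \<bar>U \<epsilon> \<omega> - \<alpha> * Kh\<bar>}) (at_right 0)" by simp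
      show "eventually (\<lambda>\<epsilon>. measure (M \<epsilon>) {\<omega>\<in>space (M \<epsilon>). \<eta> < \<bar>U \<epsilon> \<omega> - \<alpha> * Kh\<bar>}
        \<le> den_rate \<epsilon> (\<delta> \<epsilon>) (\<tau> \<epsilon>) / (c1 / 4) + num_rate \<epsilon> (\<delta> \<epsilon>) (\<tau> \<epsilon>) / (\<eta> * (c1 / (4 * Cq)))) (at_right 0)"
        using small by eventually_elim (rule bound[OF \<eta>])
      have "((\<lambda>\<epsilon>. den_rate \<epsilon> (\<delta> \<epsilon>) (\<tau> \<epsilon>) / (c1 / 4) + num_rate \<epsilon> (\<delta> \<epsilon>) (\<tau> \<epsilon>) / (\<eta> * (c1 / (4 * Cq))))
        \<longlongrightarrow> 0 / (c1 / 4) + 0 / (\<eta> * (c1 / (4 * Cq)))) (at_right 0)"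
        by (intro tendsto_intros rates) (use c1_pos C_pos \<eta> in auto)
      then show "((\<lambda>\<epsilon>. den_rate \<epsilon> (\<delta> \<epsilon>) (\<tau> \<epsilon>) / (c1 / 4) + num_rate \<epsilon> (\<delta> \<epsilon>) (\<tau> \<epsilon>) / (\<eta> * (c1 / (4 * Cq)))) \<longlongrightarrow> 0) (at_right 0)"
        by simp
    qed
  qed
  then show ?thesis unfolding U_def[abs_def] \<delta>_def N_def Kh_def by simp
qed

end
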